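(* Let $N\in\mathbb N$, $R>0$, $C>0$, $c_0>1$ and $\omega_N=N^{1/3}(\Omega\log N)^{2/3}$, where $\Omega=\Omega(N)>0$ satisfies $\Omega=o(N^{1/15}/\log N)$. Let $\{U_k\}_{k=1}^N$ be independent random matrices of the form $$U_k=\begin{pmatrix}1&\eta_{k,12}\\ \eta_{k,21}&\rho_k-\eta_{k,22}\end{pmatrix},$$ where, with $\hat k=N-k$, $\rho_k\in\mathbb C$ is deterministic with $|\rho_k|\le\exp\Big(-c_0\sqrt{\frac{\omega_N+\hat k}{N}}\Big)$ and the (complex) random variables $\{\eta_{k,ij}\}_{i,j\in\{1,2\}}$ satisfy for all $k\in\{1,\dots,N\}$ $$|\mathbb E\eta_{k,ij}|\le\frac{C}{\omega_N+\hat k},\qquad \operatorname{Var}(\eta_{k,ij})\le\frac{C}{\omega_N+\hat k},\qquad |\eta_{k,ij}|\le\sqrt{\frac{R\,\Omega\log N}{\omega_N+\hat k}} .$$ Then there exists a small constant $c_R>0$ such that if $N$ is sufficiently large (depending on $C,R$ and $\Omega$), for any $\varepsilon\ge(\Omega\log N)^{-1/2}$, $$\mathbb P\left[\left\|\prod_{k=1}^NU_k-\begin{pmatrix}1&0\\0&0\end{pmatrix}\right\|\ge\varepsilon\right]\le N^{-c_R\varepsilon^2\Omega}+c_R^{-1}N^{4-R\Omega}.$$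
   Context: $\prod_{k=1}^NU_k=U_NU_{N-1}\cdots U_1$ and $\|\cdot\|$ is the operator norm. The parameter $\Omega>0$ may vary with $N$ while $C,R,c_0,c_R$ are fixed constants (not depending on $N$). *)

theory Defs
  imports "HOL-Probability.Probability" "HOL-Library.Landau_Symbols"
begin

text \<open>
  The operator norm is taken with respect to the Euclidean norm on \<open>\<complex>\<^sup>2\<close>, which is the
  library norm on \<^typ>\<open>complex ^ 2\<close>.
\<close>
definition op_norm :: "complex ^ 2 ^ 2 \<Rightarrow> real" where
  "op_norm A = onorm (\<lambda>v. A *v v)"

text \<open>
  \<open>mat_prod U N = U N ** \<dots> ** U 1\<close>: factors with larger index stand on the left. (The
  multiplication \<open>*\<close> of the type class instance for vectors is componentwise and is not used.)
\<close>
primrec mat_prod :: "(nat \<Rightarrow> complex ^ 2 ^ 2) \<Rightarrow> nat \<Rightarrow> complex ^ 2 ^ 2" where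
  "mat_prod U 0 = mat 1"
| "mat_prod U (Suc n) = U (Suc n) ** mat_prod U n"

text \<open>
  Variance of a complex random variable, \<open>E \<bar>X - E X\<bar>\<^sup>2\<close>; the library's \<open>variance\<close>
  squares without taking the modulus and so is only meaningful for real random variables.
\<close>
definition complex_variance :: "'a measure \<Rightarrow> ('a \<Rightarrow> complex) \<Rightarrow> real" where
  "complex_variance M X = (LINT w|M. (cmod (X w - (LINT v|M. X v)))\<^sup>2)"

text \<open>The argument \<open>\<Omega>\<close> is the value of the parameter at the given \<open>N\<close>.\<close>
definition omega :: "nat \<Rightarrow> real \<Rightarrow> real" where
  "omega N \<Omega> = real N powr (1/3) * (\<Omega> * ln (real N)) powr (2/3)"

text \<open>The perturbation \<open>e 1 1\<close> does not enter the matrix.\<close>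
definition transfer_matrix :: "complex \<Rightarrow> (2 \<Rightarrow> 2 \<Rightarrow> complex) \<Rightarrow> complex ^ 2 ^ 2" where
  "transfer_matrix r e = vector [vector [1, e 1 2], vector [e 2 1, r - e 2 2]]"

end

theory Submission
  imports Defs "HOL-Real_Asymp.Real_Asymp"
begin

text \<open>
  Write \<open>L = \<Omega> log N\<close>, so that \<open>\<omega>\<^sup>3 = L\<^sup>2 N\<close>. If \<open>R \<Omega> \<le> 4\<close>, the second term of the bound is at
  least \<open>1\<close>; otherwise \<open>L \<ge> (4 / R) log N\<close> is large. Let \<open>(x, y)\<close> be a column of the partial products.
  The second entry is damped at the rate \<open>\<gamma>\<^sub>k = (s\<^sub>k / N)\<^sup>1\<^sup>/\<^sup>2\<close>, \<open>s\<^sub>k = \<omega> + N - k\<close>, and driven by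
  noise of variance of order \<open>1 / s\<^sub>k\<close>, hence \<open>|y|\<^sup>2\<close> is of order \<open>L\<^sup>-\<^sup>1\<close> at the end, and so is \<open>|x - 1|\<^sup>2\<close>.

  For large deviations, \<open>(e + |x - x\<^sub>*|\<^sup>2 + A\<^sub>k |y|\<^sup>2)\<^sup>p\<close> with \<open>p\<close> a small multiple of \<open>L e\<close> is a
  supermartingale up to summable factors, if \<open>A\<^sub>k\<close> is a multiple of \<open>(p / L) \<omega> / s\<^sub>k\<close> plus a weight decaying
  at the rate \<open>\<gamma>\<close> away from the final time: the damping of \<open>y\<close> absorbs all fluctuations.
  Markov's inequality with \<open>e\<close> proportional to \<open>\<epsilon>\<^sup>2\<close> (or \<open>e = 1\<close> for large \<open>\<epsilon>\<close>) gives \<open>K exp (- c \<epsilon>\<^sup>2 L)\<close>.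

  The constant \<open>K\<close> cannot be absorbed when \<open>\<epsilon>\<^sup>2 L\<close> is bounded. There one needs that the
  deviation is below \<open>L\<^sup>-\<^sup>1\<^sup>/\<^sup>2 / 2\<close> with probability bounded away from \<open>0\<close>. The functional
  \<open>exp (i Re (b (x - 1) + a\<^sub>k y) - P\<^sub>k y - g\<^sub>k)\<close>, with a quadratic form \<open>P\<^sub>k \<ge> 0\<close> and \<open>g\<^sub>k \<ge> 0\<close> determined
  backwards in \<open>k\<close>, is almost a martingale. So the characteristic function of the rescaled deviation is nearly
  nonnegative on bounded sets, and testing it against a product of even powers of cosines, whose Fourier
  coefficients are nonnegative, bounds the mass of a small ball from below.
\<close>

section \<open>Independent factors and column norms\<close>

text \<open>The step x -> x + e1 * y has a conditional variance of order |y|^2 / s_k, which is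
  itself random. In the Lyapunov function the damping pays for it: a rate of order gamma_k A_k must
  exceed a multiple of p / s_k, and gamma_k \<ge> L / omega turns this into the lower bound (p / L)
  omega / s_k for A_k. The price of a weight is the forcing of y by x, of order p A_k / (e s_k) per
  step; its sum is a small multiple of p if p is a small multiple of L e. As e \<le> 1, p never
  exceeds order L and the tail in \<epsilon> is only polynomial. Hence beyond a constant value of
  \<epsilon> the bound exp (- R L), covered by the second term of the theorem, replaces the Gaussian
  one. In the characteristic functional P_k carries the conditional variance backwards, so no law of
  large numbers for the sum of |y|^2 / s_k is needed. Both E |e1|^2 and E e1^2 enter (centred),
  hence a general real quadratic form. The growth condition on \<Omega> yields L^3 \<le> N^(-8/45)
  omega: L times the noise bound sqrt (R L / omega) tends to 0, and with it the errors of the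
  functional.\<close>

lemma (in prob_space) indep_var_pair_distr:
  assumes "indep_var S X T Y"
  shows "pair_sigma_finite (distr M S X) (distr M T Y)"
    and "X \<in> measurable M S" and "Y \<in> measurable M T"
    and "distr M S X \<Otimes>\<^sub>M distr M T Y = distr M (S \<Otimes>\<^sub>M T) (\<lambda>w. (X w, Y w))"
proof -
  show X: "X \<in> measurable M S" and Y: "Y \<in> measurable M T"
    and "distr M S X \<Otimes>\<^sub>M distr M T Y = distr M (S \<Otimes>\<^sub>M T) (\<lambda>w. (X w, Y w))"
    using assms by (auto simp: indep_var_distribution_eq)
  interpret X: prob_space "distr M S X" using X by (rule prob_space_distr)
  interpret Y: prob_space "distr M T Y" using Y by (rule prob_space_distr)
  show "pair_sigma_finite (distr M S X) (distr M T Y)" ..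
qed

text \<open>Fubini for the joint law. It stands in for conditioning on the past: the new factor is
  averaged while the partial product is frozen. This version serves the Lyapunov moments, the
  bounded one below the characteristic functional.\<close>

lemma (in prob_space) nn_integral_indep_var:
  fixes h :: "_ \<Rightarrow> ennreal"
  assumes ind: "indep_var S X T Y" and h: "h \<in> borel_measurable (S \<Otimes>\<^sub>M T)"
  shows "(\<integral>\<^sup>+w. h (X w, Y w) \<partial>M) = (\<integral>\<^sup>+w. (\<integral>\<^sup>+v. h (X v, Y w) \<partial>M) \<partial>M)"
proof -
  note P = indep_var_pair_distr[OF ind]
  interpret pair_sigma_finite "distr M S X" "distr M T Y" by (rule P(1))
  note [measurable] = P(2,3) h
  have "(\<integral>\<^sup>+w. h (X w, Y w) \<partial>M) = (\<integral>\<^sup>+z. h z \<partial>(distr M (S \<Otimes>\<^sub>M T) (\<lambda>w. (X w, Y w))))"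
    by (simp add: nn_integral_distr)
  also have "\<dots> = (\<integral>\<^sup>+z. h z \<partial>(distr M S X \<Otimes>\<^sub>M distr M T Y))" using P(4) by simp
  also have "\<dots> = (\<integral>\<^sup>+y. (\<integral>\<^sup>+x. h (x, y) \<partial>distr M S X) \<partial>distr M T Y)"
    by (rule nn_integral_snd[symmetric]) measurable
  also have "\<dots> = (\<integral>\<^sup>+w. (\<integral>\<^sup>+x. h (x, Y w) \<partial>distr M S X) \<partial>M)"
    by (rule nn_integral_distr) measurable
  also have "\<dots> = (\<integral>\<^sup>+w. (\<integral>\<^sup>+v. h (X v, Y w) \<partial>M) \<partial>M)"
  proof (rule nn_integral_cong)
    fix w assume w: "w \<in> space M"
    then have "Y w \<in> space T" using P(3) by (rule measurable_space[rotated])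
    then show "(\<integral>\<^sup>+x. h (x, Y w) \<partial>distr M S X) = (\<integral>\<^sup>+v. h (X v, Y w) \<partial>M)"
      by (intro nn_integral_distr) measurable
  qed
  finally show ?thesis .
qed

lemma (in prob_space) integral_indep_var:
  fixes h :: "_ \<Rightarrow> 'b::{banach, second_countable_topology}"
  assumes ind: "indep_var S X T Y" and h: "h \<in> borel_measurable (S \<Otimes>\<^sub>M T)"
    and bd: "\<And>z. norm (h z) \<le> K"
  shows "(\<integral>w. h (X w, Y w) \<partial>M) = (\<integral>w. (\<integral>v. h (X v, Y w) \<partial>M) \<partial>M)"
proof -
  note P = indep_var_pair_distr[OF ind]
  interpret pair_sigma_finite "distr M S X" "distr M T Y" by (rule P(1))
  note [measurable] = P(2,3) h
  interpret X: prob_space "distr M S X" using P(2) by (rule prob_space_distr)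
  interpret Y: prob_space "distr M T Y" using P(3) by (rule prob_space_distr)
  interpret XY: pair_prob_space "distr M S X" "distr M T Y" ..
  have int: "integrable (distr M S X \<Otimes>\<^sub>M distr M T Y) (case_prod (\<lambda>x y. h (x, y)))"
    by (rule XY.integrable_const_bound[where B = K]) (auto simp: bd split: prod.split)
  have "(\<integral>w. h (X w, Y w) \<partial>M) = (\<integral>z. h z \<partial>(distr M (S \<Otimes>\<^sub>M T) (\<lambda>w. (X w, Y w))))"
    by (simp add: integral_distr)
  also have "\<dots> = (\<integral>z. case_prod (\<lambda>x y. h (x, y)) z \<partial>(distr M S X \<Otimes>\<^sub>M distr M T Y))" using P(4) by simp
  also have "\<dots> = (\<integral>y. (\<integral>x. h (x, y) \<partial>distr M S X) \<partial>distr M T Y)"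
    using integral_snd[OF int] by simp
  also have "\<dots> = (\<integral>w. (\<integral>x. h (x, Y w) \<partial>distr M S X) \<partial>M)"
    by (rule integral_distr) measurable
  also have "\<dots> = (\<integral>w. (\<integral>v. h (X v, Y w) \<partial>M) \<partial>M)"
  proof (rule Bochner_Integration.integral_cong[OF refl])
    fix w assume w: "w \<in> space M"
    then have "Y w \<in> space T" using P(3) by (rule measurable_space[rotated])
    then show "(\<integral>x. h (x, Y w) \<partial>distr M S X) = (\<integral>v. h (X v, Y w) \<partial>M)"
      by (intro integral_distr) measurable
  qed
  finally show ?thesis .
qed

section \<open>Measurability and independence of the partial products\<close>

lemma borel_measurable_matrix_mult:
  "(\<lambda>(A, B). A ** B) \<in> borel_measurable (borel \<Otimes>\<^sub>M (borel :: (complex ^ 2 ^ 2) measure))"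
  unfolding borel_prod
  by (rule borel_measurable_continuous_onI)
    (auto simp: matrix_matrix_mult_def case_prod_unfold intro!: continuous_intros)

lemma borel_measurable_matrix_vector_mult:
  "(\<lambda>(A, v). A *v v) \<in> borel_measurable ((borel :: (complex ^ 2 ^ 2) measure) \<Otimes>\<^sub>M borel)"
  unfolding borel_prod
  by (rule borel_measurable_continuous_onI)
    (auto simp: matrix_vector_mult_def case_prod_unfold intro!: continuous_intros)

lemma borel_measurable_mat_prod_PiM:
  assumes "{1..n} \<subseteq> J"
  shows "(\<lambda>f. mat_prod f n) \<in> borel_measurable (PiM J (\<lambda>_. borel))"
  using assms
proof (induction n)
  case (Suc n)
  have [measurable]: "(\<lambda>f. f (Suc n)) \<in> borel_measurable (PiM J (\<lambda>_. borel))"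
    using Suc.prems by (intro measurable_component_singleton) auto
  have [measurable]: "(\<lambda>f. mat_prod f n) \<in> borel_measurable (PiM J (\<lambda>_. borel))"
    by (rule Suc.IH) (use Suc.prems in auto)
  have "(\<lambda>f. (\<lambda>(A, B). A ** B) (f (Suc n), mat_prod f n)) \<in> borel_measurable (PiM J (\<lambda>_. borel))"
    by (rule measurable_compose[OF _ borel_measurable_matrix_mult]) measurable
  then show ?case by simp
qed simp

lemma mat_prod_cong: "(\<And>j. j \<in> {1..n} \<Longrightarrow> f j = g j) \<Longrightarrow> mat_prod f n = mat_prod g n"
  by (induction n) auto

text \<open>Both sides are measurable functions of the disjoint blocks \<open>{Suc k}\<close> and
  \<open>{1..k}\<close> of the independent family; \<open>mat_prod\<close> reads only the indices
  from 1 to k, so restricting the family leaves it unchanged.\<close>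

lemma (in prob_space) indep_var_mat_prod_step:
  fixes U :: "nat \<Rightarrow> 'a \<Rightarrow> complex ^ 2 ^ 2"
  assumes ind: "indep_vars (\<lambda>_. borel) U {1..N}" and k: "k < N"
  shows "indep_var borel (U (Suc k)) borel (\<lambda>w. mat_prod (\<lambda>j. U j w) k)"
proof -
  have "indep_var (PiM {Suc k} (\<lambda>_. borel)) (\<lambda>w. restrict (\<lambda>i. U i w) {Suc k})
          (PiM {1..k} (\<lambda>_. borel)) (\<lambda>w. restrict (\<lambda>i. U i w) {1..k})"
    using k by (intro indep_var_restrict[OF ind]) auto
  moreover have "(\<lambda>f. f (Suc k)) \<in> borel_measurable (PiM {Suc k} (\<lambda>_. borel :: (complex^2^2) measure))"
    by (intro measurable_component_singleton) auto
  moreover have "(\<lambda>f. mat_prod f k) \<in> borel_measurable (PiM {1..k} (\<lambda>_. borel))"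
    by (rule borel_measurable_mat_prod_PiM) simp
  ultimately have "indep_var borel ((\<lambda>f. f (Suc k)) \<circ> (\<lambda>w. restrict (\<lambda>i. U i w) {Suc k}))
     borel ((\<lambda>f. mat_prod f k) \<circ> (\<lambda>w. restrict (\<lambda>i. U i w) {1..k}))"
    by (rule indep_var_compose)
  moreover have "mat_prod (restrict (\<lambda>i. U i w) {1..k}) k = mat_prod (\<lambda>i. U i w) k" for w
    by (rule mat_prod_cong) auto
  ultimately show ?thesis by (simp add: comp_def)
qed

lemma (in prob_space) mat_prod_step_measurable:
  fixes U :: "nat \<Rightarrow> 'a \<Rightarrow> complex ^ 2 ^ 2"
  assumes ind: "indep_vars (\<lambda>_. borel) U {1..N}" and k: "k \<le> N"
  shows "(\<lambda>w. mat_prod (\<lambda>j. U j w) k *v v) \<in> borel_measurable M"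
  using k
proof (induction k)
  case (Suc k)
  have [measurable]: "(\<lambda>w. mat_prod (\<lambda>j. U j w) k *v v) \<in> borel_measurable M" using Suc by simp
  have [measurable]: "U (Suc k) \<in> borel_measurable M" using ind Suc by (auto simp: indep_vars_def)
  have "(\<lambda>w. (\<lambda>(A, u). A *v u) (U (Suc k) w, mat_prod (\<lambda>j. U j w) k *v v)) \<in> borel_measurable M"
    by (rule measurable_compose[OF _ borel_measurable_matrix_vector_mult]) measurable
  then show ?case by (simp add: matrix_vector_mul_assoc)
qed simp

lemma (in prob_space) nn_integral_mat_prod_step:
  fixes U :: "nat \<Rightarrow> 'a \<Rightarrow> complex ^ 2 ^ 2" and h :: "complex ^ 2 \<Rightarrow> ennreal"
  assumes ind: "indep_vars (\<lambda>_. borel) U {1..N}" and k: "k < N" and h[measurable]: "h \<in> borel_measurable borel"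
  shows "(\<integral>\<^sup>+w. h (mat_prod (\<lambda>j. U j w) (Suc k) *v v) \<partial>M)
       = (\<integral>\<^sup>+w. (\<integral>\<^sup>+w'. h (U (Suc k) w' *v (mat_prod (\<lambda>j. U j w) k *v v)) \<partial>M) \<partial>M)"
proof -
  have "(\<lambda>p. h (fst p *v (snd p *v v))) \<in> borel_measurable (borel \<Otimes>\<^sub>M borel)"
    unfolding borel_prod
    by (rule measurable_compose[OF _ h], rule borel_measurable_continuous_onI)
      (auto simp: matrix_vector_mult_def intro!: continuous_intros)
  from nn_integral_indep_var[OF indep_var_mat_prod_step[OF ind k] this]
  show ?thesis by (simp add: matrix_vector_mul_assoc)
qed

lemma (in prob_space) integral_mat_prod_step:
  fixes U :: "nat \<Rightarrow> 'a \<Rightarrow> complex ^ 2 ^ 2" and h :: "complex ^ 2 \<Rightarrow> complex"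
  assumes ind: "indep_vars (\<lambda>_. borel) U {1..N}" and k: "k < N" and h[measurable]: "h \<in> borel_measurable borel"
    and bd: "\<And>z. cmod (h z) \<le> K"
  shows "(\<integral>w. h (mat_prod (\<lambda>j. U j w) (Suc k) *v v) \<partial>M)
       = (\<integral>w. (\<integral>w'. h (U (Suc k) w' *v (mat_prod (\<lambda>j. U j w) k *v v)) \<partial>M) \<partial>M)"
proof -
  have "(\<lambda>p. h (fst p *v (snd p *v v))) \<in> borel_measurable (borel \<Otimes>\<^sub>M borel)"
    unfolding borel_prod
    by (rule measurable_compose[OF _ h], rule borel_measurable_continuous_onI)
      (auto simp: matrix_vector_mult_def intro!: continuous_intros)
  from integral_indep_var[OF indep_var_mat_prod_step[OF ind k] this, of K] bd
  show ?thesis by (simp add: matrix_vector_mul_assoc)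
qed

text \<open>Reduces the theorem to two vector-valued chains, started at (1, 0) and (0, 1).\<close>

lemma op_norm_le_column_norms:
  fixes A :: "complex ^ 2 ^ 2"
  shows "op_norm A \<le> norm (A *v vector [1, 0]) + norm (A *v vector [0, 1])"
  unfolding op_norm_def
proof (rule onorm_bound)
  fix v :: "complex ^ 2"
  have "v = v $ 1 *s vector [1, 0] + v $ 2 *s vector [0, 1]"
    by (simp add: vec_eq_iff forall_2 vector_2)
  then have "A *v v = v $ 1 *s (A *v vector [1, 0]) + v $ 2 *s (A *v vector [0, 1])"
    by (metis matrix_vector_right_distrib vector_scalar_commute)
  moreover have scal: "norm (c *s u) = cmod c * norm u" for c and u :: "complex ^ 2"
    by (simp add: norm_vec_def L2_set_def sum_2 norm_mult power_mult_distrib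
        flip: distrib_left) (simp add: real_sqrt_mult)
  ultimately have "norm (A *v v) \<le> cmod (v $ 1) * norm (A *v vector [1, 0])
      + cmod (v $ 2) * norm (A *v vector [0, 1])"
    by (metis norm_triangle_ineq)
  also have "\<dots> \<le> norm v * norm (A *v vector [1, 0]) + norm v * norm (A *v vector [0, 1])"
    by (intro add_mono mult_right_mono) (auto intro: Finite_Cartesian_Product.norm_nth_le)
  finally show "norm (A *v v) \<le> (norm (A *v vector [1, 0]) + norm (A *v vector [0, 1])) * norm v"
    by (simp add: algebra_simps)
qed simp

lemma norm_cvec2_sq: "(norm (v :: complex ^ 2))\<^sup>2 = (cmod (v $ 1))\<^sup>2 + (cmod (v $ 2))\<^sup>2"
  by (simp add: norm_vec_def L2_set_def sum_2)

lemma transfer_matrix_mult_nth: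
  "(transfer_matrix r e *v v) $ 1 = v $ 1 + e 1 2 * v $ 2"
  "(transfer_matrix r e *v v) $ 2 = r * v $ 2 + (e 2 1 * v $ 1 - e 2 2 * v $ 2)"
  by (simp_all add: transfer_matrix_def matrix_vector_mult_def sum_2 vector_2 algebra_simps)

section \<open>One step of the Lyapunov functional\<close>

text \<open>For negative t put x = -t. The Taylor bound exp x \<ge> 1 + x + x^2 / 2 suffices,
  because its product with 1 - x + x^2 exceeds 1 by x^2 / 2 + x^3 / 2 + x^4 / 2.\<close>

lemma exp_le_quadratic:
  fixes t :: real
  assumes "\<bar>t\<bar> \<le> 1"
  shows "exp t \<le> 1 + t + t\<^sup>2"
proof (cases "0 \<le> t")
  case True
  then show ?thesis using exp_bound assms by auto
next
  case False
  define x where "x = - t"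
  have x: "0 \<le> x" "x \<le> 1" using False assms by (auto simp: x_def)
  have pos: "0 < 1 + x + x\<^sup>2 / 2" using x by (auto intro!: add_pos_nonneg)
  have "1 \<le> 1 + x\<^sup>2 / 2 + x^3 / 2 + x^4 / 2" using x by simp
  also have "\<dots> = (1 - x + x\<^sup>2) * (1 + x + x\<^sup>2 / 2)"
    by (simp add: power2_eq_square power3_eq_cube power4_eq_xxxx field_simps)
  also have "\<dots> \<le> (1 - x + x\<^sup>2) * exp x"
  proof (rule mult_left_mono[OF exp_lower_Taylor_quadratic[OF x(1)]])
    show "0 \<le> 1 - x + x\<^sup>2" using x by simp
  qed
  finally have "1 / exp x \<le> 1 - x + x\<^sup>2" by (simp add: field_simps)
  then show ?thesis by (simp add: x_def exp_minus field_simps)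
qed

text \<open>\<open>l\<close> will be a fluctuation whose mean is much smaller than its size, so it
  must survive with coefficient 1; the nonnegative second-order part \<open>k\<close> may lose a
  factor.\<close>

lemma exp_le_linear_plus_squares:
  fixes l k :: real
  assumes "\<bar>l\<bar> \<le> 1/2" "0 \<le> k" "k \<le> 1/2"
  shows "exp (l + k) \<le> 1 + l + 2 * k + 2 * l\<^sup>2"
proof -
  have "exp (l + k) \<le> 1 + (l + k) + (l + k)\<^sup>2" by (rule exp_le_quadratic) (use assms in auto)
  moreover have "(l + k)\<^sup>2 \<le> 2 * l\<^sup>2 + 2 * k\<^sup>2"
    using sum_squares_bound[of l k] by (simp add: power2_sum)
  moreover have "2 * k\<^sup>2 \<le> k"
    using mult_right_mono[of k "1/2" k] assms by (simp add: power2_eq_square)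
  ultimately show ?thesis by linarith
qed

text \<open>Concavity: \<open>ln\<close> lies below its tangent at \<open>v\<close>. The increment
  of the Lyapunov function thus enters the exponent with the factor p / v, called \<open>q\<close>
  below.\<close>

lemma powr_le_powr_times_exp:
  fixes v v' p :: real
  assumes "0 < v" "0 < v'" "0 < p"
  shows "v' powr p \<le> v powr p * exp (p / v * (v' - v))"
proof -
  have "ln v' - ln v \<le> (v' - v) / v"
    using ln_le_minus_one[of "v' / v"] assms by (simp add: ln_div diff_divide_distrib)
  then have "p * ln v' \<le> p * ln v + p * ((v' - v) / v)"
    using mult_left_mono[of "ln v' - ln v" "(v' - v) / v" p] assms by (simp add: algebra_simps)
  then have "exp (p * ln v') \<le> exp (p * ln v + p * ((v' - v) / v))" by simp
  then show ?thesis using assms by (simp add: powr_def exp_add)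
qed

lemma power2_sum3_le: "(a + b + c)\<^sup>2 \<le> 3 * (a\<^sup>2 + b\<^sup>2 + (c::real)\<^sup>2)"
proof -
  have "0 \<le> (a - b)\<^sup>2 + (b - c)\<^sup>2 + (a - c)\<^sup>2" by simp
  then show ?thesis by (simp add: power2_eq_square algebra_simps)
qed

lemma cmod_diff_sq_le: "(cmod (a - b))\<^sup>2 \<le> 2 * (cmod a)\<^sup>2 + 2 * (cmod b)\<^sup>2"
proof -
  have "(cmod (a - b))\<^sup>2 \<le> (cmod a + cmod b)\<^sup>2" by (intro power_mono norm_triangle_ineq4) auto
  also have "\<dots> \<le> 2 * (cmod a)\<^sup>2 + 2 * (cmod b)\<^sup>2"
    using sum_squares_bound[of "cmod a" "cmod b"] by (simp add: power2_sum)
  finally show ?thesis .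
qed

lemma cmod_add_sq: "(cmod (a + b))\<^sup>2 = (cmod a)\<^sup>2 + 2 * Re (cnj a * b) + (cmod b)\<^sup>2"
  unfolding cmod_power2 by (simp add: power2_eq_square algebra_simps)

text \<open>
  \<open>V\<close> and \<open>V'\<close> are the values of the Lyapunov function before and after one step; the linear
  part of the increment keeps its sign so that its mean can be used after integration.
\<close>
lemma lyapunov_pointwise:
  fixes x y xs r e1 e2 e3 :: complex and e A A' g p hx B :: real
  defines "V \<equiv> e + (cmod (x - xs))\<^sup>2 + A' * (cmod y)\<^sup>2"
  defines "V' \<equiv> e + (cmod (x + e1 * y - xs))\<^sup>2 + A * (cmod (r * y + (e2 * x - e3 * y)))\<^sup>2"
  defines "q \<equiv> p / V"
  assumes p: "1 \<le> p" and e: "0 < e" and A: "0 < A" "A \<le> 2" "A \<le> 5 * A'"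
    and r: "cmod r \<le> 1" and damp: "A * (cmod r)\<^sup>2 + g * A \<le> A'"
    and hx: "hx = 2 * (cmod xs)\<^sup>2 / e + 2"
    and B: "720 * B\<^sup>2 * p\<^sup>2 \<le> A" "3600 * B\<^sup>2 * p\<^sup>2 * hx \<le> 1"
    and e1: "cmod e1 \<le> B" and e2: "cmod e2 \<le> B" and e3: "cmod e3 \<le> B"
  shows "V' powr p \<le> V powr p * exp (- (q * (g * A * (cmod y)\<^sup>2))) *
     (1 + Re (2 * q * cnj (x - xs) * y * e1) + Re (2 * q * A * cnj (r * y) * x * e2)
        - Re (2 * q * A * cnj (r * y) * y * e3)
        + (2 * q * (cmod y)\<^sup>2 + 24 * q\<^sup>2 * (cmod (x - xs))\<^sup>2 * (cmod y)\<^sup>2) * (cmod e1)\<^sup>2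
        + (4 * q * A * (cmod x)\<^sup>2 + 24 * q\<^sup>2 * A\<^sup>2 * (cmod y)\<^sup>2 * (cmod x)\<^sup>2) * (cmod e2)\<^sup>2
        + (4 * q * A * (cmod y)\<^sup>2 + 24 * q\<^sup>2 * A\<^sup>2 * (cmod y)\<^sup>2 * (cmod y)\<^sup>2) * (cmod e3)\<^sup>2)" (is ?main)
    and "q * (cmod (x - xs))\<^sup>2 \<le> p" and "q * A * (cmod y)\<^sup>2 \<le> 5 * p" and "q * (cmod x)\<^sup>2 \<le> p * hx"
    and "0 < V" and "0 < q"
proof -
  define u w X where "u = cmod (x - xs)" and "w = cmod y" and "X = cmod x"
  have A': "0 < A'" using A by simp
  have V: "e \<le> V" "u\<^sup>2 \<le> V" "A' * w\<^sup>2 \<le> V" using e A' by (auto simp: V_def u_def w_def)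
  show V0: "0 < V" using V e by simp
  then show q0: "0 < q" using p by (simp add: q_def)
  have V'0: "0 < V'" using e A by (auto simp: V'_def intro!: add_pos_nonneg)
  have qV: "q * V = p" using V0 by (simp add: q_def)
  have hx2: "2 \<le> hx" using e by (simp add: hx)
  have qu: "q * u\<^sup>2 \<le> p" using mult_left_mono[OF V(2), of q] q0 qV by simp
  \<comment> \<open>\<open>V\<close> controls y with the weight \<open>A'\<close> before the step,
    the increments carry the weight \<open>A\<close> after it; the factor 5 converts one into the
    other.\<close>
  have qAw: "q * A * w\<^sup>2 \<le> 5 * p"
  proof -
    have "q * A * w\<^sup>2 \<le> q * (5 * A') * w\<^sup>2" using A q0 by (intro mult_right_mono mult_left_mono) auto
    also have "\<dots> \<le> 5 * (q * V)" using mult_left_mono[OF V(3), of q] q0 by simp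
    finally show ?thesis by (simp add: qV)
  qed
  have qX: "q * X\<^sup>2 \<le> p * hx"
  proof -
    have "x = (x - xs) - (- xs)" by simp
    then have "X\<^sup>2 \<le> 2 * u\<^sup>2 + 2 * (cmod xs)\<^sup>2"
      unfolding X_def u_def using cmod_diff_sq_le[of "x - xs" "- xs"] by simp
    also have "2 * (cmod xs)\<^sup>2 \<le> 2 * (cmod xs)\<^sup>2 / e * V"
      using V(1) e by (simp add: field_simps mult_mono)
    finally have "X\<^sup>2 \<le> hx * V" using V(2) by (simp add: hx algebra_simps)
    then have "q * X\<^sup>2 \<le> q * (hx * V)" using q0 by simp
    also have "\<dots> = hx * (q * V)" by simp
    finally show ?thesis unfolding qV by (simp add: mult.commute)
  qed
  show "q * (cmod (x - xs))\<^sup>2 \<le> p" "q * A * (cmod y)\<^sup>2 \<le> 5 * p" "q * (cmod x)\<^sup>2 \<le> p * hx"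
    using qu qAw qX by (simp_all add: u_def w_def X_def)
  define T1 T2 T3 where "T1 = Re (2 * q * cnj (x - xs) * y * e1)"
    and "T2 = Re (2 * q * A * cnj (r * y) * x * e2)" and "T3 = Re (2 * q * A * cnj (r * y) * y * e3)"
  have B0: "0 \<le> B" using e1 norm_ge_zero order_trans by blast
  have qB: "7200 * (B\<^sup>2 * p\<^sup>2) \<le> 1"
  proof -
    have "3600 * B\<^sup>2 * p\<^sup>2 * 2 \<le> 3600 * B\<^sup>2 * p\<^sup>2 * hx" using hx2 by (intro mult_left_mono) auto
    then have "7200 * (B\<^sup>2 * p\<^sup>2) \<le> 3600 * B\<^sup>2 * p\<^sup>2 * hx" by simp
    then show ?thesis using B(2) by linarith
  qed
  have T1: "\<bar>T1\<bar> \<le> 2 * q * u * w * cmod e1"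
    unfolding T1_def using abs_Re_le_cmod[of "2 * q * cnj (x - xs) * y * e1"] q0
    by (simp add: norm_mult u_def w_def del: complex_cnj_diff)
  have T2: "\<bar>T2\<bar> \<le> 2 * q * A * w * X * cmod e2"
  proof -
    have "\<bar>T2\<bar> \<le> 2 * q * A * (cmod r * w) * X * cmod e2"
      unfolding T2_def using abs_Re_le_cmod[of "2 * q * A * cnj (r * y) * x * e2"] q0 A
      by (simp add: norm_mult X_def w_def)
    also have "\<dots> \<le> 2 * q * A * (1 * w) * X * cmod e2"
      using r q0 A by (intro mult_right_mono mult_left_mono) (auto simp: w_def X_def)
    finally show ?thesis by simp
  qed
  have T3: "\<bar>T3\<bar> \<le> 2 * q * A * w * w * cmod e3"
  proof -
    have "\<bar>T3\<bar> \<le> 2 * q * A * (cmod r * w) * w * cmod e3"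
      unfolding T3_def using abs_Re_le_cmod[of "2 * q * A * cnj (r * y) * y * e3"] q0 A
      by (simp add: norm_mult w_def)
    also have "\<dots> \<le> 2 * q * A * (1 * w) * w * cmod e3"
      using r q0 A by (intro mult_right_mono mult_left_mono) (auto simp: w_def)
    finally show ?thesis by simp
  qed
  have n: "(cmod e1)\<^sup>2 \<le> B\<^sup>2" "(cmod e2)\<^sup>2 \<le> B\<^sup>2" "(cmod e3)\<^sup>2 \<le> B\<^sup>2" using e1 e2 e3 by (auto intro: power_mono)
  have S1: "T1\<^sup>2 \<le> 4 * q\<^sup>2 * u\<^sup>2 * w\<^sup>2 * (cmod e1)\<^sup>2"
    using power_mono[OF T1, of 2] by (simp add: power_mult_distrib)
  have S2: "T2\<^sup>2 \<le> 4 * q\<^sup>2 * A\<^sup>2 * w\<^sup>2 * X\<^sup>2 * (cmod e2)\<^sup>2"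
    using power_mono[OF T2, of 2] by (simp add: power_mult_distrib)
  have S3: "T3\<^sup>2 \<le> 4 * q\<^sup>2 * A\<^sup>2 * w\<^sup>2 * w\<^sup>2 * (cmod e3)\<^sup>2"
    using power_mono[OF T3, of 2] by (simp add: power_mult_distrib)
  have sm: "\<bar>T\<bar> \<le> 1/6" if "T\<^sup>2 \<le> 1/36" for T :: real
    using that real_sqrt_le_mono[of "T\<^sup>2" "1/36"] by (simp add: real_sqrt_divide)
  \<comment> \<open>720 = 4 * 5 * 36: the square of \<open>T1\<close> is at most 20 * B^2 * p^2 / A
    and has to be at most 1/36. The weight ends up in the denominator because e1 * y enters the
    unweighted coordinate.\<close>
  have U1: "\<bar>T1\<bar> \<le> 1/6"
  proof (rule sm)
    have "T1\<^sup>2 * A \<le> (4 * q\<^sup>2 * u\<^sup>2 * w\<^sup>2 * B\<^sup>2) * A"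
      using order_trans[OF S1 mult_left_mono[OF n(1)]] A by (intro mult_right_mono) auto
    also have "\<dots> = 4 * B\<^sup>2 * ((q * u\<^sup>2) * (q * A * w\<^sup>2))" by (simp add: power2_eq_square)
    also have "\<dots> \<le> 4 * B\<^sup>2 * (p * (5 * p))" by (intro mult_left_mono mult_mono[OF qu qAw]) (use p q0 A in auto)
    also have "\<dots> \<le> A / 36" using B(1) by (simp add: power2_eq_square)
    finally show "T1\<^sup>2 \<le> 1/36" using A by simp
  qed
  have U2: "\<bar>T2\<bar> \<le> 1/6"
  proof (rule sm)
    have "T2\<^sup>2 \<le> 4 * q\<^sup>2 * A\<^sup>2 * w\<^sup>2 * X\<^sup>2 * B\<^sup>2"
      using order_trans[OF S2 mult_left_mono[OF n(2)]] A by auto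
    also have "\<dots> = 4 * B\<^sup>2 * A * ((q * A * w\<^sup>2) * (q * X\<^sup>2))" by (simp add: power2_eq_square)
    also have "\<dots> \<le> 4 * B\<^sup>2 * 2 * ((5 * p) * (p * hx))"
      by (rule mult_mono[OF mult_left_mono[OF A(2)] mult_mono[OF qAw qX]]) (use p q0 A hx2 in auto)
    also have "\<dots> \<le> 1 / 36" using B(2) by (simp add: power2_eq_square algebra_simps)
    finally show "T2\<^sup>2 \<le> 1/36" .
  qed
  have U3: "\<bar>T3\<bar> \<le> 1/6"
  proof (rule sm)
    have "T3\<^sup>2 \<le> 4 * q\<^sup>2 * A\<^sup>2 * w\<^sup>2 * w\<^sup>2 * B\<^sup>2"
      using order_trans[OF S3 mult_left_mono[OF n(3)]] A by auto
    also have "\<dots> = 4 * B\<^sup>2 * ((q * A * w\<^sup>2) * (q * A * w\<^sup>2))" by (simp add: power2_eq_square)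
    also have "\<dots> \<le> 4 * B\<^sup>2 * ((5 * p) * (5 * p))" by (intro mult_left_mono mult_mono[OF qAw qAw]) (use p q0 A in auto)
    also have "\<dots> \<le> 1 / 36" using qB by (simp add: power2_eq_square)
    finally show "T3\<^sup>2 \<le> 1/36" .
  qed
  define l where "l = T1 + T2 - T3"
  have l: "\<bar>l\<bar> \<le> 1/2" unfolding l_def using U1 U2 U3 by linarith
  define k where "k = q * (w\<^sup>2 * (cmod e1)\<^sup>2 + A * (2 * X\<^sup>2 * (cmod e2)\<^sup>2 + 2 * w\<^sup>2 * (cmod e3)\<^sup>2))"
  have k0: "0 \<le> k" using q0 A by (simp add: k_def)
  have qw: "q * w\<^sup>2 * B\<^sup>2 \<le> 1/144"
  proof -
    have "q * w\<^sup>2 * B\<^sup>2 * A = B\<^sup>2 * (q * A * w\<^sup>2)" by simp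
    also have "\<dots> \<le> B\<^sup>2 * (5 * p)" using qAw by (intro mult_left_mono) auto
    also have "\<dots> \<le> 5 * (B\<^sup>2 * p\<^sup>2)"
      using mult_left_mono[of p "p\<^sup>2" "5 * B\<^sup>2"] p by (simp add: power2_eq_square)
    also have "\<dots> \<le> A * (1/144)" using B(1) by simp
    finally show ?thesis using A by simp
  qed
  have k1: "k \<le> 1/2"
  proof -
    have "k \<le> q * (w\<^sup>2 * B\<^sup>2 + A * (2 * X\<^sup>2 * B\<^sup>2 + 2 * w\<^sup>2 * B\<^sup>2))"
      unfolding k_def using q0 A n by (intro mult_left_mono add_mono) auto
    also have "\<dots> = q * w\<^sup>2 * B\<^sup>2 * (1 + 2 * A) + 2 * A * B\<^sup>2 * (q * X\<^sup>2)" by (simp add: algebra_simps)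
    also have "\<dots> \<le> 1/144 * 5 + 2 * 2 * B\<^sup>2 * (p * hx)"
      by (intro add_mono mult_mono[OF qw] mult_mono[OF _ qX] mult_right_mono) (use A q0 hx2 p B0 in auto)
    also have "2 * 2 * B\<^sup>2 * (p * hx) \<le> 4 * B\<^sup>2 * (p\<^sup>2 * hx)"
    proof -
      have "p * hx \<le> p\<^sup>2 * hx" using p hx2 by (intro mult_right_mono) (auto simp: power2_eq_square)
      then have "4 * B\<^sup>2 * (p * hx) \<le> 4 * B\<^sup>2 * (p\<^sup>2 * hx)" by (intro mult_left_mono) auto
      then show ?thesis by simp
    qed
    also have "4 * B\<^sup>2 * (p\<^sup>2 * hx) \<le> 1/900" using B(2) by (simp add: algebra_simps)
    finally show ?thesis by simp
  qed
  have q_incr: "q * (V' - V) \<le> - (q * (g * A * w\<^sup>2)) + (l + k)"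
  proof -
    define \<nu> where "\<nu> = e2 * x - e3 * y"
    have nu: "(cmod \<nu>)\<^sup>2 \<le> 2 * X\<^sup>2 * (cmod e2)\<^sup>2 + 2 * w\<^sup>2 * (cmod e3)\<^sup>2"
      using cmod_diff_sq_le[of "e2 * x" "e3 * y"]
      by (simp add: \<nu>_def norm_mult power_mult_distrib X_def w_def algebra_simps)
    have a1: "(cmod (x + e1 * y - xs))\<^sup>2 = u\<^sup>2 + 2 * Re (cnj (x - xs) * (e1 * y)) + (cmod e1)\<^sup>2 * w\<^sup>2"
      using cmod_add_sq[of "x - xs" "e1 * y"] by (simp add: u_def w_def norm_mult power_mult_distrib algebra_simps)
    have a2: "(cmod (r * y + \<nu>))\<^sup>2 = (cmod r)\<^sup>2 * w\<^sup>2 + 2 * Re (cnj (r * y) * \<nu>) + (cmod \<nu>)\<^sup>2"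
      using cmod_add_sq[of "r * y" \<nu>] by (simp add: w_def norm_mult power_mult_distrib)
    have l_eq: "l = q * (2 * Re (cnj (x - xs) * (e1 * y)) + A * (2 * Re (cnj (r * y) * \<nu>)))"
      by (simp add: l_def T1_def T2_def T3_def \<nu>_def algebra_simps)
    have "V' - V = (A * (cmod r)\<^sup>2 - A') * w\<^sup>2 + (2 * Re (cnj (x - xs) * (e1 * y)) + A * (2 * Re (cnj (r * y) * \<nu>)))
        + ((cmod e1)\<^sup>2 * w\<^sup>2 + A * (cmod \<nu>)\<^sup>2)"
      unfolding V'_def V_def \<nu>_def[symmetric] a1 a2 by (simp add: u_def w_def algebra_simps)
    also have "\<dots> \<le> - (g * A) * w\<^sup>2 + (2 * Re (cnj (x - xs) * (e1 * y)) + A * (2 * Re (cnj (r * y) * \<nu>)))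
        + ((cmod e1)\<^sup>2 * w\<^sup>2 + A * (2 * X\<^sup>2 * (cmod e2)\<^sup>2 + 2 * w\<^sup>2 * (cmod e3)\<^sup>2))"
      using damp A nu by (intro add_mono mult_right_mono mult_left_mono order.refl) auto
    finally have "q * (V' - V) \<le> q * (- (g * A) * w\<^sup>2 + (2 * Re (cnj (x - xs) * (e1 * y)) + A * (2 * Re (cnj (r * y) * \<nu>)))
        + ((cmod e1)\<^sup>2 * w\<^sup>2 + A * (2 * X\<^sup>2 * (cmod e2)\<^sup>2 + 2 * w\<^sup>2 * (cmod e3)\<^sup>2)))"
      using q0 by (intro mult_left_mono) auto
    also have "\<dots> = - (q * (g * A * w\<^sup>2)) + (l + k)" unfolding l_eq k_def by (simp add: algebra_simps)
    finally show ?thesis .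
  qed
  have "V' powr p \<le> V powr p * exp (q * (V' - V))"
    using powr_le_powr_times_exp[OF V0 V'0, of p] p by (simp add: q_def)
  also have "\<dots> \<le> V powr p * exp (- (q * (g * A * w\<^sup>2)) + (l + k))"
    using q_incr by (intro mult_left_mono) auto
  also have "\<dots> = V powr p * exp (- (q * (g * A * w\<^sup>2))) * exp (l + k)"
    by (simp only: exp_add mult.assoc)
  also have "\<dots> \<le> V powr p * exp (- (q * (g * A * w\<^sup>2))) * (1 + l + 2 * k + 2 * l\<^sup>2)"
    using exp_le_linear_plus_squares[OF l k0 k1] by (intro mult_left_mono) auto
  also have "\<dots> \<le> V powr p * exp (- (q * (g * A * w\<^sup>2))) *
     (1 + T1 + T2 - T3
        + (2 * q * w\<^sup>2 + 24 * q\<^sup>2 * u\<^sup>2 * w\<^sup>2) * (cmod e1)\<^sup>2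
        + (4 * q * A * X\<^sup>2 + 24 * q\<^sup>2 * A\<^sup>2 * w\<^sup>2 * X\<^sup>2) * (cmod e2)\<^sup>2
        + (4 * q * A * w\<^sup>2 + 24 * q\<^sup>2 * A\<^sup>2 * w\<^sup>2 * w\<^sup>2) * (cmod e3)\<^sup>2)"
  proof (intro mult_left_mono)
    \<comment> \<open>The three linear terms are squared separately, so that no mixed moments of the
      entries of one factor arise: these entries may be dependent. This gives 24 = 6 * 4.\<close>
    have "2 * l\<^sup>2 \<le> 6 * (T1\<^sup>2 + T2\<^sup>2 + T3\<^sup>2)"
      using power2_sum3_le[of T1 T2 "- T3"] by (simp add: l_def)
    also have "\<dots> \<le> 6 * (4 * q\<^sup>2 * u\<^sup>2 * w\<^sup>2 * (cmod e1)\<^sup>2 + 4 * q\<^sup>2 * A\<^sup>2 * w\<^sup>2 * X\<^sup>2 * (cmod e2)\<^sup>2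
         + 4 * q\<^sup>2 * A\<^sup>2 * w\<^sup>2 * w\<^sup>2 * (cmod e3)\<^sup>2)"
      by (intro mult_left_mono add_mono S1 S2 S3) auto
    finally show "1 + l + 2 * k + 2 * l\<^sup>2 \<le> 1 + T1 + T2 - T3
        + (2 * q * w\<^sup>2 + 24 * q\<^sup>2 * u\<^sup>2 * w\<^sup>2) * (cmod e1)\<^sup>2
        + (4 * q * A * X\<^sup>2 + 24 * q\<^sup>2 * A\<^sup>2 * w\<^sup>2 * X\<^sup>2) * (cmod e2)\<^sup>2
        + (4 * q * A * w\<^sup>2 + 24 * q\<^sup>2 * A\<^sup>2 * w\<^sup>2 * w\<^sup>2) * (cmod e3)\<^sup>2"
      by (simp add: l_def k_def algebra_simps)
  qed auto
  finally show ?main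
    unfolding T1_def T2_def T3_def u_def w_def X_def by simp
qed

text \<open>The last clause bounds the second moment about 0 rather than the variance, since the
  Lyapunov step expands in the uncentred noise.\<close>

definition small_noise :: "'a measure \<Rightarrow> real \<Rightarrow> real \<Rightarrow> real \<Rightarrow> ('a \<Rightarrow> complex) \<Rightarrow> bool" where
  "small_noise M m v B e \<longleftrightarrow> e \<in> borel_measurable M \<and> (AE w in M. cmod (e w) \<le> B)
     \<and> cmod (LINT w|M. e w) \<le> m \<and> (LINT w|M. (cmod (e w))\<^sup>2) \<le> v"

lemma (in prob_space) small_noiseD:
  assumes "small_noise M m v B e"
  shows "e \<in> borel_measurable M" "AE w in M. cmod (e w) \<le> B" "cmod (LINT w|M. e w) \<le> m"
    "(LINT w|M. (cmod (e w))\<^sup>2) \<le> v" "integrable M e" "integrable M (\<lambda>w. (cmod (e w))\<^sup>2)"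
    "0 \<le> m" "0 \<le> v"
proof -
  show [measurable]: "e \<in> borel_measurable M" and bd: "AE w in M. cmod (e w) \<le> B"
    and m: "cmod (LINT w|M. e w) \<le> m" and v: "(LINT w|M. (cmod (e w))\<^sup>2) \<le> v"
    using assms by (auto simp: small_noise_def)
  show "integrable M e" by (rule integrable_const_bound[OF bd]) measurable
  show "integrable M (\<lambda>w. (cmod (e w))\<^sup>2)"
  proof (rule integrable_const_bound)
    show "AE w in M. norm ((cmod (e w))\<^sup>2) \<le> B\<^sup>2" using bd by eventually_elim (auto intro: power_mono)
  qed measurable
  show "0 \<le> m" using m norm_ge_zero order_trans by blast
  have "0 \<le> (LINT w|M. (cmod (e w))\<^sup>2)" by simp
  then show "0 \<le> v" using v by linarith
qed

lemma (in prob_space) Re_mean_le: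
  assumes "small_noise M m v B e"
  shows "(LINT w|M. Re (c * e w)) \<le> cmod c * m"
proof -
  note e = small_noiseD[OF assms]
  have "(LINT w|M. Re (c * e w)) = Re (c * (LINT w|M. e w))" using e by simp
  also have "\<dots> \<le> cmod (c * (LINT w|M. e w))" by (rule complex_Re_le_cmod)
  also have "\<dots> \<le> cmod c * m" unfolding norm_mult by (intro mult_left_mono e) auto
  finally show ?thesis .
qed

text \<open>After integration every term that carries |y|^2 is absorbed by the damping factor exp (-
  q g A |y|^2). Two sources survive: \<open>hx * A * (m + 4 * v)\<close> from e2 * x, which drives y
  even at y = 0, and \<open>2 * m^2 / (g * A)\<close> from the mean of e1.\<close>

lemma (in prob_space) lyapunov_step:
  fixes x y xs r :: complex and e A A' g p hx B :: real and e1 e2 e3 :: "'a \<Rightarrow> complex"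
  defines "V \<equiv> e + (cmod (x - xs))\<^sup>2 + A' * (cmod y)\<^sup>2"
  assumes p: "1 \<le> p" and e: "0 < e" and A: "0 < A" "A \<le> 2" "A \<le> 5 * A'" and g: "0 < g"
    and r: "cmod r \<le> 1" and damp: "A * (cmod r)\<^sup>2 + g * A \<le> A'"
    and hx: "hx = 2 * (cmod xs)\<^sup>2 / e + 2"
    and B: "720 * B\<^sup>2 * p\<^sup>2 \<le> A" "3600 * B\<^sup>2 * p\<^sup>2 * hx \<le> 1"
    and mv: "m \<le> v" and v: "26 * p * v \<le> g * A / 4" "v * (7 + 120 * p + 48 * p * hx) \<le> g / 4"
    and noise: "small_noise M m v B e1" "small_noise M m v B e2" "small_noise M m v B e3"
  shows "(\<integral>\<^sup>+w. ennreal ((e + (cmod (x + e1 w * y - xs))\<^sup>2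
            + A * (cmod (r * y + (e2 w * x - e3 w * y)))\<^sup>2) powr p) \<partial>M)
     \<le> ennreal (V powr p * exp (p * (hx * A * (m + 4 * v) + 2 * m\<^sup>2 / (g * A))))"
proof -
  note n1 = small_noiseD[OF noise(1)] and n2 = small_noiseD[OF noise(2)] and n3 = small_noiseD[OF noise(3)]
  note [measurable] = n1(1) n2(1) n3(1)
  define q where "q = p / V"
  define k1 k2 k3 where "k1 = 2 * q * (cmod y)\<^sup>2 + 24 * q\<^sup>2 * (cmod (x - xs))\<^sup>2 * (cmod y)\<^sup>2"
    and "k2 = 4 * q * A * (cmod x)\<^sup>2 + 24 * q\<^sup>2 * A\<^sup>2 * (cmod y)\<^sup>2 * (cmod x)\<^sup>2"
    and "k3 = 4 * q * A * (cmod y)\<^sup>2 + 24 * q\<^sup>2 * A\<^sup>2 * (cmod y)\<^sup>2 * (cmod y)\<^sup>2"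
  define c1 c2 c3 where "c1 = 2 * q * cnj (x - xs) * y" and "c2 = 2 * q * A * cnj (r * y) * x"
    and "c3 = 2 * q * A * cnj (r * y) * y"
  define G where "G = (\<lambda>w. 1 + Re (c1 * e1 w) + Re (c2 * e2 w) - Re (c3 * e3 w)
        + k1 * (cmod (e1 w))\<^sup>2 + k2 * (cmod (e2 w))\<^sup>2 + k3 * (cmod (e3 w))\<^sup>2)"
  define V' where "V' = (\<lambda>w. e + (cmod (x + e1 w * y - xs))\<^sup>2
            + A * (cmod (r * y + (e2 w * x - e3 w * y)))\<^sup>2)"
  define D where "D = V powr p * exp (- (q * (g * A * (cmod y)\<^sup>2)))"
  have pw: "V' w powr p \<le> D * G w" if "cmod (e1 w) \<le> B" "cmod (e2 w) \<le> B" "cmod (e3 w) \<le> B" for w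
    using lyapunov_pointwise(1)[OF p e A r damp hx B that]
    unfolding V'_def D_def G_def q_def V_def c1_def c2_def c3_def k1_def k2_def k3_def by simp
  have "AE w in M. cmod (e1 w) \<le> B \<and> cmod (e2 w) \<le> B \<and> cmod (e3 w) \<le> B"
    using n1(2) n2(2) n3(2) by eventually_elim auto
  then have AE: "AE w in M. V' w powr p \<le> D * G w" by eventually_elim (auto intro: pw)
  \<comment> \<open>The deterministic conclusions of \<open>lyapunov_pointwise\<close> are stated
    under the noise bounds, so one sample point satisfying them is needed.\<close>
  have "\<exists>w. cmod (e1 w) \<le> B \<and> cmod (e2 w) \<le> B \<and> cmod (e3 w) \<le> B"
  proof (rule ccontr)
    assume "\<not> ?thesis"
    with \<open>AE w in M. cmod (e1 w) \<le> B \<and> cmod (e2 w) \<le> B \<and> cmod (e3 w) \<le> B\<close>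
    have "AE w in M. False" by (elim AE_mp) (auto intro: AE_I2)
    then show False by simp
  qed
  then obtain w0 where w0: "cmod (e1 w0) \<le> B" "cmod (e2 w0) \<le> B" "cmod (e3 w0) \<le> B" by blast
  note F = lyapunov_pointwise(2-6)[OF p e A r damp hx B w0, where x = x and y = y, folded V_def, folded q_def]
  have intG: "integrable M (\<lambda>w. D * G w)"
    unfolding G_def using n1 n2 n3 by (intro integrable_mult_right Bochner_Integration.integrable_add
      Bochner_Integration.integrable_diff) auto
  define w where "w = cmod y"
  define u where "u = cmod (x - xs)"
  define X where "X = cmod x"
  have q0: "0 < q" and V0: "0 < V" using F by auto
  have hx2: "2 \<le> hx" using e by (simp add: hx)
  have "(LINT w|M. G w) = 1 + (LINT w|M. Re (c1 * e1 w)) + (LINT w|M. Re (c2 * e2 w)) + (LINT w|M. Re ((- c3) * e3 w))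
     + k1 * (LINT w|M. (cmod (e1 w))\<^sup>2) + k2 * (LINT w|M. (cmod (e2 w))\<^sup>2) + k3 * (LINT w|M. (cmod (e3 w))\<^sup>2)"
    unfolding G_def using n1 n2 n3 by (simp add: prob_space)
  also have "\<dots> \<le> 1 + cmod c1 * m + cmod c2 * m + cmod (- c3) * m + k1 * v + k2 * v + k3 * v"
    using n1(4) n2(4) n3(4) q0 A
    by (intro add_mono Re_mean_le[OF noise(1)] Re_mean_le[OF noise(2)] Re_mean_le[OF noise(3)] mult_left_mono)
      (auto simp: k1_def k2_def k3_def)
  also have "\<dots> \<le> 1 + (q * (g * A * w\<^sup>2) + p * (hx * A * (m + 4 * v) + 2 * m\<^sup>2 / (g * A)))"
  proof -
    define z where "z = q * w\<^sup>2"
    have z0: "0 \<le> z" using q0 by (simp add: z_def)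
    have Fu: "q * u\<^sup>2 \<le> p" and Fw: "A * z \<le> 5 * p" and FX: "q * X\<^sup>2 \<le> p * hx"
      using F by (auto simp: u_def w_def X_def z_def algebra_simps)
    have m0: "0 \<le> m" and v0: "0 \<le> v" using n1 by auto
    have c1: "cmod c1 * m \<le> g * A / 2 * z + p * (2 * m\<^sup>2 / (g * A))"
    proof -
      \<comment> \<open>Young's inequality, balanced so that y takes exactly half of the damping;
        the other part multiplies q * u^2 \<le> p.\<close>
      have "2 * u * w * m \<le> g * A / 2 * w\<^sup>2 + 2 * m\<^sup>2 / (g * A) * u\<^sup>2"
      proof -
        have gA: "0 < g * A" using g A by simp
        define t where "t = m / (g * A)"
        have m: "m = g * A * t" using g A by (simp add: t_def)
        have "0 \<le> g * A / 2 * (w - 2 * t * u)\<^sup>2" using gA by simp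
        also have "\<dots> = g * A / 2 * w\<^sup>2 + 2 * (g * A * t\<^sup>2) * u\<^sup>2 - 2 * u * w * m"
          unfolding m by (simp add: power2_eq_square algebra_simps)
        also have "2 * (g * A * t\<^sup>2) = 2 * m\<^sup>2 / (g * A)"
          using g A by (simp add: t_def power2_eq_square)
        finally show ?thesis by simp
      qed
      then have "q * (2 * u * w * m) \<le> q * (g * A / 2 * w\<^sup>2 + 2 * m\<^sup>2 / (g * A) * u\<^sup>2)"
        using q0 by (intro mult_left_mono) auto
      also have "\<dots> = g * A / 2 * z + (q * u\<^sup>2) * (2 * m\<^sup>2 / (g * A))"
        by (simp add: z_def algebra_simps)
      also have "\<dots> \<le> g * A / 2 * z + p * (2 * m\<^sup>2 / (g * A))"
        using Fu g A by (intro add_left_mono mult_right_mono) auto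
      finally have *: "q * (2 * u * w * m) \<le> g * A / 2 * z + p * (2 * m\<^sup>2 / (g * A))" .
      have "cmod c1 = 2 * q * u * w"
        unfolding c1_def norm_mult complex_mod_cnj u_def w_def using q0 by simp
      with * show ?thesis by (simp add: mult_ac)
    qed
    have rw: "cmod (r * y) \<le> w" using r by (simp add: norm_mult w_def mult_left_le_one_le)
    have c2: "cmod c2 * m \<le> A * m * z + p * hx * A * m"
    proof -
      have "cmod c2 * m = q * A * m * (2 * cmod (r * y) * X)" using q0 A by (simp add: c2_def norm_mult X_def)
      also have "\<dots> \<le> q * A * m * (2 * w * X)"
        using rw q0 A m0 by (intro mult_left_mono mult_right_mono) (auto simp: X_def)
      also have "\<dots> \<le> q * A * m * (w\<^sup>2 + X\<^sup>2)"
        using sum_squares_bound[of w X] q0 A m0 by (intro mult_left_mono) auto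
      also have "\<dots> = A * m * z + A * m * (q * X\<^sup>2)" by (simp add: z_def algebra_simps)
      also have "\<dots> \<le> A * m * z + A * m * (p * hx)" using FX A m0 by (intro add_left_mono mult_left_mono) auto
      finally show ?thesis by (simp add: algebra_simps)
    qed
    have c3: "cmod (- c3) * m \<le> 2 * A * m * z"
    proof -
      have "cmod (- c3) * m = 2 * q * A * m * (cmod (r * y) * w)" using q0 A by (simp add: c3_def norm_mult w_def)
      also have "\<dots> \<le> 2 * q * A * m * (w * w)"
        using rw q0 A m0 by (intro mult_left_mono mult_right_mono) (auto simp: w_def)
      finally show ?thesis by (simp add: z_def power2_eq_square mult_ac)
    qed
    have k1: "k1 * v \<le> (2 + 24 * p) * v * z"
    proof -
      have "k1 * v = 2 * v * z + 24 * v * z * (q * u\<^sup>2)" by (simp add: k1_def z_def u_def w_def power2_eq_square algebra_simps)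
      also have "\<dots> \<le> 2 * v * z + 24 * v * z * p" using Fu v0 z0 by (intro add_left_mono mult_left_mono) auto
      finally show ?thesis by (simp add: algebra_simps)
    qed
    have k2: "k2 * v \<le> 4 * A * v * p * hx + 48 * A * p * hx * v * z"
    proof -
      have "k2 * v = 4 * A * v * (q * X\<^sup>2) + 24 * A * A * v * z * (q * X\<^sup>2)"
        by (simp add: k2_def z_def X_def w_def power2_eq_square algebra_simps)
      also have "\<dots> \<le> 4 * A * v * (p * hx) + 24 * A * 2 * v * z * (p * hx)"

        by (intro add_mono mult_mono[OF _ FX] mult_left_mono mult_right_mono) (use v0 z0 A p hx2 q0 in auto)
      finally show ?thesis by (simp add: algebra_simps)
    qed
    have k3: "k3 * v \<le> 4 * A * v * z + 120 * p * A * v * z"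
    proof -
      have "k3 * v = 4 * A * v * z + 24 * A * v * z * (A * z)"
        by (simp add: k3_def z_def w_def power2_eq_square algebra_simps)
      also have "\<dots> \<le> 4 * A * v * z + 24 * A * v * z * (5 * p)"
        using Fw v0 z0 A by (intro add_left_mono mult_left_mono) auto
      finally show ?thesis by (simp add: algebra_simps)
    qed
    have "3 * A * m \<le> 3 * A * v" using mv A by simp
    moreover have "A * (v * (7 + 120 * p + 48 * p * hx)) \<le> A * (g / 4)" using v(2) A by (intro mult_left_mono) auto
    moreover have "2 * v \<le> 2 * v * p" using p v0 by (simp add: mult_le_cancel_left1)
    \<comment> \<open>The damping is spent as follows: one half on the mean of e1, one quarter on
      the variance of e1 (2 + 24 * p \<le> 26 * p), one quarter on the terms that carry
      \<open>A\<close>, where 7 = 3 + 4 collects the means and the squares of e2 and e3.\<close>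
    ultimately have coef: "g * A / 2 + 3 * A * m + (2 + 24 * p) * v + 48 * A * p * hx * v + 4 * A * v + 120 * p * A * v \<le> g * A"
      using v(1) by (simp add: algebra_simps)
    from mult_right_mono[OF coef z0] c1 c2 c3 k1 k2 k3
    show ?thesis by (simp add: z_def algebra_simps)
  qed
  also have "\<dots> \<le> exp (q * (g * A * w\<^sup>2) + p * (hx * A * (m + 4 * v) + 2 * m\<^sup>2 / (g * A)))"
    by (rule exp_ge_add_one_self)
  finally have G: "(LINT w|M. G w) \<le> exp (q * (g * A * w\<^sup>2) + p * (hx * A * (m + 4 * v) + 2 * m\<^sup>2 / (g * A)))" .
  have "(\<integral>\<^sup>+w. ennreal (V' w powr p) \<partial>M) \<le> (\<integral>\<^sup>+w. ennreal (D * G w) \<partial>M)"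
    using AE by (intro nn_integral_mono_AE) (auto simp: ennreal_leI)
  also have "\<dots> = ennreal (LINT w|M. D * G w)"
  proof (rule nn_integral_eq_integral[OF intG])
    show "AE w in M. 0 \<le> D * G w" using AE by eventually_elim (meson order_trans powr_ge_zero)
  qed
  also have "\<dots> \<le> ennreal (V powr p * exp (p * (hx * A * (m + 4 * v) + 2 * m\<^sup>2 / (g * A))))"
  proof (rule ennreal_leI)
    have "(LINT w|M. D * G w) = D * (LINT w|M. G w)" by simp
    also have "\<dots> \<le> D * exp (q * (g * A * w\<^sup>2) + p * (hx * A * (m + 4 * v) + 2 * m\<^sup>2 / (g * A)))"
      using G by (intro mult_left_mono) (auto simp: D_def)
    also have "\<dots> = V powr p * exp (p * (hx * A * (m + 4 * v) + 2 * m\<^sup>2 / (g * A)))"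
      by (simp add: D_def w_def exp_add[symmetric] mult.assoc)
    finally show "(LINT w|M. D * G w) \<le> V powr p * exp (p * (hx * A * (m + 4 * v) + 2 * m\<^sup>2 / (g * A)))" .
  qed
  finally show ?thesis unfolding V'_def .
qed

section \<open>Moments of the columns\<close>

lemma borel_measurable_cvec_nth [measurable (raw)]:
  fixes f :: "'a \<Rightarrow> complex ^ 2"
  assumes "f \<in> borel_measurable M"
  shows "(\<lambda>x. f x $ i) \<in> borel_measurable M"
  by (rule borel_measurable_continuous_on[OF _ assms]) (intro continuous_intros)

text \<open>A normalised setting: the damping has constant 1, and \<open>C\<close> and
  \<open>R\<close> are at least 1, which the theorem reaches by enlarging them.
  \<open>om_large\<close> says that the noise bound times \<open>L\<close> is at most 1, so
  exponents p up to order L remain in the range where exponentials can be expanded.\<close>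

locale random_transfer_product = prob_space M
  for M :: "'a measure" +
  fixes N :: nat and om L C R :: real and \<rho> :: "nat \<Rightarrow> complex"
    and \<eta> :: "nat \<Rightarrow> 2 \<Rightarrow> 2 \<Rightarrow> 'a \<Rightarrow> complex"
  assumes C1: "1 \<le> C" and R1: "1 \<le> R" and om_cube: "om ^ 3 = L\<^sup>2 * N"
    and L_large: "10000000 * C\<^sup>2 \<le> L" and om_large: "R * L ^ 3 \<le> om"
    and rho_le: "\<And>k. k \<in> {1..N} \<Longrightarrow> cmod (\<rho> k) \<le> exp (- sqrt ((om + (real N - real k)) / real N))"
    and eta_measurable: "\<And>k i j. k \<in> {1..N} \<Longrightarrow> \<eta> k i j \<in> borel_measurable M"
    and eta_mean: "\<And>k i j. k \<in> {1..N} \<Longrightarrow> cmod (LINT w|M. \<eta> k i j w) \<le> C / (om + (real N - real k))"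
    and eta_var: "\<And>k i j. k \<in> {1..N} \<Longrightarrow> complex_variance M (\<eta> k i j) \<le> C / (om + (real N - real k))"
    and eta_bound: "\<And>k i j. k \<in> {1..N} \<Longrightarrow>
      AE w in M. cmod (\<eta> k i j w) \<le> sqrt (R * L / (om + (real N - real k)))"
    and indep: "indep_vars (\<lambda>_. borel) (\<lambda>k w. transfer_matrix (\<rho> k) (\<lambda>i j. \<eta> k i j w)) {1..N}"
begin

definition s :: "nat \<Rightarrow> real" where "s k = om + (real N - real k)"
definition gam :: "nat \<Rightarrow> real" where "gam k = sqrt (s k / real N)"
definition U :: "nat \<Rightarrow> 'a \<Rightarrow> complex ^ 2 ^ 2" where
  "U k w = transfer_matrix (\<rho> k) (\<lambda>i j. \<eta> k i j w)"
definition Z :: "complex ^ 2 \<Rightarrow> nat \<Rightarrow> 'a \<Rightarrow> complex ^ 2" where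
  "Z v k w = mat_prod (\<lambda>j. U j w) k *v v"

section \<open>Comparison of the scales \<open>L\<close>, \<open>om\<close>, \<open>N\<close> and
  the damping rates\<close>

lemma L_ge: "10000000 \<le> L"
proof -
  have "1 \<le> C\<^sup>2" using C1 by simp
  then show ?thesis using L_large by linarith
qed

lemma L3_le: "L ^ 3 \<le> om"
proof -
  have "1 * L^3 \<le> R * L^3" using R1 L_ge by (intro mult_right_mono) auto
  then show ?thesis using om_large by simp
qed

lemma L_le: "L \<le> L^2" "L^2 \<le> L^3" "L \<le> om" "10000000 \<le> om" "C \<le> L" "L\<^sup>2 \<le> om"
proof -
  show "L \<le> L^2" "L^2 \<le> L^3" using L_ge by (auto intro!: self_le_power power_increasing)
  then show "L \<le> om" "10000000 \<le> om" "L\<^sup>2 \<le> om" using L3_le L_ge by linarith+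
  have "C \<le> C\<^sup>2" using C1 by (auto intro!: self_le_power)
  then show "C \<le> L" using L_large C1 by linarith
qed

lemma N_pos: "0 < N"
proof (rule ccontr)
  assume "\<not> 0 < N"
  then have "om ^ 3 = 0" using om_cube by simp
  then show False using L_le by simp
qed

lemma N_eq: "real N = om ^ 3 / L\<^sup>2" using om_cube L_ge by (simp add: field_simps)

lemma om_le_N: "10 * om \<le> N"
proof -
  have "10 * L^2 \<le> om * om" using L_le L_ge by (intro mult_mono) auto
  then have "(10 * L^2) * om \<le> (om * om) * om" using L_le by (intro mult_right_mono) auto
  then show ?thesis unfolding N_eq using L_ge by (simp add: field_simps power3_eq_cube power2_eq_square)
qed

lemma s_Suc: "s k = s (Suc k) + 1" by (simp add: s_def)
lemma s_ge: "k \<le> N \<Longrightarrow> om \<le> s k" by (simp add: s_def)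
lemma s_pos: "k \<le> N \<Longrightarrow> 10000000 \<le> s k" using s_ge[of k] L_le by linarith

lemma sqrt_om_N: "sqrt (om / N) = L / om"
proof (rule real_sqrt_unique)
  show "(L / om)\<^sup>2 = om / real N" unfolding N_eq using L_ge L_le
    by (simp add: field_simps power2_eq_square power3_eq_cube)
  show "0 \<le> L / om" using L_ge L_le by simp
qed

lemma gam_ge: "k \<le> N \<Longrightarrow> L / om \<le> gam k"
  unfolding sqrt_om_N[symmetric] gam_def using s_ge[of k] N_pos by (simp add: divide_right_mono)

lemma gam_pos: "k \<le> N \<Longrightarrow> 0 < gam k"
  using less_le_trans[OF divide_pos_pos gam_ge[of k]] L_ge L_le by simp

text \<open>The relaxation time 1 / gam k is at most s k / L, so \<open>s\<close> hardly changes
  while y relaxes. Weights proportional to 1 / s k can therefore follow the damping.\<close>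

lemma gam_s_ge: assumes "k \<le> N" shows "L \<le> gam k * s k"
proof -
  have "L = (L / om) * om" using L_le by simp
  also have "\<dots> \<le> gam k * s k" using gam_ge[OF assms] s_ge[OF assms] gam_pos[OF assms] L_le L_ge
    by (intro mult_mono) auto
  finally show ?thesis .
qed

lemma gam_le: "k \<le> N \<Longrightarrow> gam k \<le> 5/4"
proof -
  assume "k \<le> N"
  have "s k / N \<le> (5/4)\<^sup>2"
    using om_le_N N_pos by (simp add: s_def field_simps power2_eq_square)
  from real_sqrt_le_mono[OF this] show ?thesis by (simp add: gam_def)
qed

lemma exp_gam_le: assumes "k \<le> N" shows "exp (gam k) \<le> 5" "exp (2 * gam k) \<le> 27"
proof -
  have "(exp (gam k)) ^ 4 = exp (4 * gam k)" by (simp add: exp_of_nat_mult[symmetric])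
  also have "\<dots> \<le> exp (of_nat 5 * 1)" using gam_le[OF assms] by simp
  also have "\<dots> = (exp 1) ^ 5" by (simp only: exp_of_nat_mult)
  also have "\<dots> \<le> 3 ^ 5" by (intro power_mono exp_le) auto
  also have "\<dots> \<le> (5::real) ^ 4" by simp
  finally show "exp (gam k) \<le> 5" by (subst (asm) power_mono_iff) auto
  have "exp (2 * gam k) \<le> exp (of_nat 3 * 1)" using gam_le[OF assms] by simp
  also have "\<dots> = (exp 1) ^ 3" by (simp only: exp_of_nat_mult)
  also have "\<dots> \<le> 3 ^ 3" by (intro power_mono exp_le) auto
  finally show "exp (2 * gam k) \<le> 27" by simp
qed

text \<open>|y|^2 is damped at the rate 2 * gam, of which the weights use up only gam; at least gam
  / 27 is left as the gain \<open>g\<close> of \<open>lyapunov_step\<close>. The constant 27 bounds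
  exp (2 * gam k).\<close>

lemma exp_gam_gap: assumes "k \<le> N" shows "exp (- 2 * gam k) + gam k / 27 \<le> exp (- gam k)"
proof -
  have "gam k / 27 \<le> gam k / exp (2 * gam k)"
    using exp_gam_le[OF assms] gam_pos[OF assms] by (intro divide_left_mono) auto
  also have "\<dots> \<le> (exp (gam k) - 1) / exp (2 * gam k)"
    using exp_ge_add_one_self[of "gam k"] by (intro divide_right_mono) (simp_all add: le_diff_eq add.commute)
  also have "\<dots> = exp (- gam k) - exp (- 2 * gam k)"
  proof -
    have "exp (gam k) / exp (2 * gam k) = exp (- gam k)" by (simp flip: exp_diff)
    moreover have "1 / exp (2 * gam k) = exp (- 2 * gam k)" by (simp add: exp_minus inverse_eq_divide)
    ultimately show ?thesis by (simp only: diff_divide_distrib)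
  qed
  finally show ?thesis by simp
qed

lemma rho_le_gam: "k \<in> {1..N} \<Longrightarrow> cmod (\<rho> k) \<le> exp (- gam k)"
  using rho_le by (simp add: gam_def s_def)

lemma rho_le_1: assumes "k \<in> {1..N}" shows "cmod (\<rho> k) \<le> 1"
proof -
  have "exp (- gam k) \<le> 1" using gam_pos[of k] assms by auto
  then show ?thesis using rho_le_gam[OF assms] by linarith
qed

lemma rho_sq_le: assumes "k \<in> {1..N}" shows "(cmod (\<rho> k))\<^sup>2 \<le> exp (- 2 * gam k)"
proof -
  have "(cmod (\<rho> k))\<^sup>2 \<le> (exp (- gam k))\<^sup>2" using rho_le_gam[OF assms] by (intro power_mono) auto
  then show ?thesis by (simp add: power2_eq_square mult_exp_exp)
qed

text \<open>Going from k + 1 to k raises \<open>s\<close> by 1, a relative change 1 / s (Suc k),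
  which is smaller than gam (Suc k).\<close>

lemma exp_gam_inverse_s: assumes "Suc k \<le> N" shows "exp (- gam (Suc k)) / s (Suc k) \<le> 1 / s k"
proof -
  have sp: "0 < s (Suc k)" using s_pos[OF assms] by simp
  have "1 \<le> gam (Suc k) * s (Suc k)" using gam_s_ge[OF assms] L_ge by linarith
  then have "1 + 1 / s (Suc k) \<le> 1 + gam (Suc k)" using sp by (simp add: field_simps)
  also have "\<dots> \<le> exp (gam (Suc k))" by (rule exp_ge_add_one_self)
  finally have "(s (Suc k) + 1) \<le> exp (gam (Suc k)) * s (Suc k)" using sp by (simp add: field_simps)
  then show ?thesis unfolding s_Suc[of k] using sp by (simp add: exp_minus field_simps)
qed

text \<open>The rate is the smallest damping rate, so damping dominates the change of
  \<open>W\<close> at every k, and sums over k are geometric. The value 1 at k = n makes the final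
  Lyapunov function control |y|^2 itself.\<close>

definition W :: "nat \<Rightarrow> nat \<Rightarrow> real" where "W n k = exp (- (L / om) * (real n - real k))"

lemma W_le_1: "k \<le> n \<Longrightarrow> W n k \<le> 1" using L_ge L_le by (auto simp: W_def)

lemma W_step: assumes "Suc k \<le> N" shows "exp (- gam (Suc k)) * W n (Suc k) \<le> W n k"
  using gam_ge[OF assms] by (simp add: W_def exp_add[symmetric] algebra_simps diff_divide_distrib)

text \<open>Telescoping with 1 / t^2 \<le> 1 / (t - 1) - 1 / t. The smallest value of
  \<open>s\<close> is the last one, so the bound is in terms of s n.\<close>

lemma sum_inverse_s_sq: "n \<le> N \<Longrightarrow> (\<Sum>k=1..n. 1 / (s k)\<^sup>2) \<le> 1 / (s n - 1)"
proof (induction n)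
  case 0
  then show ?case using s_pos[of 0] by simp
next
  case (Suc n)
  define t where "t = s (Suc n)"
  have t: "1 < t" using s_pos[OF Suc.prems] by (simp add: t_def)
  have "(\<Sum>k=1..Suc n. 1 / (s k)\<^sup>2) \<le> 1 / t + 1 / t\<^sup>2" using Suc s_Suc[of n] by (simp add: t_def)
  also have "\<dots> \<le> 1 / (t - 1)" using t by (simp add: field_simps power2_eq_square)
  finally show ?case by (simp add: t_def)
qed

text \<open>Integral comparison for t^(-3/2), obtained by rationalising the difference. The summand
  1 / (s k * gam k) is sqrt N times this function at t = s k.\<close>

lemma inverse_three_halves_le:
  assumes "1 < (t::real)" shows "1 / (t * sqrt t) \<le> 2 / sqrt (t - 1) - 2 / sqrt t"
proof -
  define a b where "a = sqrt (t - 1)" and "b = sqrt t"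
  have ab: "0 < a" "a \<le> b" "a * a = t - 1" "b * b = t" using assms by (auto simp: a_def b_def)
  have "a * b * (a + b) \<le> b * b * (b + b)" using ab by (intro mult_mono add_mono) auto
  then have "2 / (b * b * (b + b)) \<le> 2 / (a * b * (a + b))" using ab by (intro divide_left_mono) auto
  also have "\<dots> = 2 * (b * b - a * a) / (a * b * (a + b))" using ab by simp
  also have "\<dots> = 2 / a - 2 / b"
  proof -
    have "2 * (b * b - a * a) / (a * b * (a + b)) = 2 * (b - a) * (a + b) / (a * b * (a + b))"
      by (simp add: algebra_simps)
    also have "\<dots> = 2 * (b - a) / (a * b)" using ab by simp
    also have "\<dots> = 2 / a - 2 / b" using ab by (simp add: field_simps)
    finally show ?thesis .
  qed
  finally show ?thesis using ab by (simp add: a_def[symmetric] b_def[symmetric] mult_ac)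
qed

lemma sum_inverse_s_gam: "n \<le> N \<Longrightarrow> (\<Sum>k=1..n. 1 / (s k * gam k)) \<le> 2 * sqrt N / sqrt (s n - 1)"
proof (induction n)
  case 0
  then show ?case using s_pos[of 0] by simp
next
  case (Suc n)
  define t where "t = s (Suc n)"
  have t: "1 < t" using s_pos[OF Suc.prems] by (simp add: t_def)
  have "(\<Sum>k=1..Suc n. 1 / (s k * gam k)) \<le> 2 * sqrt N / sqrt t + sqrt N * (1 / (t * sqrt t))"
    using Suc s_Suc[of n] by (simp add: t_def gam_def real_sqrt_divide)
  also have "\<dots> \<le> 2 * sqrt N / sqrt t + sqrt N * (2 / sqrt (t - 1) - 2 / sqrt t)"
    using inverse_three_halves_le[OF t] by (intro add_left_mono mult_left_mono) auto
  also have "\<dots> = 2 * sqrt N / sqrt (t - 1)" by (simp add: algebra_simps)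
  finally show ?case by (simp add: t_def)
qed

text \<open>A geometric series with ratio exp (- L / om). The upper limit is separated from
  \<open>n\<close> for the induction; the step is 1 + x \<le> exp x at x = L / om.\<close>

lemma sum_W: "n \<le> N \<Longrightarrow> m \<le> n \<Longrightarrow> (\<Sum>k=1..m. W n k) \<le> W n m * (1 + om / L)"
proof (induction m)
  case 0
  then show ?case using L_ge L_le by (auto simp: W_def intro!: mult_nonneg_nonneg add_nonneg_nonneg)
next
  case (Suc m)
  define c where "c = exp (- (L / om))"
  have Lo: "0 < L / om" using L_ge L_le by simp
  have Wm: "W n m = c * W n (Suc m)"
    by (simp add: W_def c_def exp_add[symmetric] algebra_simps diff_divide_distrib)
  have "c * (1 + L / om) \<le> c * exp (L / om)"
    using exp_ge_add_one_self[of "L / om"] by (intro mult_left_mono) (auto simp: c_def)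
  also have "\<dots> = 1" by (simp add: c_def exp_add[symmetric])
  finally have "c * (1 + L / om) * (om / L) \<le> 1 * (om / L)" using Lo L_ge L_le by (intro mult_right_mono) auto
  then have c: "c * (1 + om / L) \<le> om / L" using L_ge L_le by (simp add: algebra_simps)
  have "(\<Sum>k=1..Suc m. W n k) \<le> c * W n (Suc m) * (1 + om / L) + W n (Suc m)"
    using Suc Wm by simp
  also have "\<dots> = W n (Suc m) * (c * (1 + om / L) + 1)" by (simp add: algebra_simps)
  also have "\<dots> \<le> W n (Suc m) * (om / L + 1)" using c by (intro mult_left_mono add_right_mono) (auto simp: W_def)
  finally show ?case by (simp add: add.commute)
qed

lemma sum_W_div_s: assumes "n \<le> N" shows "(\<Sum>k=1..n. W n k / s k) \<le> 2 / L"
proof -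
  have "(\<Sum>k=1..n. W n k / s k) \<le> (\<Sum>k=1..n. W n k / om)"
    using s_ge assms L_le by (intro sum_mono divide_left_mono) (auto simp: W_def intro!: mult_pos_pos less_le_trans[OF _ s_ge])
  also have "\<dots> \<le> (1 + om / L) / om"
    using sum_W[OF assms order.refl] L_le by (simp add: sum_divide_distrib[symmetric] W_def divide_right_mono)
  also have "\<dots> = 1 / om + 1 / L" using L_le by (simp add: add_divide_distrib)
  also have "1 / om \<le> 1 / L" using L_le L_ge by (intro divide_left_mono) auto
  finally show ?thesis by simp
qed

lemma sum_om_div_s_sq: assumes "n \<le> N" shows "(\<Sum>k=1..n. om / s k / s k) \<le> 2"
proof -
  have "(\<Sum>k=1..n. om / s k / s k) = om * (\<Sum>k=1..n. 1 / (s k)\<^sup>2)"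
    by (simp add: sum_distrib_left power2_eq_square)
  also have "\<dots> \<le> om * (1 / (s n - 1))" using sum_inverse_s_sq[OF assms] L_le by (intro mult_left_mono) auto
  also have "\<dots> \<le> om * (1 / (om / 2))" using s_ge[OF assms] L_le by (intro mult_left_mono divide_left_mono) auto
  finally show ?thesis using L_le by simp
qed

text \<open>sqrt N = om * sqrt om / L converts sqrt N / sqrt om into om / L. The shift s n - 1 is
  absorbed by lowering sqrt om to 2/3 of itself, which gives 3 = 2 / (2/3).\<close>

lemma sum_inverse_s_gam_le: assumes "n \<le> N" shows "(\<Sum>k=1..n. 1 / (s k * gam k)) \<le> 3 * om / L"
proof -
  have so: "sqrt N = om * sqrt om / L"
  proof -
    have "sqrt (om / N) * sqrt N = sqrt om" using N_pos by (simp add: real_sqrt_divide)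
    then show ?thesis unfolding sqrt_om_N using L_ge L_le by (simp add: field_simps)
  qed
  have "(\<Sum>k=1..n. 1 / (s k * gam k)) \<le> 2 * sqrt N / sqrt (s n - 1)" by (rule sum_inverse_s_gam[OF assms])
  also have "\<dots> \<le> 2 * sqrt N / (2 / 3 * sqrt om)"
  proof (intro divide_left_mono)
    have "4 / 9 * om \<le> s n - 1" using s_ge[OF assms] L_le by simp
    from real_sqrt_le_mono[OF this] show "2 / 3 * sqrt om \<le> sqrt (s n - 1)"
      by (simp add: real_sqrt_mult real_sqrt_divide)
  qed (use s_ge[OF assms] L_le in auto)
  also have "\<dots> = 3 * om / L" unfolding so using L_le by simp
  finally show ?thesis .
qed

text \<open>Second moment = variance + squared mean. Since C \<le> s k, the squared mean is at most
  C / s k as well, hence the factor 2.\<close>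

lemma small_noise_eta:
  assumes "k \<in> {1..N}"
  shows "small_noise M (C / s k) (2 * C / s k) (sqrt (R * L / s k)) (\<eta> k i j)"
proof -
  have [measurable]: "\<eta> k i j \<in> borel_measurable M" using eta_measurable[OF assms] .
  define B where "B = sqrt (R * L / s k)"
  have bd: "AE w in M. cmod (\<eta> k i j w) \<le> B" using eta_bound[OF assms] by (simp add: s_def B_def)
  have int: "integrable M (\<eta> k i j)" by (rule integrable_const_bound[OF bd]) measurable
  have int2: "integrable M (\<lambda>w. (cmod (\<eta> k i j w))\<^sup>2)"
  proof (rule integrable_const_bound)
    show "AE w in M. norm ((cmod (\<eta> k i j w))\<^sup>2) \<le> B\<^sup>2" using bd by eventually_elim (auto intro: power_mono)
  qed measurable
  define \<mu> where "\<mu> = (LINT w|M. \<eta> k i j w)"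
  have sp: "10000000 \<le> s k" "C \<le> s k" using s_pos[of k] s_ge[of k] L_le assms by auto
  have "complex_variance M (\<eta> k i j) = (LINT w|M. (cmod (\<eta> k i j w))\<^sup>2 - 2 * Re (cnj \<mu> * \<eta> k i j w) + (cmod \<mu>)\<^sup>2)"
    unfolding complex_variance_def \<mu>_def[symmetric]
  proof (intro Bochner_Integration.integral_cong refl)
    fix w
    show "(cmod (\<eta> k i j w - \<mu>))\<^sup>2 = (cmod (\<eta> k i j w))\<^sup>2 - 2 * Re (cnj \<mu> * \<eta> k i j w) + (cmod \<mu>)\<^sup>2"
      using cmod_add_sq[of "- \<mu>" "\<eta> k i j w"] by (simp add: norm_minus_commute)
  qed
  also have "\<dots> = (LINT w|M. (cmod (\<eta> k i j w))\<^sup>2) - 2 * Re (cnj \<mu> * \<mu>) + (cmod \<mu>)\<^sup>2"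
    using int int2 by (simp add: prob_space \<mu>_def)
  also have "\<dots> = (LINT w|M. (cmod (\<eta> k i j w))\<^sup>2) - (cmod \<mu>)\<^sup>2"
    unfolding cmod_power2 by (simp add: power2_eq_square)
  finally have "(LINT w|M. (cmod (\<eta> k i j w))\<^sup>2) \<le> C / s k + (cmod \<mu>)\<^sup>2"
    using eta_var[OF assms, of i j] by (simp add: s_def)
  also have "(cmod \<mu>)\<^sup>2 \<le> (C / s k)\<^sup>2"
    using eta_mean[OF assms, of i j] by (intro power_mono) (auto simp: \<mu>_def s_def)
  also have "\<dots> \<le> C / s k * 1"
    unfolding power2_eq_square using sp C1 by (intro mult_left_mono) (auto simp: divide_le_eq)
  finally have "(LINT w|M. (cmod (\<eta> k i j w))\<^sup>2) \<le> 2 * C / s k" by simp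
  then show ?thesis
    using eta_mean[OF assms, of i j] bd by (auto simp: small_noise_def s_def B_def)
qed

text \<open>
  The constant \<open>5616 = 4 * 27 * 52\<close> is dictated by the hypothesis \<open>26 * p * v \<le> g * A / 4\<close> of
  \<open>lyapunov_step\<close> with \<open>g = gam k / 27\<close> and \<open>v = 2 * C / s k\<close>.
\<close>
definition wt :: "real \<Rightarrow> nat \<Rightarrow> nat \<Rightarrow> real" where
  "wt p n k = 5616 * C * p / L * (om / s k) + W n k"

definition lyap :: "real \<Rightarrow> real \<Rightarrow> complex \<Rightarrow> nat \<Rightarrow> nat \<Rightarrow> complex ^ 2 \<Rightarrow> real" where
  "lyap p e xs n k v = e + (cmod (v $ 1 - xs))\<^sup>2 + wt p n k * (cmod (v $ 2))\<^sup>2"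

lemma indep_U: "indep_vars (\<lambda>_. borel) U {1..N}"
  using indep unfolding U_def[abs_def] .

lemma Z_measurable: "k \<le> N \<Longrightarrow> Z v k \<in> borel_measurable M"
  unfolding Z_def by (rule mat_prod_step_measurable[OF indep_U])

lemma Z_0: "Z v 0 w = v" by (simp add: Z_def)

lemma nn_integral_Z_Suc:
  assumes "k < N" "h \<in> borel_measurable borel"
  shows "(\<integral>\<^sup>+w. h (Z v (Suc k) w) \<partial>M) = (\<integral>\<^sup>+w. (\<integral>\<^sup>+w'. h (U (Suc k) w' *v Z v k w) \<partial>M) \<partial>M)"
  unfolding Z_def by (rule nn_integral_mat_prod_step[OF indep_U assms])

text \<open>\<open>p_hx\<close> ties the exponent to the floor: for a target of modulus 1,
  \<open>hx\<close> is of order 1 / e for small e, so p may be a small multiple of L * e. For the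
  target 0, \<open>hx\<close> is 2 and e is free.\<close>

context
  fixes p e hx :: real and xs :: complex
  assumes p1: "1 \<le> p" and e0: "0 < e" and hx: "hx = 2 * (cmod xs)\<^sup>2 / e + 2"
    and p_hx: "p * hx \<le> L / (1000000 * C\<^sup>2)"
begin

lemma hx2: "2 \<le> hx" using e0 by (simp add: hx)

lemma C2: "1 \<le> C\<^sup>2" using C1 by simp

lemma p_hx_le: "p * hx * (1000000 * C\<^sup>2) \<le> L"
  using p_hx C2 by (subst (asm) pos_le_divide_eq) auto

lemma p_le: "p * (2 * 1000000 * C\<^sup>2) \<le> L"
proof -
  have "p * 2 * (1000000 * C\<^sup>2) \<le> p * hx * (1000000 * C\<^sup>2)" using hx2 p1 by (intro mult_right_mono mult_left_mono) auto
  also note p_hx_le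
  finally show ?thesis by simp
qed

lemma kap_le: "5616 * C * p / L \<le> 1"
proof -
  have "C * 1 \<le> C * C" using C1 by (intro mult_left_mono) auto
  then have "5616 * C \<le> 2 * 1000000 * C\<^sup>2" using C1 by (simp add: power2_eq_square)
  then have "5616 * C * p \<le> (2 * 1000000 * C\<^sup>2) * p" using p1 by (intro mult_right_mono) auto
  also have "\<dots> \<le> L" using p_le by (simp add: mult.commute)
  finally show ?thesis using L_ge by simp
qed

lemma lyap_step:
  assumes n: "n \<le> N" and k: "Suc k \<le> n"
  shows "(\<integral>\<^sup>+w. ennreal (lyap p e xs n (Suc k) (U (Suc k) w *v v) powr p) \<partial>M)
    \<le> ennreal (lyap p e xs n k v powr p
        * exp (p * (9 * C * hx * (wt p n (Suc k) / s (Suc k))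
              + 54 * C\<^sup>2 / ((s (Suc k))\<^sup>2 * gam (Suc k) * wt p n (Suc k)))))"
proof -
  let ?k = "Suc k"
  define A A' g where "A = wt p n ?k" and "A' = wt p n k" and "g = gam ?k / 27"
  have kN: "?k \<le> N" "?k \<in> {1..N}" using n k by auto
  define S where "S = s ?k"
  have sp: "10000000 \<le> S" "om \<le> S" using s_pos[OF kN(1)] s_ge[OF kN(1)] by (auto simp: S_def)
  have S0: "0 < S" using sp by simp
  have L0: "0 < L" using L_ge by simp
  have C0: "0 < C" using C1 by simp
  have kapn: "0 < 5616 * C * p / L * (om / S)" using p1 C0 L0 L_le S0 by auto
  have A0: "0 < A" unfolding A_def wt_def using kapn by (auto simp: W_def S_def add_pos_pos)
  have A_ge: "5616 * C * p / L * (om / S) \<le> A" unfolding A_def wt_def by (simp add: W_def S_def)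
  have A2: "A \<le> 2"
  proof -
    have "5616 * C * p / L * (om / S) \<le> 1 * 1"
      using kap_le sp L_le S0 p1 C0 L0 by (intro mult_mono) auto
    then show ?thesis using W_le_1[OF k] by (simp add: A_def wt_def S_def)
  qed
  have expA: "exp (- gam ?k) * A \<le> A'"
  proof -
    have "exp (- gam ?k) * A = 5616 * C * p / L * om * (exp (- gam ?k) / s ?k) + exp (- gam ?k) * W n ?k"
      by (simp add: A_def wt_def algebra_simps)
    also have "\<dots> \<le> 5616 * C * p / L * om * (1 / s k) + W n k"
      using exp_gam_inverse_s[OF kN(1)] W_step[OF kN(1)] C0 p1 L0 L_le
      by (intro add_mono mult_left_mono) auto
    finally show ?thesis by (simp add: A'_def wt_def)
  qed
  have A5: "A \<le> 5 * A'"
  proof -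
    have "A = exp (gam ?k) * (exp (- gam ?k) * A)" by (simp add: exp_minus)
    also have "\<dots> \<le> 5 * (exp (- gam ?k) * A)"
      using exp_gam_le[OF kN(1)] A0 by (intro mult_right_mono) auto
    finally show ?thesis using expA by simp
  qed
  have damp: "A * (cmod (\<rho> ?k))\<^sup>2 + g * A \<le> A'"
  proof -
    have "A * (cmod (\<rho> ?k))\<^sup>2 + g * A \<le> A * exp (- 2 * gam ?k) + g * A"
      using rho_sq_le[OF kN(2)] A0 by simp
    also have "\<dots> = (exp (- 2 * gam ?k) + gam ?k / 27) * A" by (simp add: g_def algebra_simps)
    also have "\<dots> \<le> exp (- gam ?k) * A" using exp_gam_gap[OF kN(1)] A0 by (intro mult_right_mono) auto
    finally show ?thesis using expA by simp
  qed
  have g0: "0 < g" using gam_pos[OF kN(1)] by (simp add: g_def)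
  have gS: "L \<le> gam ?k * S" using gam_s_ge[OF kN(1)] by (simp add: S_def)
  have pL: "p \<le> L"
  proof -
    have "p * 1 \<le> p * (2 * 1000000 * C\<^sup>2)" using p1 C2 by (intro mult_left_mono) auto
    then show ?thesis using p_le by simp
  qed
  have phL: "p * hx \<le> L"
  proof -
    have "p * hx * 1 \<le> p * hx * (1000000 * C\<^sup>2)" using p1 C2 hx2 by (intro mult_left_mono) auto
    also note p_hx_le
    finally show ?thesis by simp
  qed
  have RL3: "R * L * L * L \<le> om" using om_large by (simp add: power3_eq_cube mult.assoc)
  have B2: "(sqrt (R * L / S))\<^sup>2 = R * L / S" using R1 L0 S0 by simp
  \<comment> \<open>With p \<le> L and R * L^3 \<le> om the left side is at most 720 * p / L * (om /
    S), which has the shape of the first part of the weight.\<close>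
  have B1: "720 * (sqrt (R * L / S))\<^sup>2 * p\<^sup>2 \<le> A"
  proof -
    have "720 * (R * L / S) * p\<^sup>2 = 720 * p / (L * S) * (R * L * L * p)"
      using L0 by (simp add: field_simps power2_eq_square)
    also have "\<dots> \<le> 720 * p / (L * S) * (R * L * L * L)"
      using pL R1 L0 S0 p1 by (intro mult_left_mono) auto
    also have "\<dots> \<le> 720 * p / (L * S) * om" using RL3 L0 S0 p1 by (intro mult_left_mono) auto
    also have "\<dots> \<le> (5616 * C) * p / (L * S) * om"
      using C1 L0 S0 p1 L_le by (intro mult_right_mono divide_right_mono) auto
    also have "\<dots> = 5616 * C * p / L * (om / S)" by simp
    finally show ?thesis using A_ge B2 by simp
  qed
  have B2': "3600 * (sqrt (R * L / S))\<^sup>2 * p\<^sup>2 * hx \<le> 1"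
  proof -
    have p6: "3600 * p \<le> L"
    proof -
      have "p * 3600 \<le> p * (2 * 1000000 * C\<^sup>2)" using p1 C2 by (intro mult_left_mono) auto
      then show ?thesis using p_le by simp
    qed
    have "3600 * (R * L / S) * p\<^sup>2 * hx = (R * L / S) * ((3600 * p) * (p * hx))"
      by (simp add: power2_eq_square)
    also have "\<dots> \<le> (R * L / S) * (L * L)"
      by (intro mult_left_mono mult_mono[OF p6 phL]) (use p1 hx2 L0 S0 R1 in auto)
    also have "\<dots> = R * L * L * L / S" by simp
    also have "\<dots> \<le> 1" using RL3 sp S0 by simp
    finally show ?thesis using B2 by simp
  qed
  have v1: "26 * p * (2 * C / S) \<le> g * A / 4"
  proof -
    have "26 * p * (2 * C / S) = L / om / 27 * (5616 * C * p / L * (om / S)) / 4"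
      using L0 L_le by simp
    also have "\<dots> \<le> gam ?k / 27 * A / 4"
      using gam_ge[OF kN(1)] A_ge kapn gam_pos[OF kN(1)] by (intro divide_right_mono mult_mono) auto
    finally show ?thesis by (simp add: g_def)
  qed
  have v2: "2 * C / S * (7 + 120 * p + 48 * p * hx) \<le> g / 4"
  proof -
    have "p * 2 \<le> p * hx" using hx2 p1 by (intro mult_left_mono) auto
    moreover have "48 * p * hx = 48 * (p * hx)" by simp
    ultimately have "7 + 120 * p + 48 * p * hx \<le> 112 * (p * hx)" using p1 by linarith
    then have "2 * C / S * (7 + 120 * p + 48 * p * hx) \<le> 2 * C / S * (112 * (p * hx))"
      using C0 S0 by (intro mult_left_mono) auto
    also have "\<dots> = 224 * (C * (p * hx)) / S" by simp
    also have "\<dots> \<le> (L / 108) / S"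
    proof (intro divide_right_mono)
      have "C * (p * hx) \<le> C\<^sup>2 * (p * hx)" using C1 p1 hx2
        by (intro mult_right_mono) (auto simp: power2_eq_square)
      then show "224 * (C * (p * hx)) \<le> L / 108" using p_hx_le L0 by (simp add: mult_ac)
    qed (use S0 in auto)
    also have "\<dots> \<le> (gam ?k * S / 108) / S" using gS S0 by (intro divide_right_mono) auto
    also have "\<dots> = g / 4" using S0 by (simp add: g_def)
    finally show ?thesis .
  qed
  have mv: "C / S \<le> 2 * C / S" using C0 S0 by (simp add: divide_right_mono)
  from lyapunov_step[OF p1 e0 A0 A2 A5 g0 rho_le_1[OF kN(2)] damp hx B1 B2' mv v1 v2,
      where x = "v $ 1" and y = "v $ 2"]
      small_noise_eta[OF kN(2)]
  have "(\<integral>\<^sup>+w. ennreal ((e + (cmod (v $ 1 + \<eta> ?k 1 2 w * v $ 2 - xs))\<^sup>2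
        + A * (cmod (\<rho> ?k * v $ 2 + (\<eta> ?k 2 1 w * v $ 1 - \<eta> ?k 2 2 w * v $ 2)))\<^sup>2) powr p) \<partial>M)
     \<le> ennreal ((e + (cmod (v $ 1 - xs))\<^sup>2 + A' * (cmod (v $ 2))\<^sup>2) powr p *
         exp (p * (hx * A * (C / S + 4 * (2 * C / S)) + 2 * (C / S)\<^sup>2 / (g * A))))"
    by (simp add: S_def)
  moreover have "hx * A * (C / S + 4 * (2 * C / S)) + 2 * (C / S)\<^sup>2 / (g * A)
     = 9 * C * hx * (A / S) + 54 * C\<^sup>2 / (S\<^sup>2 * gam ?k * A)"
    by (simp add: g_def power_divide) (simp add: field_simps)
  ultimately show ?thesis
    by (simp add: lyap_def U_def transfer_matrix_mult_nth A_def A'_def S_def)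
qed

lemma lyap_iterate:
  assumes n: "n \<le> N" and k: "k \<le> n"
  shows "(\<integral>\<^sup>+w. ennreal (lyap p e xs n k (Z v k w) powr p) \<partial>M)
    \<le> ennreal (lyap p e xs n 0 v powr p
        * exp (\<Sum>j=1..k. p * (9 * C * hx * (wt p n j / s j) + 54 * C\<^sup>2 / ((s j)\<^sup>2 * gam j * wt p n j))))"
  using k
proof (induction k)
  case 0
  then show ?case by (simp add: Z_0 emeasure_space_1)
next
  case (Suc k)
  define r where "r = (\<lambda>j. p * (9 * C * hx * (wt p n j / s j) + 54 * C\<^sup>2 / ((s j)\<^sup>2 * gam j * wt p n j)))"
  have meas: "(\<lambda>v. ennreal (lyap p e xs n j v powr p)) \<in> borel_measurable borel" for j
    unfolding lyap_def by measurable
  have [measurable]: "Z v k \<in> borel_measurable M" using Suc.prems n by (intro Z_measurable) auto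
  have "(\<integral>\<^sup>+w. ennreal (lyap p e xs n (Suc k) (Z v (Suc k) w) powr p) \<partial>M)
     = (\<integral>\<^sup>+w. (\<integral>\<^sup>+w'. ennreal (lyap p e xs n (Suc k) (U (Suc k) w' *v Z v k w) powr p) \<partial>M) \<partial>M)"
    using nn_integral_Z_Suc[OF _ meas, of k "Suc k"] Suc.prems n by simp
  also have "\<dots> \<le> (\<integral>\<^sup>+w. ennreal (lyap p e xs n k (Z v k w) powr p * exp (r (Suc k))) \<partial>M)"
    unfolding r_def by (intro nn_integral_mono lyap_step[OF n Suc.prems])
  also have "\<dots> = (\<integral>\<^sup>+w. ennreal (lyap p e xs n k (Z v k w) powr p) \<partial>M) * ennreal (exp (r (Suc k)))"
    using measurable_compose[OF \<open>Z v k \<in> borel_measurable M\<close> meas]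
    by (subst nn_integral_multc[symmetric]) (auto simp: ennreal_mult'')
  also have "\<dots> \<le> ennreal (lyap p e xs n 0 v powr p * exp (\<Sum>j=1..k. r j)) * ennreal (exp (r (Suc k)))"
    using Suc unfolding r_def by (intro mult_right_mono) auto
  also have "\<dots> = ennreal (lyap p e xs n 0 v powr p * exp (\<Sum>j=1..Suc k. r j))"
    by (simp add: ennreal_mult''[symmetric] exp_add mult.assoc)
  finally show ?case unfolding r_def .
qed

text \<open>The forcing by e2 sums to p * hx * C * (kap + 1 / L) up to constants;
  \<open>p_hx\<close> reduces this to 9 * 0.011234 * p \<le> p / 8, which Markov's factor 2^(-p)
  will beat. In the term from the mean of e1 the weight in the denominator contains p, so p cancels
  and only a constant below C remains.\<close>

lemma lyap_rate_sum:
  assumes n: "n \<le> N"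
  shows "(\<Sum>j=1..n. p * (9 * C * hx * (wt p n j / s j) + 54 * C\<^sup>2 / ((s j)\<^sup>2 * gam j * wt p n j)))
     \<le> p / 8 + C"
proof -
  define kap where "kap = 5616 * C * p / L"
  have L0: "0 < L" and C0: "0 < C" and om0: "0 < om" using L_ge C1 L_le by auto
  have kap0: "0 < kap" using p1 L0 C0 by (simp add: kap_def)
  have "(\<Sum>j=1..n. wt p n j / s j) = (\<Sum>j=1..n. kap * (om / s j / s j) + W n j / s j)"
    unfolding wt_def kap_def add_divide_distrib times_divide_eq_right[symmetric] ..
  also have "\<dots> = kap * (\<Sum>j=1..n. om / s j / s j) + (\<Sum>j=1..n. W n j / s j)"
    by (simp only: sum.distrib sum_distrib_left)
  also have "\<dots> \<le> kap * 2 + 2 / L"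
    using sum_om_div_s_sq[OF n] sum_W_div_s[OF n] kap0 by (intro add_mono mult_left_mono) auto
  finally have S1: "(\<Sum>j=1..n. wt p n j / s j) \<le> kap * 2 + 2 / L" .
  have "p * hx * C * (\<Sum>j=1..n. wt p n j / s j) \<le> p * hx * C * (kap * 2 + 2 / L)"
    using S1 p1 hx2 C0 by (intro mult_left_mono) auto
  also have "\<dots> = (p * hx) * (C * (11232 * C * p + 2)) / L" using L0 by (simp add: kap_def field_simps)
  also have "\<dots> \<le> (p * hx) * (11234 * C\<^sup>2 * p) / L"
  proof (intro divide_right_mono mult_left_mono)
    have "C * 1 \<le> C * (C * p)" using C1 p1 mult_mono[of 1 C 1 p] C0 by (intro mult_left_mono) auto
    then show "C * (11232 * C * p + 2) \<le> 11234 * C\<^sup>2 * p" by (simp add: algebra_simps power2_eq_square)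
  qed (use p1 hx2 L0 in auto)
  also have "\<dots> = (p * hx * (1000000 * C\<^sup>2)) * (11234 / 1000000 * p) / L" by simp
  also have "\<dots> \<le> L * (11234 / 1000000 * p) / L"
    using p_hx_le p1 L0 by (intro divide_right_mono mult_right_mono) auto
  also have "\<dots> = 11234 / 1000000 * p" using L0 by simp
  finally have T1: "9 * (p * hx * C * (\<Sum>j=1..n. wt p n j / s j)) \<le> p / 8" using p1 by simp
  have "(\<Sum>j=1..n. 1 / ((s j)\<^sup>2 * gam j * wt p n j)) \<le> (\<Sum>j=1..n. 1 / (kap * om) * (1 / (s j * gam j)))"
  proof (rule sum_mono)
    fix j assume j: "j \<in> {1..n}"
    have sp: "0 < s j" "0 < gam j" using s_pos[of j] gam_pos[of j] j n by auto
    have "kap * (om / s j) \<le> wt p n j" by (simp add: wt_def kap_def W_def)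
    then have "(s j)\<^sup>2 * gam j * (kap * (om / s j)) \<le> (s j)\<^sup>2 * gam j * wt p n j" using sp by (intro mult_left_mono) auto
    moreover have "(s j)\<^sup>2 * gam j * (kap * (om / s j)) = kap * om * (s j * gam j)"
      using sp by (simp add: power2_eq_square)
    moreover have "0 < kap * om * (s j * gam j)" using kap0 om0 sp by simp
    ultimately have "1 / ((s j)\<^sup>2 * gam j * wt p n j) \<le> 1 / (kap * om * (s j * gam j))"
      by (intro frac_le) auto
    then show "1 / ((s j)\<^sup>2 * gam j * wt p n j) \<le> 1 / (kap * om) * (1 / (s j * gam j))" by simp
  qed
  also have "\<dots> = 1 / (kap * om) * (\<Sum>j=1..n. 1 / (s j * gam j))" by (simp only: sum_distrib_left)
  also have "\<dots> \<le> 1 / (kap * om) * (3 * om / L)"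
    using sum_inverse_s_gam_le[OF n] kap0 om0 by (intro mult_left_mono) auto
  also have "\<dots> = 3 / (5616 * C * p)" using om0 L0 by (simp add: kap_def)
  finally have "p * (54 * C\<^sup>2) * (\<Sum>j=1..n. 1 / ((s j)\<^sup>2 * gam j * wt p n j)) \<le> p * (54 * C\<^sup>2) * (3 / (5616 * C * p))"
    using p1 by (intro mult_left_mono) auto
  also have "\<dots> \<le> C" using p1 C0 by (simp add: power2_eq_square)
  finally have T2: "p * (54 * C\<^sup>2) * (\<Sum>j=1..n. 1 / ((s j)\<^sup>2 * gam j * wt p n j)) \<le> C" .
  have "(\<Sum>j=1..n. p * (9 * C * hx * (wt p n j / s j) + 54 * C\<^sup>2 / ((s j)\<^sup>2 * gam j * wt p n j)))
     = (\<Sum>j=1..n. 9 * (p * hx * C) * (wt p n j / s j) + p * (54 * C\<^sup>2) * (1 / ((s j)\<^sup>2 * gam j * wt p n j)))"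
    by (intro sum.cong refl) (simp add: algebra_simps)
  also have "\<dots> = 9 * (p * hx * C * (\<Sum>j=1..n. wt p n j / s j))
      + p * (54 * C\<^sup>2) * (\<Sum>j=1..n. 1 / ((s j)\<^sup>2 * gam j * wt p n j))"
    by (simp only: sum.distrib sum_distrib_left mult.assoc)
  finally show ?thesis using T1 T2 by linarith
qed

lemma lyap_moment:
  assumes n: "n \<le> N"
  shows "(\<integral>\<^sup>+w. ennreal ((e + (cmod (Z v n w $ 1 - xs))\<^sup>2 + (cmod (Z v n w $ 2))\<^sup>2) powr p) \<partial>M)
    \<le> ennreal (lyap p e xs n 0 v powr p * exp (p / 8 + C))"
proof -
  have "(\<integral>\<^sup>+w. ennreal ((e + (cmod (Z v n w $ 1 - xs))\<^sup>2 + (cmod (Z v n w $ 2))\<^sup>2) powr p) \<partial>M)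
     \<le> (\<integral>\<^sup>+w. ennreal (lyap p e xs n n (Z v n w) powr p) \<partial>M)"
  proof (intro nn_integral_mono ennreal_leI powr_mono2)
    fix w
    have "1 \<le> wt p n n" using p1 C1 L_ge L_le s_pos[OF n] by (simp add: wt_def W_def)
    then have "1 * (cmod (Z v n w $ 2))\<^sup>2 \<le> wt p n n * (cmod (Z v n w $ 2))\<^sup>2" by (intro mult_right_mono) auto
    then show "e + (cmod (Z v n w $ 1 - xs))\<^sup>2 + (cmod (Z v n w $ 2))\<^sup>2 \<le> lyap p e xs n n (Z v n w)"
      by (simp add: lyap_def)
  qed (use p1 e0 in auto)
  also have "\<dots> \<le> ennreal (lyap p e xs n 0 v powr p
        * exp (\<Sum>j=1..n. p * (9 * C * hx * (wt p n j / s j) + 54 * C\<^sup>2 / ((s j)\<^sup>2 * gam j * wt p n j))))"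
    by (rule lyap_iterate[OF n order.refl])
  also have "\<dots> \<le> ennreal (lyap p e xs n 0 v powr p * exp (p / 8 + C))"
    using lyap_rate_sum[OF n] by (intro ennreal_leI mult_left_mono) auto
  finally show ?thesis .
qed

lemma lyap_tail:
  assumes n: "n \<le> N" and a: "0 \<le> a"
  shows "prob {w \<in> space M. a \<le> (cmod (Z v n w $ 1 - xs))\<^sup>2 + (cmod (Z v n w $ 2))\<^sup>2}
    \<le> (lyap p e xs n 0 v / (e + a)) powr p * exp (p / 8 + C)"
proof -
  have [measurable]: "Z v n \<in> borel_measurable M" using n by (rule Z_measurable)
  define f where "f = (\<lambda>w. e + (cmod (Z v n w $ 1 - xs))\<^sup>2 + (cmod (Z v n w $ 2))\<^sup>2)"
  have [measurable]: "f \<in> borel_measurable M" unfolding f_def by measurable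
  have ea: "0 < e + a" using e0 a by simp
  define c where "c = (e + a) powr p"
  have c0: "0 < c" using ea by (simp add: c_def)
  have l0: "0 \<le> lyap p e xs n 0 v"
    using e0 p1 C1 L_ge L_le s_pos[of 0]
    by (auto simp: lyap_def wt_def W_def intro!: add_nonneg_nonneg mult_nonneg_nonneg divide_nonneg_nonneg)
  let ?E = "{w \<in> space M. a \<le> (cmod (Z v n w $ 1 - xs))\<^sup>2 + (cmod (Z v n w $ 2))\<^sup>2}"
  have "emeasure M ?E \<le> emeasure M {w \<in> space M. 1 \<le> ennreal (1 / c) * ennreal (f w powr p)}"
  proof (intro emeasure_mono subsetI)
    fix w assume "w \<in> ?E"
    then have "e + a \<le> f w" and w: "w \<in> space M" by (auto simp: f_def)
    then have "c \<le> f w powr p" unfolding c_def using ea p1 by (intro powr_mono2) auto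
    then have "1 \<le> 1 / c * f w powr p" using c0 by simp
    then have "ennreal 1 \<le> ennreal (1 / c * f w powr p)" by (rule ennreal_leI)
    also have "\<dots> = ennreal (1 / c) * ennreal (f w powr p)" using c0 by (intro ennreal_mult') auto
    finally have "1 \<le> ennreal (1 / c) * ennreal (f w powr p)" by simp
    then show "w \<in> {w \<in> space M. 1 \<le> ennreal (1 / c) * ennreal (f w powr p)}"
      using w by simp
  qed measurable
  also have "\<dots> \<le> ennreal (1 / c) * (\<integral>\<^sup>+w. ennreal (f w powr p) \<partial>M)"
  proof -
    have "emeasure M {w \<in> space M. 1 \<le> ennreal (1 / c) * ennreal (f w powr p)}
       \<le> ennreal (1 / c) * (\<integral>\<^sup>+w. ennreal (f w powr p) * indicator (space M) w \<partial>M)"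
      by (rule nn_integral_Markov_inequality) auto
    also have "(\<integral>\<^sup>+w. ennreal (f w powr p) * indicator (space M) w \<partial>M) = (\<integral>\<^sup>+w. ennreal (f w powr p) \<partial>M)"
      by (intro nn_integral_cong) auto
    finally show ?thesis .
  qed
  also have "\<dots> \<le> ennreal (1 / c) * ennreal (lyap p e xs n 0 v powr p * exp (p / 8 + C))"
    unfolding f_def by (intro mult_left_mono lyap_moment[OF n]) auto
  also have "\<dots> = ennreal ((lyap p e xs n 0 v / (e + a)) powr p * exp (p / 8 + C))"
    using c0 l0 ea by (simp add: ennreal_mult'[symmetric] powr_divide c_def)
  finally show ?thesis by (simp add: emeasure_eq_measure ennreal_le_iff)
qed

end

end

section \<open>One step of the characteristic functional\<close>

text \<open>Every real quadratic form on \<open>\<complex>\<close> has this shape; it is nonnegative iff \<open>cmod p1 \<le> p0\<close>.\<close>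
definition qform :: "real \<Rightarrow> complex \<Rightarrow> complex \<Rightarrow> real" where
  "qform p0 p1 y = p0 * (cmod y)\<^sup>2 + Re (p1 * y\<^sup>2)"

lemma abs_Re_qform_le:
  assumes "cmod p1 \<le> p0" shows "\<bar>Re (p1 * y\<^sup>2)\<bar> \<le> p0 * (cmod y)\<^sup>2"
proof -
  have "\<bar>Re (p1 * y\<^sup>2)\<bar> \<le> cmod (p1 * y\<^sup>2)" by (rule abs_Re_le_cmod)
  also have "\<dots> = cmod p1 * (cmod y)\<^sup>2" by (simp add: norm_mult norm_power)
  also have "\<dots> \<le> p0 * (cmod y)\<^sup>2" using assms by (intro mult_right_mono) auto
  finally show ?thesis .
qed

lemma qform_nonneg: "cmod p1 \<le> p0 \<Longrightarrow> 0 \<le> qform p0 p1 y"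
  using abs_Re_qform_le[of p1 p0 y] by (simp add: qform_def)

lemma qform_le: "cmod p1 \<le> p0 \<Longrightarrow> qform p0 p1 y \<le> 2 * p0 * (cmod y)\<^sup>2"
  using abs_Re_qform_le[of p1 p0 y] by (simp add: qform_def)

lemma qform_add:
  "qform p0 p1 (y + z) = qform p0 p1 y + Re ((2 * p0 * cnj y + 2 * p1 * y) * z) + qform p0 p1 z"
  unfolding qform_def cmod_add_sq by (simp add: power2_eq_square algebra_simps)

lemma qform_lipschitz:
  assumes "cmod p1 \<le> p0"
  shows "\<bar>qform p0 p1 y - qform p0 p1 z\<bar> \<le> 2 * p0 * (cmod (y - z) * (cmod y + cmod z))"
proof -
  have p0: "0 \<le> p0" using assms norm_ge_zero order_trans by blast
  have "\<bar>(cmod y)\<^sup>2 - (cmod z)\<^sup>2\<bar> = \<bar>cmod y - cmod z\<bar> * (cmod y + cmod z)"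
  proof -
    have "(cmod y)\<^sup>2 - (cmod z)\<^sup>2 = (cmod y - cmod z) * (cmod y + cmod z)"
      by (simp add: power2_eq_square algebra_simps)
    then show ?thesis by (simp add: abs_mult)
  qed
  also have "\<dots> \<le> cmod (y - z) * (cmod y + cmod z)"
    by (intro mult_right_mono norm_triangle_ineq3) auto
  finally have 1: "p0 * \<bar>(cmod y)\<^sup>2 - (cmod z)\<^sup>2\<bar> \<le> p0 * (cmod (y - z) * (cmod y + cmod z))"
    using p0 by (intro mult_left_mono) auto
  have "\<bar>Re (p1 * (y\<^sup>2 - z\<^sup>2))\<bar> \<le> cmod (p1 * ((y - z) * (y + z)))"
    using abs_Re_le_cmod[of "p1 * (y\<^sup>2 - z\<^sup>2)"] by (simp add: power2_eq_square algebra_simps)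
  also have "\<dots> = cmod p1 * (cmod (y - z) * cmod (y + z))" by (simp add: norm_mult)
  also have "\<dots> \<le> p0 * (cmod (y - z) * (cmod y + cmod z))"
    using assms p0 by (intro mult_mono mult_left_mono norm_triangle_ineq) auto
  finally have 2: "\<bar>Re (p1 * (y\<^sup>2 - z\<^sup>2))\<bar> \<le> p0 * (cmod (y - z) * (cmod y + cmod z))" .
  have "qform p0 p1 y - qform p0 p1 z = p0 * ((cmod y)\<^sup>2 - (cmod z)\<^sup>2) + Re (p1 * (y\<^sup>2 - z\<^sup>2))"
    by (simp add: qform_def algebra_simps)
  moreover have "\<bar>p0 * ((cmod y)\<^sup>2 - (cmod z)\<^sup>2)\<bar> = p0 * \<bar>(cmod y)\<^sup>2 - (cmod z)\<^sup>2\<bar>" using p0 by (simp add: abs_mult)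
  ultimately show ?thesis using 1 2 by linarith
qed

text \<open>Both signs follow from convexity of exp, using the tangent at -v for the lower bound and
  at -u for the upper one. As u and v are nonnegative, u - v need not be small.\<close>

lemma exp_minus_remainder:
  fixes u v :: real
  assumes "0 \<le> u" "0 \<le> v"
  shows "\<bar>exp (- u) - exp (- v)\<bar> \<le> \<bar>u - v\<bar>"
    and "\<bar>exp (- u) - exp (- v) + exp (- v) * (u - v)\<bar> \<le> (u - v)\<^sup>2"
proof -
  have mono: "exp (- a) - exp (- c) \<le> c - a" if "0 \<le> a" "a \<le> c" for a c :: real
  proof -
    have "exp (- a) - exp (- c) = exp (- a) * (1 - exp (- (c - a)))"
      by (simp add: algebra_simps exp_add[symmetric])
    also have "\<dots> \<le> 1 * (c - a)"
    proof (intro mult_mono)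
      show "1 - exp (- (c - a)) \<le> c - a" using exp_ge_add_one_self[of "- (c - a)"] by linarith
    qed (use that in auto)
    finally show ?thesis by simp
  qed
  show 1: "\<bar>exp (- u) - exp (- v)\<bar> \<le> \<bar>u - v\<bar>"
    using mono[of u v] mono[of v u] assms by (cases "u \<le> v") auto
  have "0 \<le> exp (- v) * (exp (v - u) - 1 - (v - u))"
    using exp_ge_add_one_self[of "v - u"] by (intro mult_nonneg_nonneg; linarith?) simp
  also have e: "exp (- v) * (exp (v - u) - 1 - (v - u)) = exp (- u) - exp (- v) + exp (- v) * (u - v)"
    proof -
    have "exp (- v) * exp (v - u) = exp (- u)" by (simp add: exp_add[symmetric])
    then show ?thesis by (simp only: right_diff_distrib mult_1_right)
  qed
  finally have lo: "0 \<le> exp (- u) - exp (- v) + exp (- v) * (u - v)" .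
  have "0 \<le> exp (- u) * (exp (u - v) - 1 - (u - v))"
    using exp_ge_add_one_self[of "u - v"] by (intro mult_nonneg_nonneg; linarith?) simp
  also have "exp (- u) * (exp (u - v) - 1 - (u - v)) = exp (- v) - exp (- u) + exp (- u) * (v - u)"
    proof -
    have "exp (- u) * exp (u - v) = exp (- v)" by (simp add: exp_add[symmetric])
    then show ?thesis by (simp only: right_diff_distrib mult_1_right)
  qed
  finally have "exp (- u) - exp (- v) + exp (- v) * (u - v) \<le> (exp (- v) - exp (- u)) * (u - v)"
    by (simp add: algebra_simps)
  also have "\<dots> \<le> \<bar>exp (- v) - exp (- u)\<bar> * \<bar>u - v\<bar>" by (simp add: abs_mult[symmetric])
  also have "\<dots> \<le> \<bar>u - v\<bar> * \<bar>u - v\<bar>" using 1 by (intro mult_right_mono) (auto simp: abs_minus_commute)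
  also have "\<dots> = (u - v)\<^sup>2" by (simp add: power2_eq_square)
  finally show "\<bar>exp (- u) - exp (- v) + exp (- v) * (u - v)\<bar> \<le> (u - v)\<^sup>2" using lo by simp
qed

text \<open>Second order in the phase \<xi> but only first order in the damping u. All exponentials
  have modulus at most 1, so the bound is global.\<close>

lemma iexp_times_exp_remainder:
  fixes \<xi> u v :: real
  assumes "0 \<le> u" "0 \<le> v"
  shows "cmod (iexp \<xi> * exp (- u) - exp (- v) * (1 + \<i> * \<xi> - \<xi>\<^sup>2 / 2 - (u - v)))
     \<le> \<bar>\<xi>\<bar> * \<bar>u - v\<bar> + (u - v)\<^sup>2 + \<bar>\<xi>\<bar> ^ 3"
proof -
  have a: "cmod (iexp \<xi> - 1) \<le> \<bar>\<xi>\<bar>"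
    using iexp_approx1[of \<xi> 0] by simp
  have b: "cmod (iexp \<xi> - (1 + \<i> * \<xi> - \<xi>\<^sup>2 / 2)) \<le> \<bar>\<xi>\<bar> ^ 3"
  proof -
    have "(\<i> * complex_of_real \<xi>) ^ 2 = - complex_of_real (\<xi>\<^sup>2)" by (simp add: power_mult_distrib)
    moreover have "(\<Sum>k\<le>2. (\<i> * complex_of_real \<xi>) ^ k / fact k)
       = 1 + \<i> * complex_of_real \<xi> + (\<i> * complex_of_real \<xi>) ^ 2 / 2"
      by (simp add: numeral_2_eq_2)
    ultimately have "(\<Sum>k\<le>2. (\<i> * complex_of_real \<xi>) ^ k / fact k) = 1 + \<i> * \<xi> - \<xi>\<^sup>2 / 2" by simp
    then have "cmod (iexp \<xi> - (1 + \<i> * \<xi> - \<xi>\<^sup>2 / 2)) \<le> \<bar>\<xi>\<bar> ^ 3 / 6"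
      using iexp_approx1[of \<xi> 2] by (simp add: eval_nat_numeral)
    also have "\<dots> \<le> \<bar>\<xi>\<bar> ^ 3" by simp
    finally show ?thesis .
  qed
  have "iexp \<xi> * exp (- u) - exp (- v) * (1 + \<i> * \<xi> - \<xi>\<^sup>2 / 2 - (u - v))
     = (iexp \<xi> - 1) * of_real (exp (- u) - exp (- v))
       + of_real (exp (- u) - exp (- v) + exp (- v) * (u - v))
       + of_real (exp (- v)) * (iexp \<xi> - (1 + \<i> * \<xi> - \<xi>\<^sup>2 / 2))"
    by (simp add: algebra_simps)
  also have "cmod \<dots> \<le> cmod (iexp \<xi> - 1) * \<bar>exp (- u) - exp (- v)\<bar>
      + \<bar>exp (- u) - exp (- v) + exp (- v) * (u - v)\<bar> + exp (- v) * cmod (iexp \<xi> - (1 + \<i> * \<xi> - \<xi>\<^sup>2 / 2))"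
    by (intro order_trans[OF norm_triangle_ineq] add_mono) (simp_all only: norm_mult norm_of_real abs_exp_cancel order.refl)
  also have "\<dots> \<le> \<bar>\<xi>\<bar> * \<bar>u - v\<bar> + (u - v)\<^sup>2 + 1 * \<bar>\<xi>\<bar> ^ 3"
    using a b exp_minus_remainder[OF assms] assms by (intro add_mono mult_mono) auto
  finally show ?thesis by simp
qed

text \<open>Almost surely the noise lies in a compact product of balls, where \<open>F\<close> is
  bounded. It settles all integrability questions of \<open>phase_step\<close>.\<close>

lemma (in prob_space) integrable_continuous_noise:
  fixes F :: "complex \<times> complex \<times> complex \<Rightarrow> 'b::{banach, second_countable_topology}"
  assumes F: "continuous_on UNIV F"
    and e: "small_noise M m v B e1" "small_noise M m v B e2" "small_noise M m v B e3"
  shows "integrable M (\<lambda>w. F (e1 w, e2 w, e3 w))"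
proof -
  note [measurable] = small_noiseD(1)[OF e(1)] small_noiseD(1)[OF e(2)] small_noiseD(1)[OF e(3)]
  have "compact (F ` (cball 0 B \<times> cball 0 B \<times> cball 0 B))"
    by (intro compact_continuous_image continuous_on_subset[OF F] compact_Times) auto
  then obtain K where K: "\<And>z. z \<in> cball 0 B \<times> cball 0 B \<times> cball 0 B \<Longrightarrow> norm (F z) \<le> K"
    by (meson bounded_iff compact_imp_bounded imageI)
  show ?thesis
  proof (rule integrable_const_bound)
    show "AE w in M. norm (F (e1 w, e2 w, e3 w)) \<le> K"
      using small_noiseD(2)[OF e(1)] small_noiseD(2)[OF e(2)] small_noiseD(2)[OF e(3)]
      by eventually_elim (auto intro!: K simp: dist_norm)
    show "(\<lambda>w. F (e1 w, e2 w, e3 w)) \<in> borel_measurable M"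
      by (rule borel_measurable_continuous_on[OF F]) (simp add: borel_prod[symmetric])
  qed
qed

lemma (in prob_space) abs_Re_mean_le:
  assumes "small_noise M m v B e"
  shows "\<bar>LINT w|M. Re (c * e w)\<bar> \<le> cmod c * m"
proof -
  note e = small_noiseD[OF assms]
  have "(LINT w|M. Re (c * e w)) = Re (c * (LINT w|M. e w))" using e by simp
  moreover have "\<bar>Re (c * (LINT w|M. e w))\<bar> \<le> cmod (c * (LINT w|M. e w))" by (rule abs_Re_le_cmod)
  moreover have "\<dots> \<le> cmod c * m" unfolding norm_mult by (intro mult_left_mono e) auto
  ultimately show ?thesis by simp
qed

text \<open>The functional of the overview without its scalar factor exp (- g_k), which is
  accumulated separately as a product of factors exp (- h).\<close>

definition phase :: "complex \<Rightarrow> complex \<Rightarrow> real \<Rightarrow> complex \<Rightarrow> complex \<Rightarrow> complex \<Rightarrow> complex" where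
  "phase b a p0 p1 x y = iexp (Re (b * (x - 1) + a * y)) * exp (- qform p0 p1 y)"

lemma cmod_phase_le: "cmod p1 \<le> p0 \<Longrightarrow> cmod (phase b a p0 p1 x y) \<le> 1"
  unfolding phase_def norm_mult using qform_nonneg[of p1 p0 y] by simp

text \<open>In \<open>phase_step\<close> the summands are, in order: mean of the phase increment;
  its variance beyond the two kept parts; mean of the increment of the form (two summands); phase
  times form; form squared; phase cubed; and the second-order error of 1 - (q + h) against exp (- (q
  + h)). Y, d, w stand for |x| + |y| + 1, |x - 1|, |y|.\<close>

definition phase_error :: "real \<Rightarrow> real \<Rightarrow> real \<Rightarrow> real \<Rightarrow> real \<Rightarrow> real \<Rightarrow> real \<Rightarrow> real \<Rightarrow> real \<Rightarrow> real" where
  "phase_error \<alpha> \<beta> p m v B Y d w =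
     \<alpha> * m * Y + 16 * v * (\<beta> * w * \<alpha> * Y + \<alpha>\<^sup>2 * (d + w) * Y) + 4 * p * w * m * Y + 64 * v * p * (d + w) * Y
     + 64 * v * (\<beta> * w + \<alpha> * Y) * p * Y * (w + 2 * B * Y) + 256 * v * p\<^sup>2 * Y\<^sup>2 * (w + 2 * B * Y)\<^sup>2
     + 64 * B * v * (\<beta> * w + \<alpha> * Y) ^ 3 + 64 * v\<^sup>2 * (\<beta>\<^sup>2 * w\<^sup>2 + \<alpha>\<^sup>2 + 4 * p)\<^sup>2"

lemma sum7_le:
  fixes a1 a2 a3 a4 a5 a6 a7 :: real
  assumes "a1 \<le> b1" "a2 \<le> b2" "a3 \<le> b3 + c3" "a4 \<le> b4" "a5 \<le> b5" "a6 \<le> b6" "a7 \<le> b7"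
  shows "a4 + a5 + a6 + (a1 + (a2 + a3 + a7)) \<le> b1 + b2 + b3 + c3 + b4 + b5 + b6 + b7"
  using assms by linarith

text \<open>
  The new form \<open>(p0', p1')\<close> contains half the variance of \<open>Re (b * e1 * y)\<close> and the new \<open>a'\<close> its mean.
  These are the two contributions that are summable only after averaging over \<open>y\<close>; all others
  are either the deterministic factor \<open>exp (- h)\<close> or an error.
\<close>
lemma (in prob_space) phase_step:
  fixes x y r b a p1 :: complex and p0 m v B :: real and e1 e2 e3 :: "'a \<Rightarrow> complex"
  defines "c1 \<equiv> (\<lambda>w. e1 w - (LINT w|M. e1 w))"
  defines "a' \<equiv> r * a + b * (LINT w|M. e1 w)"
    and "p0' \<equiv> (cmod r)\<^sup>2 * p0 + (cmod b)\<^sup>2 * (LINT w|M. (cmod (c1 w))\<^sup>2) / 4"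
    and "p1' \<equiv> r\<^sup>2 * p1 + b\<^sup>2 * (LINT w|M. (c1 w)\<^sup>2) / 4"
    and "h \<equiv> (LINT w|M. (Re (a * e2 w))\<^sup>2) / 2 + (LINT w|M. qform p0 p1 (e2 w))"
  assumes r: "cmod r \<le> 1" and p: "cmod p1 \<le> p0"
    and noise: "small_noise M m v B e1" "small_noise M m v B e2" "small_noise M m v B e3"
    and m: "m \<le> v" "m \<le> 1" "m \<le> B"
  shows "0 \<le> h" and "cmod ((LINT w|M. phase b a p0 p1 (x + e1 w * y) (r * y + (e2 w * x - e3 w * y)))
            - complex_of_real (exp (- h)) * phase b a' p0' p1' x y)
      \<le> phase_error (cmod a) (cmod b) p0 m v B (cmod x + cmod y + 1) (cmod (x - 1)) (cmod y)"
proof -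
  note n1 = small_noiseD[OF noise(1)] and n2 = small_noiseD[OF noise(2)] and n3 = small_noiseD[OF noise(3)]
  define \<mu> where "\<mu> = (LINT w|M. e1 w)"
  have mu: "cmod \<mu> \<le> m" using n1 by (simp add: \<mu>_def)
  have m0: "0 \<le> m" and v0: "0 \<le> v" using n1 by auto
  define \<alpha> \<beta> Y d y' where "\<alpha> = cmod a" and "\<beta> = cmod b" and "Y = cmod x + cmod y + 1"
    and "d = cmod (x - 1)" and "y' = cmod y"
  have p0: "0 \<le> p0" using p norm_ge_zero order_trans by blast
  have pos: "0 \<le> \<alpha>" "0 \<le> \<beta>" "1 \<le> Y" "0 \<le> d" "0 \<le> y'" "y' \<le> Y" by (auto simp: \<alpha>_def \<beta>_def Y_def d_def y'_def)
  have B0: "0 \<le> B" using m m0 by simp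
  define \<nu> where "\<nu> = (\<lambda>w. e2 w * x - e3 w * y)"
  define \<xi>1 \<xi>2 \<zeta> where "\<xi>1 = (\<lambda>w. Re (b * (e1 w - \<mu>) * y))" and "\<xi>2 = (\<lambda>w. Re (a * \<nu> w))"
    and "\<zeta> = (\<lambda>w. Re (a * e2 w))"
  define \<xi> where "\<xi> = (\<lambda>w. \<xi>1 w + \<xi>2 w)"
  define u u0 where "u = (\<lambda>w. qform p0 p1 (r * y + \<nu> w))" and "u0 = qform p0 p1 (r * y)"
  define cc where "cc = 2 * p0 * cnj (r * y) + 2 * p1 * (r * y)"
  define D where "D = (\<lambda>w. u w - u0)"
  have D_eq: "D w = Re (cc * \<nu> w) + qform p0 p1 (\<nu> w)" for w
    unfolding D_def u_def u0_def qform_add cc_def by simp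
  \<comment> \<open>A common majorant for all noise terms, with mean square at most 16 * v and
    almost sure bound 4 * B; all second-order errors below are multiples of its square.\<close>
  define n where "n = (\<lambda>w. cmod (e1 w) + cmod (e2 w) + cmod (e3 w) + cmod \<mu>)"
  have n0: "0 \<le> n w" for w by (simp add: n_def)
  have le_n: "cmod (e1 w - \<mu>) \<le> n w" "cmod (e2 w) \<le> n w" "cmod (e2 w) + cmod (e3 w) \<le> n w" for w
    using norm_triangle_ineq4[of "e1 w" \<mu>] norm_ge_zero[of "e1 w"] norm_ge_zero[of "e2 w"]
      norm_ge_zero[of "e3 w"] norm_ge_zero[of \<mu>] unfolding n_def by linarith+
  have ic: "integrable M (\<lambda>w. F (e1 w) (e2 w) (e3 w))"
    if "continuous_on UNIV (\<lambda>z. F (fst z) (fst (snd z)) (snd (snd z)))"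
    for F :: "complex \<Rightarrow> complex \<Rightarrow> complex \<Rightarrow> 'b::{banach, second_countable_topology}"
    using integrable_continuous_noise[OF that noise] by simp
  have n_le: "AE w in M. n w \<le> 4 * B"
    using n1(2) n2(2) n3(2) by eventually_elim (use mu m in \<open>auto simp: n_def\<close>)
  have int_n2: "integrable M (\<lambda>w. (n w)\<^sup>2)"
    unfolding n_def by (rule ic[of "\<lambda>e1 e2 e3. (cmod e1 + cmod e2 + cmod e3 + cmod \<mu>)\<^sup>2"]) (intro continuous_intros)
  have En2: "(LINT w|M. (n w)\<^sup>2) \<le> 16 * v"
  proof -
    have "(n w)\<^sup>2 \<le> 4 * (cmod (e1 w))\<^sup>2 + 4 * (cmod (e2 w))\<^sup>2 + 4 * (cmod (e3 w))\<^sup>2 + 4 * (cmod \<mu>)\<^sup>2" for w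
    proof -
      have "(p + q + s + t)\<^sup>2 \<le> 4 * p\<^sup>2 + 4 * q\<^sup>2 + 4 * s\<^sup>2 + 4 * t\<^sup>2" for p q s t :: real
      proof -
        have "0 \<le> (p - q)\<^sup>2 + (p - s)\<^sup>2 + (p - t)\<^sup>2 + (q - s)\<^sup>2 + (q - t)\<^sup>2 + (s - t)\<^sup>2" by simp
        then show ?thesis by (simp add: power2_eq_square algebra_simps)
      qed
      then show ?thesis by (simp add: n_def)
    qed
    then have "(LINT w|M. (n w)\<^sup>2) \<le> (LINT w|M. 4 * (cmod (e1 w))\<^sup>2 + 4 * (cmod (e2 w))\<^sup>2 + 4 * (cmod (e3 w))\<^sup>2 + 4 * (cmod \<mu>)\<^sup>2)"
      using int_n2 n1 n2 n3 by (intro integral_mono) auto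
    also have "\<dots> = 4 * (LINT w|M. (cmod (e1 w))\<^sup>2) + 4 * (LINT w|M. (cmod (e2 w))\<^sup>2)
        + 4 * (LINT w|M. (cmod (e3 w))\<^sup>2) + 4 * (cmod \<mu>)\<^sup>2"
      using n1 n2 n3 by (simp add: prob_space)
    also have "(cmod \<mu>)\<^sup>2 \<le> v"
    proof -
      have "(cmod \<mu>)\<^sup>2 \<le> m * 1" unfolding power2_eq_square using mu m m0 by (intro mult_mono) auto
      then show ?thesis using m by simp
    qed
    finally show ?thesis using n1(4) n2(4) n3(4) by simp
  qed
  have bound_n2: "\<bar>LINT w|M. f w\<bar> \<le> 16 * v * c"
    if f: "integrable M f" and fn: "AE w in M. \<bar>f w\<bar> \<le> c * (n w)\<^sup>2" and c: "0 \<le> c" for f :: "'a \<Rightarrow> real" and c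
  proof -
    have "\<bar>LINT w|M. f w\<bar> \<le> (LINT w|M. \<bar>f w\<bar>)" by (rule integral_abs_bound)
    also have "\<dots> \<le> (LINT w|M. c * (n w)\<^sup>2)" using f int_n2 fn by (intro integral_mono_AE) auto
    also have "\<dots> = c * (LINT w|M. (n w)\<^sup>2)" by simp
    also have "\<dots> \<le> c * (16 * v)" using En2 c by (intro mult_left_mono)
    finally show ?thesis by (simp add: mult_ac)
  qed
  note ci = continuous_intros
  have int_xi1: "integrable M \<xi>1" "integrable M (\<lambda>w. (\<xi>1 w)\<^sup>2)"
    unfolding \<xi>1_def
    by (rule ic[of "\<lambda>e1 e2 e3. Re (b * (e1 - \<mu>) * y)"], intro ci,
        rule ic[of "\<lambda>e1 e2 e3. (Re (b * (e1 - \<mu>) * y))\<^sup>2"], intro ci)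
  have int_xi2: "integrable M \<xi>2"
    unfolding \<xi>2_def \<nu>_def
    by (rule ic[of "\<lambda>e1 e2 e3. Re (a * (e2 * x - e3 * y))"], intro ci)
  have int_zeta2: "integrable M (\<lambda>w. (\<zeta> w)\<^sup>2)"
    unfolding \<zeta>_def by (rule ic[of "\<lambda>e1 e2 e3. (Re (a * e2))\<^sup>2"], intro ci)
  have int_xi: "integrable M \<xi>" unfolding \<xi>_def using int_xi1 int_xi2 by auto
  have int_xisq: "integrable M (\<lambda>w. (\<xi> w)\<^sup>2)"
    unfolding \<xi>_def \<xi>1_def \<xi>2_def \<nu>_def
    by (rule ic[of "\<lambda>e1 e2 e3. (Re (b * (e1 - \<mu>) * y) + Re (a * (e2 * x - e3 * y)))\<^sup>2"], intro ci)
  have int_q2: "integrable M (\<lambda>w. qform p0 p1 (e2 w))"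
    unfolding qform_def by (rule ic[of "\<lambda>e1 e2 e3. p0 * (cmod e2)\<^sup>2 + Re (p1 * e2\<^sup>2)"], intro ci)
  have int_qnu: "integrable M (\<lambda>w. qform p0 p1 (\<nu> w))"
    unfolding qform_def \<nu>_def
    by (rule ic[of "\<lambda>e1 e2 e3. p0 * (cmod (e2 * x - e3 * y))\<^sup>2 + Re (p1 * (e2 * x - e3 * y)\<^sup>2)"], intro ci)
  have int_lin: "integrable M (\<lambda>w. Re (cc * \<nu> w))"
    unfolding \<nu>_def by (rule ic[of "\<lambda>e1 e2 e3. Re (cc * (e2 * x - e3 * y))"], intro ci)
  have int_D: "integrable M D" unfolding D_eq[abs_def] using int_lin int_qnu by auto
  have D_fun: "D = (\<lambda>w. Re (cc * (e2 w * x - e3 w * y)) + (p0 * (cmod (e2 w * x - e3 w * y))\<^sup>2 + Re (p1 * (e2 w * x - e3 w * y)\<^sup>2)))"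
    unfolding D_eq[abs_def] qform_def \<nu>_def ..
  have xi_fun: "\<xi> = (\<lambda>w. Re (b * (e1 w - \<mu>) * y) + Re (a * (e2 w * x - e3 w * y)))"
    unfolding \<xi>_def \<xi>1_def \<xi>2_def \<nu>_def ..
  have int_xiD: "integrable M (\<lambda>w. \<bar>\<xi> w\<bar> * \<bar>D w\<bar>)"
    unfolding D_fun xi_fun
    by (rule ic[of "\<lambda>e1 e2 e3. \<bar>Re (b * (e1 - \<mu>) * y) + Re (a * (e2 * x - e3 * y))\<bar> *
       \<bar>Re (cc * (e2 * x - e3 * y)) + (p0 * (cmod (e2 * x - e3 * y))\<^sup>2 + Re (p1 * (e2 * x - e3 * y)\<^sup>2))\<bar>"], intro ci)
  have int_D2: "integrable M (\<lambda>w. (D w)\<^sup>2)"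
    unfolding D_fun
    by (rule ic[of "\<lambda>e1 e2 e3.
       (Re (cc * (e2 * x - e3 * y)) + (p0 * (cmod (e2 * x - e3 * y))\<^sup>2 + Re (p1 * (e2 * x - e3 * y)\<^sup>2)))\<^sup>2"], intro ci)
  have int_xi3: "integrable M (\<lambda>w. \<bar>\<xi> w\<bar> ^ 3)"
    unfolding xi_fun
    by (rule ic[of "\<lambda>e1 e2 e3. \<bar>Re (b * (e1 - \<mu>) * y) + Re (a * (e2 * x - e3 * y))\<bar> ^ 3"], intro ci)
  have int_E: "integrable M (\<lambda>w. iexp (\<xi> w) * exp (- u w))"
    unfolding xi_fun u_def qform_def \<nu>_def
    by (rule ic[of "\<lambda>e1 e2 e3. iexp (Re (b * (e1 - \<mu>) * y) + Re (a * (e2 * x - e3 * y))) *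
       complex_of_real (exp (- (p0 * (cmod (r * y + (e2 * x - e3 * y)))\<^sup>2 + Re (p1 * (r * y + (e2 * x - e3 * y))\<^sup>2))))"], intro ci)
  have nu_le: "cmod (\<nu> w) \<le> n w * Y" for w
  proof -
    have "cmod (\<nu> w) \<le> cmod (e2 w) * cmod x + cmod (e3 w) * cmod y"
      unfolding \<nu>_def using norm_triangle_ineq4[of "e2 w * x" "e3 w * y"] by (simp add: norm_mult)
    also have "\<dots> \<le> cmod (e2 w) * Y + cmod (e3 w) * Y" by (intro add_mono mult_left_mono) (auto simp: Y_def)
    also have "\<dots> = (cmod (e2 w) + cmod (e3 w)) * Y" by (simp add: algebra_simps)
    also have "\<dots> \<le> n w * Y" using le_n pos by (intro mult_right_mono) auto
    finally show ?thesis .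
  qed
  \<comment> \<open>Comparison with the state (1, 0), where the noise in y is just e2. This is what
    makes \<open>h\<close> independent of the state.\<close>
  have nu_e2: "cmod (\<nu> w - e2 w) \<le> n w * (d + y')" for w
  proof -
    have "\<nu> w - e2 w = e2 w * (x - 1) - e3 w * y" by (simp add: \<nu>_def algebra_simps)
    then have "cmod (\<nu> w - e2 w) \<le> cmod (e2 w) * d + cmod (e3 w) * y'"
      using norm_triangle_ineq4[of "e2 w * (x - 1)" "e3 w * y"] by (simp add: norm_mult d_def y'_def)
    also have "\<dots> \<le> cmod (e2 w) * (d + y') + cmod (e3 w) * (d + y')" using pos by (intro add_mono mult_left_mono) auto
    also have "\<dots> = (cmod (e2 w) + cmod (e3 w)) * (d + y')" by (simp add: algebra_simps)
    also have "\<dots> \<le> n w * (d + y')" using le_n pos by (intro mult_right_mono) auto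
    finally show ?thesis .
  qed
  have nu_plus_e2: "cmod (\<nu> w) + cmod (e2 w) \<le> n w * (2 * Y)" for w
  proof -
    have "cmod (e2 w) \<le> n w * Y" using le_n(2)[of w] pos n0[of w] mult_mono[of "cmod (e2 w)" "n w" 1 Y] by simp
    then show ?thesis using nu_le[of w] by simp
  qed
  have xi1_le: "\<bar>\<xi>1 w\<bar> \<le> n w * (\<beta> * y')" for w
  proof -
    have "\<bar>\<xi>1 w\<bar> \<le> cmod (e1 w - \<mu>) * (\<beta> * y')"
      unfolding \<xi>1_def using abs_Re_le_cmod[of "b * (e1 w - \<mu>) * y"] by (simp add: norm_mult \<beta>_def y'_def mult_ac)
    also have "\<dots> \<le> n w * (\<beta> * y')" using le_n pos by (intro mult_right_mono) auto
    finally show ?thesis .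
  qed
  have Re_a: "\<bar>Re (a * z)\<bar> \<le> \<alpha> * cmod z" for z
    using abs_Re_le_cmod[of "a * z"] by (simp add: norm_mult \<alpha>_def)
  have xi2_le: "\<bar>\<xi>2 w\<bar> \<le> n w * (\<alpha> * Y)" for w
  proof -
    have "\<bar>\<xi>2 w\<bar> \<le> \<alpha> * cmod (\<nu> w)" unfolding \<xi>2_def by (rule Re_a)
    also have "\<dots> \<le> \<alpha> * (n w * Y)" using nu_le pos by (intro mult_left_mono) auto
    finally show ?thesis by (simp add: mult_ac)
  qed
  have xi_le: "\<bar>\<xi> w\<bar> \<le> n w * (\<beta> * y' + \<alpha> * Y)" for w
    using abs_triangle_ineq[of "\<xi>1 w" "\<xi>2 w"] xi1_le[of w] xi2_le[of w] by (simp add: \<xi>_def algebra_simps)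
  have cc_le: "cmod cc \<le> 4 * p0 * y'"
  proof -
    have ry: "cmod (r * y) \<le> y'" using r by (simp add: norm_mult y'_def mult_left_le_one_le)
    have "cmod cc \<le> 2 * p0 * cmod (r * y) + 2 * cmod p1 * cmod (r * y)"
      unfolding cc_def using norm_triangle_ineq[of "2 * p0 * cnj (r * y)" "2 * p1 * (r * y)"] p0
      by (simp add: norm_mult)
    also have "\<dots> \<le> 2 * p0 * y' + 2 * p0 * y'" using ry p p0 by (intro add_mono mult_mono) auto
    finally show ?thesis by simp
  qed
  have D_le: "\<bar>D w\<bar> \<le> n w * (2 * p0 * Y * (2 * y' + 4 * B * Y))" if nB: "n w \<le> 4 * B" for w
  proof -
    have "\<bar>Re (cc * \<nu> w)\<bar> \<le> cmod cc * cmod (\<nu> w)" using abs_Re_le_cmod[of "cc * \<nu> w"] by (simp add: norm_mult)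
    also have "\<dots> \<le> (4 * p0 * y') * (n w * Y)" using cc_le nu_le p0 pos by (intro mult_mono) auto
    finally have 1: "\<bar>Re (cc * \<nu> w)\<bar> \<le> n w * (2 * p0 * Y * (2 * y'))" by (simp add: mult_ac)
    have "\<bar>qform p0 p1 (\<nu> w)\<bar> \<le> 2 * p0 * (cmod (\<nu> w))\<^sup>2"
      using qform_le[OF p] qform_nonneg[OF p] by simp
    also have "\<dots> \<le> 2 * p0 * (n w * Y)\<^sup>2" using nu_le p0 by (intro mult_left_mono power_mono) auto
    also have "\<dots> = n w * (2 * p0 * Y * (n w * Y))" by (simp add: power2_eq_square)
    also have "\<dots> \<le> n w * (2 * p0 * Y * (4 * B * Y))"
      using nB n0 p0 pos by (intro mult_left_mono mult_right_mono) auto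
    finally have 2: "\<bar>qform p0 p1 (\<nu> w)\<bar> \<le> n w * (2 * p0 * Y * (4 * B * Y))" .
    show ?thesis unfolding D_eq using 1 2 by (simp add: algebra_simps)
  qed
  define q where "q = (LINT w|M. (\<xi>1 w)\<^sup>2) / 2"
  have h_def: "h = (LINT w|M. (\<zeta> w)\<^sup>2) / 2 + (LINT w|M. qform p0 p1 (e2 w))"
    unfolding h_def \<zeta>_def ..
  have q0: "0 \<le> q" by (simp add: q_def)
  have h0: "0 \<le> h" unfolding h_def using qform_nonneg[OF p] by (intro add_nonneg_nonneg) auto
  have u0_0: "0 \<le> u0" and u_0: "0 \<le> u w" for w unfolding u0_def u_def by (auto intro: qform_nonneg p)
  \<comment> \<open>The mean of e1 has been moved into \<open>a'\<close>, so \<xi>1 is centred and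
    contributes only its variance, which moves into the new form.\<close>
  have Exi1: "(LINT w|M. \<xi>1 w) = 0"
  proof -
    have "(LINT w|M. \<xi>1 w) = (LINT w|M. Re (b * y * e1 w) - Re (b * y * \<mu>))"
      by (intro Bochner_Integration.integral_cong refl) (simp add: \<xi>1_def algebra_simps)
    also have "\<dots> = Re (b * y * (LINT w|M. e1 w)) - Re (b * y * \<mu>)" using n1 by (simp add: prob_space)
    finally show ?thesis by (simp add: \<mu>_def)
  qed
  have lin_mean: "\<bar>LINT w|M. Re (c * \<nu> w)\<bar> \<le> cmod c * (m * Y)" for c
  proof -
    have "(LINT w|M. Re (c * \<nu> w)) = (LINT w|M. Re (c * x * e2 w) - Re (c * y * e3 w))"
      by (intro Bochner_Integration.integral_cong refl) (simp add: \<nu>_def algebra_simps)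
    also have "\<dots> = (LINT w|M. Re (c * x * e2 w)) - (LINT w|M. Re (c * y * e3 w))"
      using n2 n3 by (intro Bochner_Integration.integral_diff) auto
    finally have "\<bar>LINT w|M. Re (c * \<nu> w)\<bar> \<le> cmod (c * x) * m + cmod (c * y) * m"
      using abs_Re_mean_le[OF noise(2), of "c * x"] abs_Re_mean_le[OF noise(3), of "c * y"] by linarith
    also have "\<dots> = cmod c * (m * (cmod x + cmod y))" by (simp add: norm_mult algebra_simps)
    also have "\<dots> \<le> cmod c * (m * Y)" using m0 by (intro mult_left_mono) (auto simp: Y_def)
    finally show ?thesis .
  qed
  have T1: "\<bar>LINT w|M. \<xi> w\<bar> \<le> \<alpha> * m * Y"
    using lin_mean[of a] int_xi1 int_xi2 by (simp add: \<xi>_def Exi1 \<xi>2_def \<alpha>_def mult_ac)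
  have T2: "\<bar>(LINT w|M. (\<xi> w)\<^sup>2) / 2 - q - (LINT w|M. (\<zeta> w)\<^sup>2) / 2\<bar> \<le> 16 * v * (\<beta> * y' * \<alpha> * Y + \<alpha>\<^sup>2 * (d + y') * Y)"
  proof -
    have "(LINT w|M. (\<xi> w)\<^sup>2) / 2 - q - (LINT w|M. (\<zeta> w)\<^sup>2) / 2
      = (LINT w|M. (\<xi> w)\<^sup>2 / 2 - (\<xi>1 w)\<^sup>2 / 2 - (\<zeta> w)\<^sup>2 / 2)"
      using int_xisq int_xi1 int_zeta2 by (simp add: q_def)
    also have "\<bar>\<dots>\<bar> \<le> 16 * v * (\<beta> * y' * \<alpha> * Y + \<alpha>\<^sup>2 * (d + y') * Y)"
    proof (rule bound_n2)
      show "integrable M (\<lambda>w. (\<xi> w)\<^sup>2 / 2 - (\<xi>1 w)\<^sup>2 / 2 - (\<zeta> w)\<^sup>2 / 2)"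
        using int_xisq int_xi1 int_zeta2 by auto
      show "AE w in M. \<bar>(\<xi> w)\<^sup>2 / 2 - (\<xi>1 w)\<^sup>2 / 2 - (\<zeta> w)\<^sup>2 / 2\<bar> \<le> (\<beta> * y' * \<alpha> * Y + \<alpha>\<^sup>2 * (d + y') * Y) * (n w)\<^sup>2"
      proof (rule AE_I2)
        fix w
        have "(\<xi> w)\<^sup>2 / 2 - (\<xi>1 w)\<^sup>2 / 2 - (\<zeta> w)\<^sup>2 / 2 = \<xi>1 w * \<xi>2 w + (\<xi>2 w - \<zeta> w) * (\<xi>2 w + \<zeta> w) / 2"
          by (simp add: \<xi>_def power2_eq_square field_simps)
        also have "\<bar>\<dots>\<bar> \<le> \<bar>\<xi>1 w\<bar> * \<bar>\<xi>2 w\<bar> + \<bar>\<xi>2 w - \<zeta> w\<bar> * \<bar>\<xi>2 w + \<zeta> w\<bar> / 2"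
          using abs_triangle_ineq[of "\<xi>1 w * \<xi>2 w" "(\<xi>2 w - \<zeta> w) * (\<xi>2 w + \<zeta> w) / 2"] by (simp add: abs_mult)
        also have "\<dots> \<le> (n w * (\<beta> * y')) * (n w * (\<alpha> * Y)) + (\<alpha> * (n w * (d + y'))) * (\<alpha> * (n w * (2 * Y))) / 2"
        proof (intro add_mono divide_right_mono mult_mono)
          have "\<xi>2 w - \<zeta> w = Re (a * (\<nu> w - e2 w))" by (simp add: \<xi>2_def \<zeta>_def algebra_simps)
          then have "\<bar>\<xi>2 w - \<zeta> w\<bar> \<le> \<alpha> * cmod (\<nu> w - e2 w)" using Re_a[of "\<nu> w - e2 w"] by simp
          also have "\<dots> \<le> \<alpha> * (n w * (d + y'))" using nu_e2 pos by (intro mult_left_mono) auto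
          finally show "\<bar>\<xi>2 w - \<zeta> w\<bar> \<le> \<alpha> * (n w * (d + y'))" .
          have "\<xi>2 w + \<zeta> w = Re (a * (\<nu> w + e2 w))" by (simp add: \<xi>2_def \<zeta>_def algebra_simps)
          then have "\<bar>\<xi>2 w + \<zeta> w\<bar> \<le> \<alpha> * cmod (\<nu> w + e2 w)" using Re_a[of "\<nu> w + e2 w"] by simp
          also have "\<dots> \<le> \<alpha> * (n w * (2 * Y))"
            using order_trans[OF norm_triangle_ineq nu_plus_e2] pos by (intro mult_left_mono) auto
          finally show "\<bar>\<xi>2 w + \<zeta> w\<bar> \<le> \<alpha> * (n w * (2 * Y))" .
        qed (use xi1_le xi2_le pos n0 in auto)
        also have "\<dots> = (\<beta> * y' * \<alpha> * Y + \<alpha>\<^sup>2 * (d + y') * Y) * (n w)\<^sup>2"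
          by (simp add: power2_eq_square algebra_simps)
        finally show "\<bar>(\<xi> w)\<^sup>2 / 2 - (\<xi>1 w)\<^sup>2 / 2 - (\<zeta> w)\<^sup>2 / 2\<bar> \<le> (\<beta> * y' * \<alpha> * Y + \<alpha>\<^sup>2 * (d + y') * Y) * (n w)\<^sup>2" .
      qed
    qed (use pos in auto)
    finally show ?thesis .
  qed
  have T3: "\<bar>(LINT w|M. D w) - (LINT w|M. qform p0 p1 (e2 w))\<bar> \<le> 4 * p0 * y' * m * Y + 64 * v * p0 * (d + y') * Y"
  proof -
    have "\<bar>LINT w|M. Re (cc * \<nu> w)\<bar> \<le> cmod cc * (m * Y)" by (rule lin_mean)
    also have "\<dots> \<le> 4 * p0 * y' * (m * Y)" using cc_le m0 pos by (intro mult_right_mono) auto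
    finally have 1: "\<bar>LINT w|M. Re (cc * \<nu> w)\<bar> \<le> 4 * p0 * y' * (m * Y)" .
    have 2: "\<bar>LINT w|M. qform p0 p1 (\<nu> w) - qform p0 p1 (e2 w)\<bar> \<le> 16 * v * (4 * p0 * (d + y') * Y)"
    proof (rule bound_n2)
      show "integrable M (\<lambda>w. qform p0 p1 (\<nu> w) - qform p0 p1 (e2 w))" using int_qnu int_q2 by auto
      show "AE w in M. \<bar>qform p0 p1 (\<nu> w) - qform p0 p1 (e2 w)\<bar> \<le> 4 * p0 * (d + y') * Y * (n w)\<^sup>2"
      proof (rule AE_I2)
        fix w
        have "\<bar>qform p0 p1 (\<nu> w) - qform p0 p1 (e2 w)\<bar> \<le> 2 * p0 * (cmod (\<nu> w - e2 w) * (cmod (\<nu> w) + cmod (e2 w)))"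
          by (rule qform_lipschitz[OF p])
        also have "\<dots> \<le> 2 * p0 * ((n w * (d + y')) * (n w * (2 * Y)))"
          using p0 nu_e2 nu_plus_e2 n0 pos by (intro mult_left_mono mult_mono) auto
        also have "\<dots> = 4 * p0 * (d + y') * Y * (n w)\<^sup>2" by (simp add: power2_eq_square algebra_simps)
        finally show "\<bar>qform p0 p1 (\<nu> w) - qform p0 p1 (e2 w)\<bar> \<le> 4 * p0 * (d + y') * Y * (n w)\<^sup>2" .
      qed
    qed (use p0 pos in auto)
    have "(LINT w|M. D w) - (LINT w|M. qform p0 p1 (e2 w))
      = (LINT w|M. Re (cc * \<nu> w)) + (LINT w|M. qform p0 p1 (\<nu> w) - qform p0 p1 (e2 w))"
      unfolding D_eq using int_lin int_qnu int_q2 by simp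
    then show ?thesis using 1 2 by (simp add: mult_ac)
  qed
  have T4: "(LINT w|M. \<bar>\<xi> w\<bar> * \<bar>D w\<bar>) \<le> 64 * v * (\<beta> * y' + \<alpha> * Y) * p0 * Y * (y' + 2 * B * Y)"
  proof -
    have "\<bar>LINT w|M. \<bar>\<xi> w\<bar> * \<bar>D w\<bar>\<bar> \<le> 16 * v * ((\<beta> * y' + \<alpha> * Y) * (2 * p0 * Y * (2 * y' + 4 * B * Y)))"
    proof (rule bound_n2[OF int_xiD])
      show "AE w in M. \<bar>\<bar>\<xi> w\<bar> * \<bar>D w\<bar>\<bar> \<le> (\<beta> * y' + \<alpha> * Y) * (2 * p0 * Y * (2 * y' + 4 * B * Y)) * (n w)\<^sup>2"
        using n_le
      proof eventually_elim
        fix w assume nB: "n w \<le> 4 * B"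
        have "\<bar>\<bar>\<xi> w\<bar> * \<bar>D w\<bar>\<bar> = \<bar>\<xi> w\<bar> * \<bar>D w\<bar>" by simp
        also have "\<dots> \<le> (n w * (\<beta> * y' + \<alpha> * Y)) * (n w * (2 * p0 * Y * (2 * y' + 4 * B * Y)))"
          using xi_le D_le[OF nB] n0 pos by (intro mult_mono) auto
        finally show "\<bar>\<bar>\<xi> w\<bar> * \<bar>D w\<bar>\<bar> \<le> (\<beta> * y' + \<alpha> * Y) * (2 * p0 * Y * (2 * y' + 4 * B * Y)) * (n w)\<^sup>2"
          by (simp add: power2_eq_square mult_ac)
      qed
    qed (use p0 pos B0 in auto)
    then have "(LINT w|M. \<bar>\<xi> w\<bar> * \<bar>D w\<bar>) \<le> 16 * v * ((\<beta> * y' + \<alpha> * Y) * (2 * p0 * Y * (2 * y' + 4 * B * Y)))" by simp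
    also have "\<dots> = 64 * v * (\<beta> * y' + \<alpha> * Y) * p0 * Y * (y' + 2 * B * Y)" by (simp add: algebra_simps)
    finally show ?thesis .
  qed
  have T5: "(LINT w|M. (D w)\<^sup>2) \<le> 256 * v * p0\<^sup>2 * Y\<^sup>2 * (y' + 2 * B * Y)\<^sup>2"
  proof -
    have "\<bar>LINT w|M. (D w)\<^sup>2\<bar> \<le> 16 * v * ((2 * p0 * Y * (2 * y' + 4 * B * Y))\<^sup>2)"
    proof (rule bound_n2[OF int_D2])
      show "AE w in M. \<bar>(D w)\<^sup>2\<bar> \<le> (2 * p0 * Y * (2 * y' + 4 * B * Y))\<^sup>2 * (n w)\<^sup>2"
        using n_le
      proof eventually_elim
        fix w assume nB: "n w \<le> 4 * B"
        from power_mono[OF D_le[OF nB], of 2]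
        show "\<bar>(D w)\<^sup>2\<bar> \<le> (2 * p0 * Y * (2 * y' + 4 * B * Y))\<^sup>2 * (n w)\<^sup>2"
          by (simp add: power_mult_distrib mult_ac)
      qed
    qed auto
    then have "(LINT w|M. (D w)\<^sup>2) \<le> 16 * v * ((2 * p0 * Y * (2 * y' + 4 * B * Y))\<^sup>2)" by simp
    also have "2 * p0 * Y * (2 * y' + 4 * B * Y) = 4 * (p0 * (Y * (y' + 2 * B * Y)))" by (simp add: algebra_simps)
    finally show ?thesis by (simp only: power_mult_distrib) simp
  qed
  have T6: "(LINT w|M. \<bar>\<xi> w\<bar> ^ 3) \<le> 64 * B * v * (\<beta> * y' + \<alpha> * Y) ^ 3"
  proof -
    have "\<bar>LINT w|M. \<bar>\<xi> w\<bar> ^ 3\<bar> \<le> 16 * v * (4 * B * (\<beta> * y' + \<alpha> * Y) ^ 3)"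
    proof (rule bound_n2[OF int_xi3])
      show "AE w in M. \<bar>\<bar>\<xi> w\<bar> ^ 3\<bar> \<le> 4 * B * (\<beta> * y' + \<alpha> * Y) ^ 3 * (n w)\<^sup>2"
        using n_le
      proof eventually_elim
        fix w assume nB: "n w \<le> 4 * B"
        have "\<bar>\<bar>\<xi> w\<bar> ^ 3\<bar> = \<bar>\<xi> w\<bar> ^ 3" by simp
        also have "\<dots> \<le> (n w * (\<beta> * y' + \<alpha> * Y)) ^ 3" using xi_le by (intro power_mono) auto
        also have "\<dots> = n w * ((\<beta> * y' + \<alpha> * Y) ^ 3 * (n w)\<^sup>2)"
          by (simp add: power_mult_distrib power3_eq_cube power2_eq_square)
        also have "\<dots> \<le> 4 * B * ((\<beta> * y' + \<alpha> * Y) ^ 3 * (n w)\<^sup>2)" using nB pos by (intro mult_right_mono) auto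
        finally show "\<bar>\<bar>\<xi> w\<bar> ^ 3\<bar> \<le> 4 * B * (\<beta> * y' + \<alpha> * Y) ^ 3 * (n w)\<^sup>2" by simp
      qed
    qed (use pos B0 in auto)
    then show ?thesis by (simp add: mult_ac)
  qed
  have T7: "(q + h)\<^sup>2 \<le> 64 * v\<^sup>2 * (\<beta>\<^sup>2 * y'\<^sup>2 + \<alpha>\<^sup>2 + 4 * p0)\<^sup>2"
  proof -
    have "\<bar>LINT w|M. (\<xi>1 w)\<^sup>2\<bar> \<le> 16 * v * (\<beta>\<^sup>2 * y'\<^sup>2)"
    proof (rule bound_n2[OF int_xi1(2)])
      have "(\<xi>1 w)\<^sup>2 \<le> \<beta>\<^sup>2 * y'\<^sup>2 * (n w)\<^sup>2" for w
        using power_mono[OF xi1_le[of w], of 2] by (simp add: power_mult_distrib mult_ac)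
      then show "AE w in M. \<bar>(\<xi>1 w)\<^sup>2\<bar> \<le> \<beta>\<^sup>2 * y'\<^sup>2 * (n w)\<^sup>2" by simp
    qed auto
    then have q: "q \<le> 8 * v * (\<beta>\<^sup>2 * y'\<^sup>2)" by (simp add: q_def)
    have "\<bar>LINT w|M. (\<zeta> w)\<^sup>2\<bar> \<le> 16 * v * \<alpha>\<^sup>2"
    proof (rule bound_n2[OF int_zeta2])
      have "(\<zeta> w)\<^sup>2 \<le> \<alpha>\<^sup>2 * (n w)\<^sup>2" for w
      proof -
        have "\<bar>\<zeta> w\<bar> \<le> \<alpha> * n w"
          unfolding \<zeta>_def using Re_a[of "e2 w"] mult_left_mono[OF le_n(2)[of w] pos(1)] by linarith
        from power_mono[OF this, of 2] show ?thesis by (simp add: power_mult_distrib)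
      qed
      then show "AE w in M. \<bar>(\<zeta> w)\<^sup>2\<bar> \<le> \<alpha>\<^sup>2 * (n w)\<^sup>2" by simp
    qed auto
    moreover have "\<bar>LINT w|M. qform p0 p1 (e2 w)\<bar> \<le> 16 * v * (2 * p0)"
    proof (rule bound_n2[OF int_q2])
      have "\<bar>qform p0 p1 (e2 w)\<bar> \<le> 2 * p0 * (n w)\<^sup>2" for w
      proof -
        have "\<bar>qform p0 p1 (e2 w)\<bar> \<le> 2 * p0 * (cmod (e2 w))\<^sup>2" using qform_le[OF p] qform_nonneg[OF p] by simp
        also have "\<dots> \<le> 2 * p0 * (n w)\<^sup>2" using le_n(2)[of w] p0 by (intro mult_left_mono power_mono) auto
        finally show ?thesis .
      qed
      then show "AE w in M. \<bar>qform p0 p1 (e2 w)\<bar> \<le> 2 * p0 * (n w)\<^sup>2" by simp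
    qed (use p0 in auto)
    ultimately have "h \<le> 8 * v * (\<alpha>\<^sup>2 + 4 * p0)" by (simp add: h_def algebra_simps)
    with q have "q + h \<le> 8 * v * (\<beta>\<^sup>2 * y'\<^sup>2 + \<alpha>\<^sup>2 + 4 * p0)" by (simp add: algebra_simps)
    from power_mono[OF this, of 2] q0 h0 show ?thesis by (simp add: power_mult_distrib)
  qed
  define \<theta> where "\<theta> = Re (b * (x - 1) + a' * y)"
  define R where "R = (\<lambda>w. \<bar>\<xi> w\<bar> * \<bar>D w\<bar> + (D w)\<^sup>2 + \<bar>\<xi> w\<bar> ^ 3)"
  define sq where "sq = (\<lambda>w. (\<xi> w)\<^sup>2)"
  have int_sq: "integrable M sq" unfolding sq_def by (rule int_xisq)
  define Lw where "Lw = (\<lambda>w. complex_of_real (exp (- u0)) * (1 + \<i> * complex_of_real (\<xi> w) - complex_of_real (sq w) / 2 - complex_of_real (D w)))"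
  have int_Lw: "integrable M Lw"
    unfolding Lw_def using int_xi int_sq int_D
    by (intro integrable_mult_right Bochner_Integration.integrable_diff Bochner_Integration.integrable_add integrable_divide_zero) auto
  have ELw: "(LINT w|M. Lw w) = complex_of_real (exp (- u0)) * (1 + \<i> * complex_of_real (LINT w|M. \<xi> w)
      - complex_of_real (LINT w|M. sq w) / 2 - complex_of_real (LINT w|M. D w))"
    unfolding Lw_def using int_xi int_sq int_D
    by (simp add: prob_space)
  have int_R: "integrable M R" unfolding R_def using int_xiD int_D2 int_xi3 by auto
  have main: "cmod ((LINT w|M. iexp (\<xi> w) * exp (- u w)) - (LINT w|M. Lw w)) \<le> (LINT w|M. R w)"
  proof -
    have "cmod ((LINT w|M. iexp (\<xi> w) * exp (- u w)) - (LINT w|M. Lw w)) = cmod (LINT w|M. iexp (\<xi> w) * exp (- u w) - Lw w)"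
      using int_E int_Lw by simp
    also have "\<dots> \<le> (LINT w|M. cmod (iexp (\<xi> w) * exp (- u w) - Lw w))" by (rule integral_norm_bound)
    also have "\<dots> \<le> (LINT w|M. R w)"
    proof (rule integral_mono)
      show "integrable M (\<lambda>w. cmod (iexp (\<xi> w) * exp (- u w) - Lw w))" using int_E int_Lw by auto
      fix w
      show "cmod (iexp (\<xi> w) * exp (- u w) - Lw w) \<le> R w"
        using iexp_times_exp_remainder[OF u_0[of w] u0_0, of "\<xi> w"] by (simp add: Lw_def R_def D_def sq_def)
    qed (rule int_R)
    finally show ?thesis .
  qed
  have qf': "qform p0' p1' y = u0 + q"
  proof -
    have int_c: "integrable M (\<lambda>w. (cmod (e1 w - \<mu>))\<^sup>2)" "integrable M (\<lambda>w. (e1 w - \<mu>)\<^sup>2)"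
      by (rule ic[of "\<lambda>e1 e2 e3. (cmod (e1 - \<mu>))\<^sup>2"], intro ci, rule ic[of "\<lambda>e1 e2 e3. (e1 - \<mu>)\<^sup>2"], intro ci)
    \<comment> \<open>The identity (Re z)^2 / 2 = |z|^2 / 4 + Re (z^2) / 4 is the origin of the
      division by 4 in \<open>p0'\<close> and \<open>p1'\<close>.\<close>
    have "q = (LINT w|M. (cmod (b * y))\<^sup>2 / 4 * (cmod (e1 w - \<mu>))\<^sup>2 + Re ((b * y)\<^sup>2 / 4 * (e1 w - \<mu>)\<^sup>2))"
    proof -
      have "(\<xi>1 w)\<^sup>2 / 2 = (cmod (b * y))\<^sup>2 / 4 * (cmod (e1 w - \<mu>))\<^sup>2 + Re ((b * y)\<^sup>2 / 4 * (e1 w - \<mu>)\<^sup>2)" for w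
      proof -
        have "(Re z)\<^sup>2 / 2 = (cmod z)\<^sup>2 / 4 + Re (z\<^sup>2 / 4)" for z
          unfolding cmod_power2 by (simp add: power2_eq_square field_simps)
        from this[of "b * y * (e1 w - \<mu>)"] show ?thesis
          by (simp add: \<xi>1_def norm_mult power_mult_distrib mult_ac)
      qed
      moreover have "q = (LINT w|M. (\<xi>1 w)\<^sup>2 / 2)" by (simp add: q_def)
      ultimately show ?thesis by (simp only:)
    qed
    also have "\<dots> = (cmod (b * y))\<^sup>2 / 4 * (LINT w|M. (cmod (e1 w - \<mu>))\<^sup>2) + Re ((b * y)\<^sup>2 / 4 * (LINT w|M. (e1 w - \<mu>)\<^sup>2))"
      using int_c by simp
    finally show ?thesis
      by (simp add: qform_def u0_def p0'_def p1'_def c1_def \<mu>_def norm_mult power_mult_distrib algebra_simps)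
  qed
  have S: "(LINT w|M. phase b a p0 p1 (x + e1 w * y) (r * y + (e2 w * x - e3 w * y)))
      = iexp \<theta> * (LINT w|M. iexp (\<xi> w) * exp (- u w))"
  proof -
    have "phase b a p0 p1 (x + e1 w * y) (r * y + (e2 w * x - e3 w * y)) = iexp \<theta> * (iexp (\<xi> w) * exp (- u w))" for w
    proof -
      have "Re (b * (x + e1 w * y - 1) + a * (r * y + (e2 w * x - e3 w * y))) = \<theta> + \<xi> w"
        unfolding \<theta>_def a'_def \<mu>_def[symmetric] xi_fun by (simp add: algebra_simps)
      moreover have "iexp (\<theta> + \<xi> w) = iexp \<theta> * iexp (\<xi> w)" by (simp add: exp_add distrib_left)
      ultimately show ?thesis unfolding phase_def u_def \<nu>_def by (simp only: mult.assoc)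
    qed
    then show ?thesis by (simp only: integral_mult_right_zero)
  qed
  have S': "complex_of_real (exp (- h)) * phase b a' p0' p1' x y = iexp \<theta> * complex_of_real (exp (- u0) * exp (- (q + h)))"
  proof -
    have "exp (- h) * exp (- (u0 + q)) = exp (- u0) * exp (- (q + h))" by (simp flip: exp_add)
    moreover have "complex_of_real (exp (- h)) * (iexp \<theta> * complex_of_real (exp (- (u0 + q))))
       = iexp \<theta> * complex_of_real (exp (- h) * exp (- (u0 + q)))" by (simp only: of_real_mult mult_ac)
    ultimately show ?thesis unfolding phase_def qf' \<theta>_def[symmetric] by (simp only:)
  qed
  have fin: "cmod ((LINT w|M. Lw w) - complex_of_real (exp (- u0) * exp (- (q + h))))
     \<le> \<bar>LINT w|M. \<xi> w\<bar> + (\<bar>(LINT w|M. (\<xi> w)\<^sup>2) / 2 - q - (LINT w|M. (\<zeta> w)\<^sup>2) / 2\<bar>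
         + \<bar>(LINT w|M. D w) - (LINT w|M. qform p0 p1 (e2 w))\<bar> + (q + h)\<^sup>2)"
  proof -
    define t where "t = - ((LINT w|M. (\<xi> w)\<^sup>2) / 2 - q - (LINT w|M. (\<zeta> w)\<^sup>2) / 2)
       - ((LINT w|M. D w) - (LINT w|M. qform p0 p1 (e2 w))) - (exp (- (q + h)) - exp (- 0) + exp (- 0) * (q + h - 0))"
    have "(LINT w|M. Lw w) - complex_of_real (exp (- u0) * exp (- (q + h)))
      = complex_of_real (exp (- u0)) * (\<i> * complex_of_real (LINT w|M. \<xi> w) + complex_of_real t)"
      unfolding ELw t_def h_def sq_def by (simp add: algebra_simps)
    also have "cmod \<dots> \<le> 1 * (\<bar>LINT w|M. \<xi> w\<bar> + \<bar>t\<bar>)"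
      unfolding norm_mult[of "complex_of_real (exp (- u0))"]
      using u0_0 norm_triangle_ineq[of "\<i> * complex_of_real (LINT w|M. \<xi> w)" "complex_of_real t"]
      by (intro mult_mono) (auto simp: norm_mult)
    also have "\<bar>t\<bar> \<le> \<bar>(LINT w|M. (\<xi> w)\<^sup>2) / 2 - q - (LINT w|M. (\<zeta> w)\<^sup>2) / 2\<bar>
         + \<bar>(LINT w|M. D w) - (LINT w|M. qform p0 p1 (e2 w))\<bar> + (q + h)\<^sup>2"
    proof -
      have "\<bar>exp (- (q + h)) - exp (- 0) + exp (- 0) * (q + h - 0)\<bar> \<le> (q + h)\<^sup>2"
        using exp_minus_remainder(2)[of "q + h" 0] q0 h0 by simp
      then show ?thesis unfolding t_def by linarith
    qed
    finally show ?thesis by simp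
  qed
  have "cmod ((LINT w|M. phase b a p0 p1 (x + e1 w * y) (r * y + (e2 w * x - e3 w * y)))
            - complex_of_real (exp (- h)) * phase b a' p0' p1' x y)
     = cmod (((LINT w|M. iexp (\<xi> w) * exp (- u w)) - (LINT w|M. Lw w)) + ((LINT w|M. Lw w) - complex_of_real (exp (- u0) * exp (- (q + h)))))"
    unfolding S S' right_diff_distrib[symmetric] norm_mult norm_exp_i_times by (simp only: mult_1_left diff_add_cancel add_diff_eq)
  also have "\<dots> \<le> (LINT w|M. R w) + (\<bar>LINT w|M. \<xi> w\<bar> + (\<bar>(LINT w|M. (\<xi> w)\<^sup>2) / 2 - q - (LINT w|M. (\<zeta> w)\<^sup>2) / 2\<bar>
         + \<bar>(LINT w|M. D w) - (LINT w|M. qform p0 p1 (e2 w))\<bar> + (q + h)\<^sup>2))"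
    by (intro order_trans[OF norm_triangle_ineq] add_mono main fin)
  also have "\<dots> \<le> phase_error \<alpha> \<beta> p0 m v B Y d y'"
  proof -
    have R: "(LINT w|M. R w) = (LINT w|M. \<bar>\<xi> w\<bar> * \<bar>D w\<bar>) + (LINT w|M. (D w)\<^sup>2) + (LINT w|M. \<bar>\<xi> w\<bar> ^ 3)"
      unfolding R_def using int_xiD int_D2 int_xi3 by simp
    show ?thesis unfolding R phase_error_def by (rule sum7_le[OF T1 T2 T3 T4 T5 T6 T7])
  qed
  finally have final: "cmod ((LINT w|M. phase b a p0 p1 (x + e1 w * y) (r * y + (e2 w * x - e3 w * y)))
            - complex_of_real (exp (- h)) * phase b a' p0' p1' x y) \<le> phase_error \<alpha> \<beta> p0 m v B Y d y'" .
  show "0 \<le> h" by (rule h0)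
  show "cmod ((LINT w|M. phase b a p0 p1 (x + e1 w * y) (r * y + (e2 w * x - e3 w * y)))
            - complex_of_real (exp (- h)) * phase b a' p0' p1' x y)
      \<le> phase_error (cmod a) (cmod b) p0 m v B (cmod x + cmod y + 1) (cmod (x - 1)) (cmod y)"
    by (rule final[unfolded \<alpha>_def \<beta>_def Y_def d_def y'_def])
qed

text \<open>\<open>T\<close> bounds the rescaled frequencies, \<tau> is the envelope of
  \<open>a\<close>, and \<open>G\<close> the deviation in units of L^(-1/2). The outcome separates
  the random factor G^4, which needs only a fourth moment, from a deterministic rate that can be
  summed over the steps.\<close>

lemma phase_error_le:
  fixes L T C \<tau> S G B \<alpha> \<beta> p Y d w :: real
  assumes T: "1 \<le> T" and C: "1 \<le> C" and CL: "C \<le> L" and G: "1 \<le> G" and S: "0 < S" and \<tau>: "0 \<le> \<tau>" "\<tau> \<le> 2"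
    and \<alpha>: "0 \<le> \<alpha>" "\<alpha> \<le> T * sqrt L * \<tau>" and \<beta>: "0 \<le> \<beta>" "\<beta> \<le> T * sqrt L"
    and p: "0 \<le> p" "p \<le> T\<^sup>2 * L * \<tau> / 4" "p \<le> 2 * C * T\<^sup>2"
    and B: "0 \<le> B" "1 / sqrt L + 8 * B \<le> 1"
    and Y: "0 \<le> Y" "Y \<le> 4 * G" and d: "0 \<le> d" "sqrt L * d \<le> G" and w: "0 \<le> w" "sqrt L * w \<le> G"
  shows "phase_error \<alpha> \<beta> p (C / S) (2 * C / S) B Y d w
     \<le> 201000 * (C\<^sup>2 * T ^ 4 * G ^ 4) * (L * \<tau> / S * (1 / sqrt L + B * sqrt L) + B / S + L\<^sup>2 / S\<^sup>2)"
proof -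
  define l \<kappa> where "l = sqrt L" and "\<kappa> = 1 / l"
  have L1: "1 \<le> L" using C CL by simp
  have l1: "1 \<le> l" and ll: "l * l = L" using L1 by (auto simp: l_def)
  have lL: "l \<le> L" using mult_left_mono[of 1 l l] l1 ll by simp
  have \<kappa>: "0 < \<kappa>" "l * \<kappa> = 1" "\<kappa> \<le> 1" using l1 by (auto simp: \<kappa>_def)
  have wk: "w \<le> \<kappa> * G" and dk: "d \<le> \<kappa> * G" using w d l1 by (auto simp: \<kappa>_def l_def field_simps)
  have \<alpha>': "\<alpha> \<le> T * l * \<tau>" and \<beta>': "\<beta> \<le> T * l" using \<alpha> \<beta> by (auto simp: l_def)
  have B8: "\<kappa> + 8 * B \<le> 1" using B by (simp add: \<kappa>_def l_def)
  define K where "K = \<kappa> + 8 * B"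
  have K: "0 \<le> K" "K \<le> 1" using \<kappa> B B8 by (auto simp: K_def)
  define P where "P = C\<^sup>2 * T ^ 4 * G ^ 4"
  have P: "C * T * G \<le> P" "C * T\<^sup>2 * G\<^sup>2 \<le> P" "C\<^sup>2 * T ^ 3 * G ^ 3 \<le> P" "C * T ^ 3 * G ^ 3 \<le> P"
    unfolding P_def using C T G by (intro mult_mono self_le_power power_increasing order.refl; simp)+
  define e where "e = L * \<tau> / S"
  have e0: "0 \<le> e" using L1 \<tau> S by (simp add: e_def)
  have T0: "0 \<le> T" and C0: "0 \<le> C" and G0: "0 \<le> G" and l0: "0 \<le> l" and L0: "0 \<le> L" using T C G l1 L1 by auto
  have bw: "\<beta> * w \<le> T * G"
  proof -
    have "\<beta> * w \<le> (T * l) * (\<kappa> * G)"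
      by (rule mult_mono[OF \<beta>' wk]) (use w T0 l0 in auto)
    also have "\<dots> = T * G * (l * \<kappa>)" by simp
    finally show ?thesis using \<kappa> by simp
  qed
  have aY: "\<alpha> * Y \<le> 4 * T * l * \<tau> * G"
  proof -
    have "\<alpha> * Y \<le> (T * l * \<tau>) * (4 * G)"
      by (rule mult_mono[OF \<alpha>' Y(2)]) (use Y T0 l0 \<tau> in auto)
    then show ?thesis by (simp add: mult_ac)
  qed
  have lk: "L * \<kappa> = l" using \<kappa> ll by (metis mult.assoc mult.right_neutral)
  have wBY: "0 \<le> w + 2 * B * Y" "w + 2 * B * Y \<le> K * G"
  proof -
    have "2 * B * Y \<le> 2 * B * (4 * G)" using Y B by (intro mult_left_mono) auto
    then show "w + 2 * B * Y \<le> K * G" using wk by (simp add: K_def algebra_simps)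
  qed (use w B Y in auto)
  have dw: "d + w \<le> 2 * (\<kappa> * G)" using dk wk by simp
  have CS: "0 \<le> C / S" using C0 S by simp
  have t1: "\<alpha> * (C / S) * Y \<le> 4 * (P * (e * \<kappa>))"
  proof -
    have "\<alpha> * (C / S) * Y = (C / S) * (\<alpha> * Y)" by simp
    also have "\<dots> \<le> (C / S) * (4 * T * l * \<tau> * G)" using aY CS by (rule mult_left_mono)
    also have "\<dots> = 4 * ((C * T * G) * (e * \<kappa>))" unfolding e_def lk[symmetric] by simp
    also have "\<dots> \<le> 4 * (P * (e * \<kappa>))" using P(1) e0 \<kappa> by (intro mult_left_mono mult_right_mono) auto
    finally show ?thesis .
  qed
  have t2: "16 * (2 * C / S) * (\<beta> * w * \<alpha> * Y + \<alpha>\<^sup>2 * (d + w) * Y) \<le> 640 * (P * (e * \<kappa>))"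
  proof -
    have 1: "\<beta> * w * \<alpha> * Y \<le> 4 * T\<^sup>2 * (L * \<tau> * \<kappa>) * G\<^sup>2"
    proof -
      have "(\<beta> * w) * (\<alpha> * Y) \<le> (T * G) * (4 * T * l * \<tau> * G)"
        by (rule mult_mono[OF bw aY]) (use \<tau> \<alpha> \<beta> p Y d w B K \<kappa> wBY T0 C0 G0 l0 L0 S CS in \<open>auto intro!: mult_nonneg_nonneg add_nonneg_nonneg divide_nonneg_nonneg\<close>)
      also have "\<dots> = 4 * T\<^sup>2 * (L * \<tau> * \<kappa>) * G\<^sup>2" unfolding lk[symmetric] by (simp add: power2_eq_square)
      finally show ?thesis by (simp add: mult_ac)
    qed
    have 2: "\<alpha>\<^sup>2 * (d + w) * Y \<le> 16 * T\<^sup>2 * (L * \<tau> * \<kappa>) * G\<^sup>2"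
    proof -
      have "\<alpha>\<^sup>2 \<le> (T * l * \<tau>)\<^sup>2" using \<alpha> \<alpha>' by (intro power_mono) auto
      also have "\<dots> = T\<^sup>2 * L * \<tau> * \<tau>" using ll by (simp add: power2_eq_square mult_ac)
      also have "\<dots> \<le> T\<^sup>2 * L * \<tau> * 2" using \<tau> L0 by (intro mult_left_mono) auto
      finally have a2: "\<alpha>\<^sup>2 \<le> T\<^sup>2 * L * \<tau> * 2" .
      have "\<alpha>\<^sup>2 * (d + w) * Y \<le> (T\<^sup>2 * L * \<tau> * 2) * (2 * (\<kappa> * G)) * (4 * G)"
        by (rule mult_mono[OF mult_mono[OF a2 dw] Y(2)]) (use \<tau> \<alpha> \<beta> p Y d w B K \<kappa> wBY T0 C0 G0 l0 L0 S CS in \<open>auto intro!: mult_nonneg_nonneg add_nonneg_nonneg divide_nonneg_nonneg\<close>)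
      then show ?thesis by (simp add: power2_eq_square mult_ac)
    qed
    have "16 * (2 * C / S) * (\<beta> * w * \<alpha> * Y + \<alpha>\<^sup>2 * (d + w) * Y) \<le> 16 * (2 * C / S) * (20 * T\<^sup>2 * (L * \<tau> * \<kappa>) * G\<^sup>2)"
      using 1 2 C0 S by (intro mult_left_mono) auto
    also have "\<dots> = 640 * ((C * T\<^sup>2 * G\<^sup>2) * (e * \<kappa>))" by (simp add: e_def)
    also have "\<dots> \<le> 640 * (P * (e * \<kappa>))" using P(2) e0 \<kappa> by (intro mult_left_mono mult_right_mono) auto
    finally show ?thesis .
  qed
  have t3: "4 * p * w * (C / S) * Y \<le> 4 * (P * (e * \<kappa>))"
  proof -
    have "4 * p * w * (C / S) * Y \<le> 4 * (T\<^sup>2 * L * \<tau> / 4) * (\<kappa> * G) * (C / S) * (4 * G)"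
      by (rule mult_mono[OF mult_right_mono[OF mult_mono[OF mult_left_mono[OF p(2)] wk]] Y(2)])
        (use \<tau> \<alpha> \<beta> p Y d w B K \<kappa> wBY T0 C0 G0 l0 L0 S CS in \<open>auto intro!: mult_nonneg_nonneg add_nonneg_nonneg divide_nonneg_nonneg\<close>)
    also have "\<dots> = 4 * ((C * T\<^sup>2 * G\<^sup>2) * (e * \<kappa>))" by (simp add: e_def power2_eq_square)
    also have "\<dots> \<le> 4 * (P * (e * \<kappa>))" using P(2) e0 \<kappa> by (intro mult_left_mono mult_right_mono) auto
    finally show ?thesis .
  qed
  have t4: "64 * (2 * C / S) * p * (d + w) * Y \<le> 256 * (P * (e * \<kappa>))"
  proof -
    have "64 * (2 * C / S) * p * (d + w) * Y \<le> 64 * (2 * C / S) * (T\<^sup>2 * L * \<tau> / 4) * (2 * (\<kappa> * G)) * (4 * G)"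
      by (rule mult_mono[OF mult_mono[OF mult_left_mono[OF p(2)] dw] Y(2)])
        (use \<tau> \<alpha> \<beta> p Y d w B K \<kappa> wBY T0 C0 G0 l0 L0 S CS in \<open>auto intro!: mult_nonneg_nonneg add_nonneg_nonneg divide_nonneg_nonneg\<close>)
    also have "\<dots> = 256 * ((C * T\<^sup>2 * G\<^sup>2) * (e * \<kappa>))" by (simp add: e_def power2_eq_square)
    also have "\<dots> \<le> 256 * (P * (e * \<kappa>))" using P(2) e0 \<kappa> by (intro mult_left_mono mult_right_mono) auto
    finally show ?thesis .
  qed
  have t5: "64 * (2 * C / S) * (\<beta> * w + \<alpha> * Y) * p * Y * (w + 2 * B * Y) \<le> 4608 * (P * (e * K))"
  proof -
    \<comment> \<open>Each product should carry one factor \<tau>. Here only p can supply it, so the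
      bound T^2 * L * \<tau> / 4 is used; in the next product \<alpha> supplies it and the bound
      without L is better.\<close>
    have 1: "(\<beta> * w) * p \<le> C * T ^ 3 * (L * \<tau>) * G"
    proof -
      have "(\<beta> * w) * p \<le> (T * G) * (T\<^sup>2 * L * \<tau> / 4)"
        by (rule mult_mono[OF bw p(2)]) (use \<tau> \<alpha> \<beta> p Y d w B K \<kappa> wBY T0 C0 G0 l0 L0 S CS in \<open>auto intro!: mult_nonneg_nonneg add_nonneg_nonneg divide_nonneg_nonneg\<close>)
      also have "\<dots> = (1/4) * (T ^ 3 * (L * \<tau>) * G)" by (simp add: power2_eq_square power3_eq_cube)
      also have "\<dots> \<le> C * (T ^ 3 * (L * \<tau>) * G)" using C T0 L0 \<tau> G0 by (intro mult_right_mono) auto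
      finally show ?thesis by (simp add: mult_ac)
    qed
    have 2: "(\<alpha> * Y) * p \<le> 8 * C * T ^ 3 * (L * \<tau>) * G"
    proof -
      have "(\<alpha> * Y) * p \<le> (4 * T * l * \<tau> * G) * (2 * C * T\<^sup>2)"
        by (rule mult_mono[OF aY p(3)]) (use \<tau> \<alpha> \<beta> p Y d w B K \<kappa> wBY T0 C0 G0 l0 L0 S CS in \<open>auto intro!: mult_nonneg_nonneg add_nonneg_nonneg divide_nonneg_nonneg\<close>)
      also have "\<dots> = 8 * C * T ^ 3 * (l * \<tau>) * G" by (simp add: power2_eq_square power3_eq_cube)
      also have "\<dots> \<le> 8 * C * T ^ 3 * (L * \<tau>) * G" using lL C0 T0 \<tau> G0 by (intro mult_right_mono mult_left_mono) auto
      finally show ?thesis .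
    qed
    have 3: "(\<beta> * w + \<alpha> * Y) * p \<le> 9 * C * T ^ 3 * (L * \<tau>) * G" using 1 2 by (simp add: algebra_simps)
    have "64 * (2 * C / S) * (\<beta> * w + \<alpha> * Y) * p * Y * (w + 2 * B * Y)
        = 64 * (2 * C / S) * ((\<beta> * w + \<alpha> * Y) * p) * Y * (w + 2 * B * Y)" by simp
    also have "\<dots> \<le> 64 * (2 * C / S) * (9 * C * T ^ 3 * (L * \<tau>) * G) * (4 * G) * (K * G)"
      by (rule mult_mono[OF mult_mono[OF mult_left_mono[OF 3] Y(2)] wBY(2)])
        (use \<tau> \<alpha> \<beta> p Y d w B K \<kappa> wBY T0 C0 G0 l0 L0 S CS in \<open>auto intro!: mult_nonneg_nonneg add_nonneg_nonneg divide_nonneg_nonneg\<close>)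
    also have "\<dots> = 4608 * ((C\<^sup>2 * T ^ 3 * G ^ 3) * (e * K))" by (simp add: e_def power2_eq_square power3_eq_cube)
    also have "\<dots> \<le> 4608 * (P * (e * K))" using P(3) e0 K by (intro mult_left_mono mult_right_mono) auto
    finally show ?thesis .
  qed
  have t6: "256 * (2 * C / S) * p\<^sup>2 * Y\<^sup>2 * (w + 2 * B * Y)\<^sup>2 \<le> 4096 * (P * (e * K))"
  proof -
    have 1: "p\<^sup>2 \<le> (T\<^sup>2 * L * \<tau> / 4) * (2 * C * T\<^sup>2)"
      unfolding power2_eq_square[of p] by (rule mult_mono[OF p(2) p(3)]) (use \<tau> \<alpha> \<beta> p Y d w B K \<kappa> wBY T0 C0 G0 l0 L0 S CS in \<open>auto intro!: mult_nonneg_nonneg add_nonneg_nonneg divide_nonneg_nonneg\<close>)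
    have 2: "Y\<^sup>2 \<le> (4 * G)\<^sup>2" using Y by (intro power_mono) auto
    have "(w + 2 * B * Y)\<^sup>2 \<le> (K * G)\<^sup>2" using wBY by (intro power_mono) auto
    also have "\<dots> = K * K * G\<^sup>2" by (simp add: power2_eq_square)
    also have "\<dots> \<le> K * 1 * G\<^sup>2" using K by (intro mult_right_mono mult_left_mono) auto
    finally have 3: "(w + 2 * B * Y)\<^sup>2 \<le> K * 1 * G\<^sup>2" .
    have "256 * (2 * C / S) * p\<^sup>2 * Y\<^sup>2 * (w + 2 * B * Y)\<^sup>2
       \<le> 256 * (2 * C / S) * ((T\<^sup>2 * L * \<tau> / 4) * (2 * C * T\<^sup>2)) * (4 * G)\<^sup>2 * (K * 1 * G\<^sup>2)"
      by (rule mult_mono[OF mult_mono[OF mult_left_mono[OF 1] 2] 3])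
        (use \<tau> \<alpha> \<beta> p Y d w B K \<kappa> wBY T0 C0 G0 l0 L0 S CS in \<open>auto intro!: mult_nonneg_nonneg add_nonneg_nonneg divide_nonneg_nonneg\<close>)
    also have "\<dots> = 4096 * (P * (e * K))" by (simp add: e_def P_def power2_eq_square power4_eq_xxxx)
    finally show ?thesis .
  qed
  have t7: "64 * B * (2 * C / S) * (\<beta> * w + \<alpha> * Y) ^ 3 \<le> 512 * (P * (B / S)) + 131072 * (P * (e * (B * l)))"
  proof -
    have "(\<beta> * w + \<alpha> * Y) ^ 3 \<le> (T * G + 4 * T * l * \<tau> * G) ^ 3"
      using bw aY \<beta> w \<alpha> Y by (intro power_mono) auto
    also have "\<dots> = (T * G) ^ 3 * (1 + 4 * l * \<tau>) ^ 3" unfolding power_mult_distrib[symmetric] by (simp add: algebra_simps)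
    \<comment> \<open>Convexity of the cube. The summand 1 stems from the fluctuation of x and has
      no factor \<tau>; it leaves the term B / S, whose sum over the steps is only
      logarithmic.\<close>
    also have "(1 + 4 * l * \<tau>) ^ 3 \<le> 4 * (1 + (4 * l * \<tau>) ^ 3)"
    proof -
      have "0 \<le> 3 * (1 + z) * (1 - z)\<^sup>2" if "0 \<le> z" for z :: real using that by simp
      then have "(1 + z) ^ 3 \<le> 4 * (1 + z ^ 3)" if "0 \<le> z" for z :: real
        using that by (fastforce simp: power2_eq_square power3_eq_cube algebra_simps)
      then show ?thesis using l0 \<tau> by simp
    qed
    also have "4 * (1 + (4 * l * \<tau>) ^ 3) \<le> 4 + 1024 * (L * l * \<tau>)"
    proof -
      have "\<tau> ^ 3 \<le> 4 * \<tau>"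
      proof -
        have "\<tau> * \<tau> \<le> 2 * 2" using \<tau> by (intro mult_mono) auto
        from mult_left_mono[OF this \<tau>(1)] show ?thesis by (simp add: power3_eq_cube)
      qed
      then have "256 * (L * l) * \<tau> ^ 3 \<le> 256 * (L * l) * (4 * \<tau>)" using L0 l0 by (intro mult_left_mono) auto
      then show ?thesis unfolding ll[symmetric] by (simp add: power3_eq_cube mult_ac)
    qed
    finally have 1: "(\<beta> * w + \<alpha> * Y) ^ 3 \<le> (T * G) ^ 3 * (4 + 1024 * (L * l * \<tau>))"
      using T0 G0 by (simp add: mult_left_mono)
    have "64 * B * (2 * C / S) * (\<beta> * w + \<alpha> * Y) ^ 3 \<le> 64 * B * (2 * C / S) * ((T * G) ^ 3 * (4 + 1024 * (L * l * \<tau>)))"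
      using 1 B C0 S by (intro mult_left_mono) auto
    also have "\<dots> = (C * T ^ 3 * G ^ 3) * (512 * (B / S) + 131072 * (e * (B * l)))"
      by (simp add: e_def power_mult_distrib algebra_simps)
    also have "\<dots> \<le> P * (512 * (B / S) + 131072 * (e * (B * l)))"
      using P(4) B S e0 l0 by (intro mult_right_mono) auto
    finally show ?thesis by (simp add: algebra_simps)
  qed
  have t8: "64 * (2 * C / S)\<^sup>2 * (\<beta>\<^sup>2 * w\<^sup>2 + \<alpha>\<^sup>2 + 4 * p)\<^sup>2 \<le> 43264 * (P * (L\<^sup>2 / S\<^sup>2))"
  proof -
    have 1: "\<beta>\<^sup>2 * w\<^sup>2 \<le> T\<^sup>2 * (L * G\<^sup>2)"
    proof -
      have "(\<beta> * w)\<^sup>2 \<le> (T * G)\<^sup>2" using bw \<beta> w by (intro power_mono) auto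
      also have "\<dots> = T\<^sup>2 * (1 * G\<^sup>2)" by (simp add: power_mult_distrib)
      also have "\<dots> \<le> T\<^sup>2 * (L * G\<^sup>2)" using L1 by (intro mult_left_mono mult_right_mono) auto
      finally show ?thesis by (simp add: power_mult_distrib)
    qed
    have G2: "1 \<le> G\<^sup>2" using G by simp
    have 2: "\<alpha>\<^sup>2 \<le> 4 * (T\<^sup>2 * (L * G\<^sup>2))"
    proof -
      have "\<alpha> \<le> T * l * 2" using \<alpha>' mult_left_mono[OF \<tau>(2), of "T * l"] T0 l0 by auto
      then have "\<alpha>\<^sup>2 \<le> (T * l * 2)\<^sup>2" using \<alpha> by (intro power_mono) auto
      also have "\<dots> = 4 * (T\<^sup>2 * (L * 1))" unfolding ll[symmetric] by (simp add: power2_eq_square)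
      also have "\<dots> \<le> 4 * (T\<^sup>2 * (L * G\<^sup>2))" using G2 L0 by (intro mult_left_mono) auto
      finally show ?thesis .
    qed
    have 3: "4 * p \<le> 8 * (T\<^sup>2 * (L * G\<^sup>2))"
    proof -
      have "4 * p \<le> 8 * (T\<^sup>2 * (C * 1))" using p by simp
      also have "\<dots> \<le> 8 * (T\<^sup>2 * (L * G\<^sup>2))" using G2 CL L0 C0 by (intro mult_left_mono mult_mono) auto
      finally show ?thesis .
    qed
    have "\<beta>\<^sup>2 * w\<^sup>2 + \<alpha>\<^sup>2 + 4 * p \<le> 13 * (T\<^sup>2 * (L * G\<^sup>2))" using 1 2 3 by linarith
    then have "(\<beta>\<^sup>2 * w\<^sup>2 + \<alpha>\<^sup>2 + 4 * p)\<^sup>2 \<le> (13 * (T\<^sup>2 * (L * G\<^sup>2)))\<^sup>2" using p by (intro power_mono) auto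
    then have "64 * (2 * C / S)\<^sup>2 * (\<beta>\<^sup>2 * w\<^sup>2 + \<alpha>\<^sup>2 + 4 * p)\<^sup>2 \<le> 64 * (2 * C / S)\<^sup>2 * (13 * (T\<^sup>2 * (L * G\<^sup>2)))\<^sup>2"
      by (intro mult_left_mono) auto
    also have "\<dots> = 43264 * (P * (L\<^sup>2 / S\<^sup>2))"
      by (simp add: P_def power_mult_distrib power_divide flip: power_mult)
    finally show ?thesis .
  qed
  have P0: "0 \<le> P" using C0 T0 G0 by (simp add: P_def)
  have eB: "P * (e * B) \<le> P * (e * (B * l))"
    using mult_left_mono[OF l1, of "P * (e * B)"] P0 e0 B by (simp add: mult_ac)
  have eK: "P * (e * K) = P * (e * \<kappa>) + 8 * (P * (e * B))" by (simp add: K_def algebra_simps)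
  have nn: "0 \<le> P * (e * \<kappa>)" "0 \<le> P * (e * (B * l))" "0 \<le> P * (B / S)" "0 \<le> P * (L\<^sup>2 / S\<^sup>2)"
    using P0 e0 \<kappa> B l0 S by auto
  \<comment> \<open>The largest coefficient is that of P * (e * (B * l)): 8 * (4608 + 4096) + 131072
    = 200704.\<close>
  have "phase_error \<alpha> \<beta> p (C / S) (2 * C / S) B Y d w
     \<le> 201000 * (P * (e * \<kappa>) + P * (e * (B * l)) + P * (B / S) + P * (L\<^sup>2 / S\<^sup>2))"
    unfolding phase_error_def using t1 t2 t3 t4 t5 t6 t7 t8 eB eK nn by argo
  also have "\<dots> = 201000 * (C\<^sup>2 * T ^ 4 * G ^ 4) * (L * \<tau> / S * (1 / sqrt L + B * sqrt L) + B / S + L\<^sup>2 / S\<^sup>2)"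
    unfolding P_def[symmetric] e_def[symmetric] l_def[symmetric] \<kappa>_def[symmetric] by (simp add: algebra_simps)
  finally show ?thesis .
qed

section \<open>The characteristic function of the first column\<close>

context random_transfer_product begin

text \<open>exp (- g) \<le> 1 - 4 * g / 9 for g \<le> 5/4, and the shift of \<open>s\<close> by 1
  costs at most g / 8. The surplus gam / (8 * s) pays for the sources of the two backward recursions
  below.\<close>

lemma exp_gam_inverse_s_gap:
  assumes "Suc k \<le> N"
  shows "exp (- gam (Suc k)) / s (Suc k) + gam (Suc k) / (8 * s (Suc k)) \<le> 1 / s k"
proof -
  define g t where "g = gam (Suc k)" and "t = s (Suc k)"
  have g: "0 < g" "g \<le> 5/4" using gam_pos[OF assms] gam_le[OF assms] by (auto simp: g_def)
  have t: "0 < t" using s_pos[OF assms] by (simp add: t_def)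
  have gt: "8 \<le> g * t" using gam_s_ge[OF assms] L_ge by (simp add: g_def t_def)
  have "exp (- g) \<le> 1 / (1 + g)"
    using exp_ge_add_one_self[of g] g by (simp add: exp_minus inverse_eq_divide divide_left_mono)
  also have "\<dots> = 1 - g / (1 + g)" using g by (simp add: field_simps)
  finally have "exp (- g) \<le> 1 - g / (1 + g)" .
  moreover have "g / (9/4) \<le> g / (1 + g)" using g by (intro divide_left_mono) auto
  ultimately have "exp (- g) + g / 8 + g / 8 \<le> 1" using g by simp
  moreover have "1 / t \<le> g / 8" using gt t by (simp add: field_simps)
  ultimately have "exp (- g) + g / 8 \<le> 1 - 1 / t" by simp
  also have "\<dots> \<le> t / (t + 1)" using t by (simp add: field_simps)
  finally have "(exp (- g) + g / 8) / t \<le> t / (t + 1) / t" using t by (intro divide_right_mono) auto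
  then show ?thesis using t by (simp add: s_Suc[of k] g_def[symmetric] t_def[symmetric] add_divide_distrib mult.commute)
qed

text \<open>Envelopes for the backward recursions: \<tau> bounds |a_k| in units of T * sqrt L,
  \<open>qform_cap\<close> bounds the form. \<open>W N\<close> carries the final value of a; the
  terms with om / s k are equilibria of source against damping. The sources are C / s for a (mean of
  e1) and T^2 * L * (C / s) / 4 for the form (variance of e1); dividing by the surplus, with gam
  \<ge> L / om, gives 8 * C / L and 2 * C * T^2.\<close>

definition \<tau> :: "nat \<Rightarrow> real" where "\<tau> k = W N k + 8 * C / L * (om / s k)"
definition qform_cap :: "real \<Rightarrow> nat \<Rightarrow> real" where "qform_cap T k = 2 * C * T\<^sup>2 * (om / s k)"

lemma \<tau>_bounds: assumes "k \<le> N" shows "0 \<le> \<tau> k" "\<tau> k \<le> 2"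
proof -
  have s: "0 < s k" "om / s k \<le> 1" "0 \<le> om / s k" using s_ge[OF assms] s_pos[OF assms] L_le by (auto simp: divide_le_eq)
  have "8 * C / L \<le> 1"
  proof -
    have "8 * C \<le> 10000000 * C\<^sup>2" using C1 mult_mono[of 8 "10000000 * C" C C] by (simp add: power2_eq_square)
    then show ?thesis using L_large L_ge by simp
  qed
  then have "8 * C / L * (om / s k) \<le> 1 * 1" using s C1 L_ge by (intro mult_mono) auto
  then show "\<tau> k \<le> 2" using W_le_1[OF assms] by (simp add: \<tau>_def)
  show "0 \<le> \<tau> k" unfolding \<tau>_def W_def using s C1 L_ge L_le
    by (intro add_nonneg_nonneg mult_nonneg_nonneg divide_nonneg_nonneg) auto
qed

lemma \<tau>_step: assumes "Suc k \<le> N" shows "exp (- gam (Suc k)) * \<tau> (Suc k) + C / s (Suc k) \<le> \<tau> k"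
proof -
  have sp: "0 < s (Suc k)" using s_pos[OF assms] by simp
  have L0: "0 < L" and om0: "0 < om" using L_ge L_le by auto
  have "L / om \<le> gam (Suc k)" by (rule gam_ge[OF assms])
  then have "1 \<le> om / L * gam (Suc k)" using L0 om0 by (simp add: field_simps)
  then have "C / s (Suc k) * 1 \<le> C / s (Suc k) * (om / L * gam (Suc k))" using C1 sp by (intro mult_left_mono) auto
  then have "C / s (Suc k) \<le> 8 * C / L * om * (gam (Suc k) / (8 * s (Suc k)))" by (simp add: mult_ac)
  then have "exp (- gam (Suc k)) * (8 * C / L * (om / s (Suc k))) + C / s (Suc k)
     \<le> 8 * C / L * om * (exp (- gam (Suc k)) / s (Suc k) + gam (Suc k) / (8 * s (Suc k)))"
    by (simp add: algebra_simps)
  also have "\<dots> \<le> 8 * C / L * om * (1 / s k)"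
    using exp_gam_inverse_s_gap[OF assms] C1 L0 om0 by (intro mult_left_mono) auto
  finally show ?thesis using W_step[OF assms, of N] by (simp add: \<tau>_def distrib_left)
qed

lemma qform_cap_step: assumes "Suc k \<le> N"
  shows "exp (- gam (Suc k)) * qform_cap T (Suc k) + T\<^sup>2 * L * (C / s (Suc k)) / 4 \<le> qform_cap T k"
proof -
  have sp: "0 < s (Suc k)" using s_pos[OF assms] by simp
  have L0: "0 < L" and om0: "0 < om" using L_ge L_le by auto
  have "L \<le> om * gam (Suc k)" using gam_ge[OF assms] om0 by (simp add: field_simps)
  then have "T\<^sup>2 * (C / s (Suc k)) / 4 * L \<le> T\<^sup>2 * (C / s (Suc k)) / 4 * (om * gam (Suc k))"
    using C1 sp by (intro mult_left_mono) auto
  then have "T\<^sup>2 * L * (C / s (Suc k)) / 4 \<le> 2 * C * T\<^sup>2 * om * (gam (Suc k) / (8 * s (Suc k)))"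
    by (simp add: mult_ac)
  then have "exp (- gam (Suc k)) * qform_cap T (Suc k) + T\<^sup>2 * L * (C / s (Suc k)) / 4
     \<le> 2 * C * T\<^sup>2 * om * (exp (- gam (Suc k)) / s (Suc k) + gam (Suc k) / (8 * s (Suc k)))"
    by (simp add: qform_cap_def algebra_simps)
  also have "\<dots> \<le> 2 * C * T\<^sup>2 * om * (1 / s k)"
    using exp_gam_inverse_s_gap[OF assms] C1 L0 om0 by (intro mult_left_mono) auto
  finally show ?thesis by (simp add: qform_cap_def)
qed

definition v1 :: "complex ^ 2" where "v1 = vector [1, 0]"

text \<open>Chosen such that the floor e = floor_const / L, of the order of the typical squared
  deviation, admits the exponent p = 2: both summands of p * hx are then at most half of L /
  (1000000 * C^2).\<close>

definition floor_const :: real where "floor_const = 8000000 * C\<^sup>2"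

definition dev_size :: "complex ^ 2 \<Rightarrow> real" where
  "dev_size v = sqrt (L * (floor_const / L + (cmod (v $ 1 - 1))\<^sup>2 + (cmod (v $ 2))\<^sup>2))"

lemma dev_size_facts:
  shows "1 \<le> dev_size v" "sqrt L * cmod (v $ 1 - 1) \<le> dev_size v" "sqrt L * cmod (v $ 2) \<le> dev_size v"
    "cmod (v $ 1) + cmod (v $ 2) + 1 \<le> 4 * dev_size v"
    "dev_size v ^ 4 = L\<^sup>2 * (floor_const / L + (cmod (v $ 1 - 1))\<^sup>2 + (cmod (v $ 2))\<^sup>2)\<^sup>2"
proof -
  have L0: "1 \<le> L" using L_ge by simp
  have "1 \<le> C\<^sup>2" using C1 by simp
  then have floor_const: "1 \<le> floor_const" by (simp add: floor_const_def)
  define d w where "d = cmod (v $ 1 - 1)" and "w = cmod (v $ 2)"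
  have e: "dev_size v = sqrt (floor_const + L * d\<^sup>2 + L * w\<^sup>2)" using L0 by (simp add: dev_size_def d_def w_def algebra_simps)
  have nn: "0 \<le> L * d\<^sup>2" "0 \<le> L * w\<^sup>2" using L0 by auto
  show 1: "1 \<le> dev_size v" unfolding e using floor_const nn by simp
  have d: "sqrt L * d \<le> dev_size v"
  proof -
    have "sqrt L * d = sqrt (L * d\<^sup>2)" by (simp add: real_sqrt_mult d_def)
    also have "\<dots> \<le> dev_size v" unfolding e using floor_const nn by (intro real_sqrt_le_mono) auto
    finally show ?thesis .
  qed
  have w: "sqrt L * w \<le> dev_size v"
  proof -
    have "sqrt L * w = sqrt (L * w\<^sup>2)" by (simp add: real_sqrt_mult w_def)
    also have "\<dots> \<le> dev_size v" unfolding e using floor_const nn by (intro real_sqrt_le_mono) auto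
    finally show ?thesis .
  qed
  show "sqrt L * cmod (v $ 1 - 1) \<le> dev_size v" "sqrt L * cmod (v $ 2) \<le> dev_size v" using d w by (auto simp: d_def w_def)
  have "1 * d \<le> sqrt L * d" "1 * w \<le> sqrt L * w"
    by (intro mult_right_mono real_sqrt_ge_one[OF L0]; simp add: d_def w_def)+
  moreover have "cmod (v $ 1) \<le> d + 1" using norm_triangle_ineq[of "v $ 1 - 1" 1] by (simp add: d_def)
  ultimately show "cmod (v $ 1) + cmod (v $ 2) + 1 \<le> 4 * dev_size v" using 1 d w by (simp add: w_def)
  have "dev_size v ^ 4 = ((dev_size v)\<^sup>2)\<^sup>2" by simp
  also have "(dev_size v)\<^sup>2 = L * (floor_const / L + (cmod (v $ 1 - 1))\<^sup>2 + (cmod (v $ 2))\<^sup>2)"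
    unfolding dev_size_def using L0 floor_const by simp
  finally show "dev_size v ^ 4 = L\<^sup>2 * (floor_const / L + (cmod (v $ 1 - 1))\<^sup>2 + (cmod (v $ 2))\<^sup>2)\<^sup>2"
    by (simp add: power_mult_distrib)
qed

text \<open>The chain starts at its target (1, 0), so the initial Lyapunov value is the floor itself
  and L cancels. The fourth moment in units of L^(-1/2) is bounded uniformly in n.\<close>

lemma dev_size_moment: assumes "n \<le> N" shows "(\<integral>\<^sup>+w. ennreal (dev_size (Z v1 n w) ^ 4) \<partial>M) \<le> ennreal (floor_const\<^sup>2 * exp (1 / 4 + C))"
proof -
  have L0: "0 < L" using L_ge by simp
  have floor_const: "0 < floor_const" using C1 by (simp add: floor_const_def)
  have C2: "1 \<le> C\<^sup>2" using C1 by simp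
  have hx: "2 * (2 * (cmod 1)\<^sup>2 / (floor_const / L) + 2) \<le> L / (1000000 * C\<^sup>2)"
  proof -
    have "4 * (2000000 * C\<^sup>2) \<le> L" using L_large C2 by linarith
    then have "4 \<le> L / (2000000 * C\<^sup>2)" using C2 by (subst pos_le_divide_eq) auto
    moreover have "4 * L / floor_const = L / (2000000 * C\<^sup>2)" by (simp add: floor_const_def)
    ultimately have "4 * L / floor_const + 4 \<le> L / (1000000 * C\<^sup>2)" by (simp add: field_simps)
    then show ?thesis by simp
  qed
  have "(\<integral>\<^sup>+w. ennreal (dev_size (Z v1 n w) ^ 4) \<partial>M)
     = (\<integral>\<^sup>+w. ennreal (L\<^sup>2) * ennreal ((floor_const / L + (cmod (Z v1 n w $ 1 - 1))\<^sup>2 + (cmod (Z v1 n w $ 2))\<^sup>2) powr 2) \<partial>M)"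
  proof (rule nn_integral_cong)
    fix w
    have "0 < floor_const / L + (cmod (Z v1 n w $ 1 - 1))\<^sup>2 + (cmod (Z v1 n w $ 2))\<^sup>2"
      using L0 floor_const by (intro add_pos_nonneg) auto
    then show "ennreal (dev_size (Z v1 n w) ^ 4) = ennreal (L\<^sup>2) * ennreal ((floor_const / L + (cmod (Z v1 n w $ 1 - 1))\<^sup>2 + (cmod (Z v1 n w $ 2))\<^sup>2) powr 2)"
      by (simp add: dev_size_facts(5) ennreal_mult')
  qed
  also have "\<dots> = ennreal (L\<^sup>2) * (\<integral>\<^sup>+w. ennreal ((floor_const / L + (cmod (Z v1 n w $ 1 - 1))\<^sup>2 + (cmod (Z v1 n w $ 2))\<^sup>2) powr 2) \<partial>M)"
    using Z_measurable[OF assms, of v1] by (intro nn_integral_cmult) measurable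
  also have "\<dots> \<le> ennreal (L\<^sup>2) * ennreal (lyap 2 (floor_const / L) 1 n 0 v1 powr 2 * exp (2 / 8 + C))"
    using lyap_moment[of 2 "floor_const / L" _ 1 n v1, OF _ _ refl hx assms] L0 floor_const by (intro mult_left_mono) auto
  also have "lyap 2 (floor_const / L) 1 n 0 v1 = floor_const / L" by (simp add: lyap_def v1_def vector_2)
  also have "ennreal (L\<^sup>2) * ennreal ((floor_const / L) powr 2 * exp (2 / 8 + C)) = ennreal (floor_const\<^sup>2 * exp (1 / 4 + C))"
    using L0 floor_const by (simp add: ennreal_mult'[symmetric] power_divide)
  finally show ?thesis .
qed

text \<open>The last factor of \<open>phase_error_le\<close>, with the noise bound replaced by its
  largest possible value, the one at s = om.\<close>

definition rate :: "nat \<Rightarrow> real" where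
  "rate k = L * \<tau> k / s k * (1 / sqrt L + sqrt (R * L / om) * sqrt L) + sqrt (R * L / om) / s k + L\<^sup>2 / (s k)\<^sup>2"

lemma rate_nonneg: "k \<le> N \<Longrightarrow> 0 \<le> rate k"
  using \<tau>_bounds[of k] s_pos[of k] L_ge L_le R1 by (auto simp: rate_def)

lemma sum_inverse_s: "n \<le> N \<Longrightarrow> (\<Sum>k=1..n. 1 / s k) \<le> ln (s 0 / (s n - 1))"
proof (induction n)
  case 0
  then show ?case using s_pos[of 0] by simp
next
  case (Suc n)
  define t where "t = s (Suc n)"
  have t: "1 < t" using s_pos[OF Suc.prems] by (simp add: t_def)
  have s0: "0 < s 0" using s_pos[of 0] by simp
  have "ln ((t - 1) / t) \<le> (t - 1) / t - 1" using t by (intro ln_le_minus_one) auto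
  moreover have "ln ((t - 1) / t) = ln (t - 1) - ln t" using t by (subst ln_div) auto
  moreover have "(t - 1) / t - 1 = - (1 / t)" using t by (simp add: field_simps)
  ultimately have "1 / t \<le> ln t - ln (t - 1)" by linarith
  moreover have "(\<Sum>k=1..n. 1 / s k) \<le> ln (s 0 / t)" using Suc s_Suc[of n] by (simp add: t_def)
  ultimately show ?case using t s0 by (simp add: t_def[symmetric] ln_div)
qed

text \<open>L * \<tau> k / s k sums to at most 2 + 16 * C \<le> 18 * C, and 1 / s k to at most ln N.
  Apart from the term 1 / sqrt L, smallness therefore rests on \<open>L\<close> being small against
  a power of \<open>om\<close>.\<close>

lemma rate_sum: "(\<Sum>j=1..N. rate j)
   \<le> 18 * C * (1 / sqrt L + sqrt (R * L / om) * sqrt L) + sqrt (R * L / om) * ln N + 2 * L\<^sup>2 / om"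
proof -
  have L0: "0 < L" and om0: "1 \<le> om" and C0: "0 < C" using L_ge L_le C1 by auto
  define K B where "K = 1 / sqrt L + sqrt (R * L / om) * sqrt L" and "B = sqrt (R * L / om)"
  have K0: "0 \<le> K" and B0: "0 \<le> B" using L0 om0 R1 by (auto simp: K_def B_def)
  have "(\<Sum>j=1..N. rate j) = (\<Sum>j=1..N. K * (L * (W N j / s j)) + K * (8 * C * (om / s j / s j)) + B * (1 / s j) + L\<^sup>2 * (1 / (s j)\<^sup>2))"
  proof (intro sum.cong refl)
    fix j
    have "rate j = L * (W N j + 8 * C / L * (om / s j)) / s j * K + B / s j + L\<^sup>2 / (s j)\<^sup>2"
      by (simp only: rate_def \<tau>_def K_def B_def)
    also have "L * (W N j + 8 * C / L * (om / s j)) = L * W N j + 8 * C * (om / s j)"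
      using L0 by (simp add: distrib_left)
    finally show "rate j = K * (L * (W N j / s j)) + K * (8 * C * (om / s j / s j)) + B * (1 / s j) + L\<^sup>2 * (1 / (s j)\<^sup>2)"
      by (simp add: add_divide_distrib algebra_simps)
  qed
  also have "\<dots> = K * (L * (\<Sum>j=1..N. W N j / s j)) + K * (8 * C * (\<Sum>j=1..N. om / s j / s j))
      + B * (\<Sum>j=1..N. 1 / s j) + L\<^sup>2 * (\<Sum>j=1..N. 1 / (s j)\<^sup>2)"
    by (simp only: sum.distrib sum_distrib_left)
  also have "\<dots> \<le> K * (L * (2 / L)) + K * (8 * C * 2) + B * ln N + L\<^sup>2 * (2 / om)"
  proof (intro add_mono mult_left_mono)
    show "(\<Sum>j=1..N. 1 / s j) \<le> ln N"
    proof -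
      have "(\<Sum>j=1..N. 1 / s j) \<le> ln (s 0 / (s N - 1))" by (rule sum_inverse_s) simp
      also have "\<dots> \<le> ln N"
      proof (rule ln_mono)
        have o2: "10000000 \<le> om" using L_le by simp
        have "om + real N \<le> real N * 2" using om_le_N om0 by simp
        also have "\<dots> \<le> real N * (om - 1)" using o2 by (intro mult_left_mono) auto
        finally show "s 0 / (s N - 1) \<le> N" using o2 by (simp add: s_def divide_le_eq)
        show "0 < s 0 / (s N - 1)" using o2 by (auto simp: s_def intro!: divide_pos_pos add_pos_nonneg)
      qed
      finally show ?thesis .
    qed
    show "(\<Sum>j=1..N. 1 / (s j)\<^sup>2) \<le> 2 / om"
    proof -
      have "(\<Sum>j=1..N. 1 / (s j)\<^sup>2) \<le> 1 / (s N - 1)" by (rule sum_inverse_s_sq) simp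
      also have "\<dots> \<le> 1 / (om / 2)" using L_le by (intro divide_left_mono) (auto simp: s_def)
      finally show ?thesis by simp
    qed
  qed (use sum_W_div_s[of N] sum_om_div_s_sq[of N] K0 B0 L0 C0 in auto)
  also have "\<dots> \<le> 18 * C * K + B * ln N + 2 * L\<^sup>2 / om"
  proof -
    have "1 * K \<le> C * K" using C1 K0 by (intro mult_right_mono) auto
    moreover have "K * (L * (2 / L)) = 2 * K" using L0 by simp
    moreover have "L\<^sup>2 * (2 / om) = 2 * L\<^sup>2 / om" "K * (8 * C * 2) = 16 * (C * K)" "18 * C * K = 18 * (C * K)" by simp_all
    ultimately show ?thesis by linarith
  qed
  finally show ?thesis by (simp add: K_def B_def)
qed

text \<open>\<theta> is the product of the factors exp (- h), times the initial value 1 of the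
  functional at (1, 0); all that matters later is that it is real and nonnegative. The parameters
  are arbitrary in the induction because each step replaces (a, p0, p1) by (a', p0', p1').
  Multiplication by exp (- h) \<le> 1 does not amplify errors, so they add up.\<close>

lemma phase_iterate:
  fixes a b p1 :: complex and p0 T :: real
  assumes T: "1 \<le> T" and b: "cmod b \<le> T * sqrt L" and k: "k \<le> N"
    and a: "cmod a \<le> T * sqrt L * \<tau> k" and p: "cmod p1 \<le> p0" "p0 \<le> qform_cap T k"
  shows "\<exists>\<theta>. (0::real) \<le> \<theta> \<and> \<theta> \<le> (1::real) \<and>
    cmod ((LINT w|M. phase b a p0 p1 (Z v1 k w $ 1) (Z v1 k w $ 2)) - complex_of_real \<theta>)
      \<le> 201000 * (C\<^sup>2 * T ^ 4) * (floor_const\<^sup>2 * exp (1 / 4 + C)) * (\<Sum>j=1..k. rate j)"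
  using k a p
proof (induction k arbitrary: a p0 p1)
  case 0
  have "phase b a p0 p1 1 0 = 1" by (simp add: phase_def qform_def)
  then show ?case by (intro exI[of _ 1]) (simp add: Z_0 v1_def vector_2 prob_space)
next
  case (Suc k)
  let ?k = "Suc k"
  have kN: "?k \<le> N" "?k \<in> {1..N}" "k < N" "k \<le> N" using Suc.prems by auto
  define S where "S = s ?k"
  have S0: "0 < S" "om \<le> S" "10000000 \<le> S" using s_pos[OF kN(1)] s_ge[OF kN(1)] by (auto simp: S_def)
  have L0: "0 < L" "1 \<le> L" and om0: "0 < om" and C0: "0 < C" and T0: "0 \<le> T" using L_ge L_le C1 T by auto
  define B where "B = sqrt (R * L / S)"
  define e1 e2 e3 where "e1 = \<eta> ?k 1 2" and "e2 = \<eta> ?k 2 1" and "e3 = \<eta> ?k 2 2"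
  have noise: "small_noise M (C / S) (2 * C / S) B e1" "small_noise M (C / S) (2 * C / S) B e2"
      "small_noise M (C / S) (2 * C / S) B e3"
    unfolding e1_def e2_def e3_def S_def B_def by (rule small_noise_eta[OF kN(2)])+
  have [measurable]: "e1 \<in> borel_measurable M" "e2 \<in> borel_measurable M" "e3 \<in> borel_measurable M"
    using noise by (auto simp: small_noise_def)
  have CS: "C / S \<le> 2 * C / S" "C / S \<le> 1" "C / S \<le> B"
  proof -
    show "C / S \<le> 2 * C / S" using C0 S0 by (simp add: divide_right_mono)
    show "C / S \<le> 1" using L_le S0 by simp
    have "C * C \<le> L * L" using L_le C0 by (intro mult_mono) auto
    also have "\<dots> \<le> (R * L) * S"
      using R1 L0 L_le S0 by (intro mult_mono) (auto simp: mult_le_cancel_right1)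
    finally have "(C / S)\<^sup>2 \<le> R * L / S" using S0 by (simp add: power2_eq_square field_simps)
    from real_sqrt_le_mono[OF this] show "C / S \<le> B" using C0 S0 by (simp add: B_def)
  qed
  define c1 where "c1 = (\<lambda>w. e1 w - (LINT w|M. e1 w))"
  define a' where "a' = \<rho> ?k * a + b * (LINT w|M. e1 w)"
  define p0' where "p0' = (cmod (\<rho> ?k))\<^sup>2 * p0 + (cmod b)\<^sup>2 * (LINT w|M. (cmod (c1 w))\<^sup>2) / 4"
  define p1' where "p1' = (\<rho> ?k)\<^sup>2 * p1 + b\<^sup>2 * (LINT w|M. (c1 w)\<^sup>2) / 4"
  define h where "h = (LINT w|M. (Re (a * e2 w))\<^sup>2) / 2 + (LINT w|M. qform p0 p1 (e2 w))"
  note step = phase_step(2)[OF rho_le_1[OF kN(2)] Suc.prems(3) noise CS, where a = a and b = b,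
      folded a'_def p0'_def[unfolded c1_def] p1'_def[unfolded c1_def] h_def]
  have h0: "0 \<le> h" unfolding h_def by (rule phase_step(1)[OF rho_le_1[OF kN(2)] Suc.prems(3) noise CS])
  have p00: "0 \<le> p0" using Suc.prems(3) norm_ge_zero order_trans by blast
  \<comment> \<open>The variance bound C / S is used here, not the second moment bound 2 * C / S: it
    is the source that \<open>qform_cap_step\<close> allows for.\<close>
  have var1: "(LINT w|M. (cmod (c1 w))\<^sup>2) \<le> C / S"
    using eta_var[OF kN(2), of 1 2] by (simp add: complex_variance_def c1_def e1_def S_def s_def)
  have bsq: "(cmod b)\<^sup>2 \<le> T\<^sup>2 * L"
    using power_mono[OF b, of 2] L0 by (simp add: power_mult_distrib)
  have a': "cmod a' \<le> T * sqrt L * \<tau> k"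
  proof -
    have "cmod a' \<le> cmod (\<rho> ?k) * cmod a + cmod b * cmod (LINT w|M. e1 w)"
      unfolding a'_def norm_mult[symmetric] by (rule norm_triangle_ineq)
    also have "\<dots> \<le> exp (- gam ?k) * (T * sqrt L * \<tau> ?k) + (T * sqrt L) * (C / S)"
      using rho_le_gam[OF kN(2)] Suc.prems(2) b eta_mean[OF kN(2), of 1 2] T0 L0
      by (intro add_mono mult_mono) (auto simp: e1_def S_def s_def)
    also have "\<dots> = T * sqrt L * (exp (- gam ?k) * \<tau> ?k + C / S)" by (simp add: algebra_simps)
    also have "\<dots> \<le> T * sqrt L * \<tau> k" unfolding S_def using \<tau>_step[OF kN(1)] T0 L0 by (intro mult_left_mono) auto
    finally show ?thesis .
  qed
  have p0': "p0' \<le> qform_cap T k"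
  proof -
    have "(cmod (\<rho> ?k))\<^sup>2 \<le> exp (- gam ?k)"
    proof -
      have "(cmod (\<rho> ?k))\<^sup>2 \<le> cmod (\<rho> ?k) * 1" unfolding power2_eq_square
        using rho_le_1[OF kN(2)] by (intro mult_left_mono) auto
      then show ?thesis using rho_le_gam[OF kN(2)] by simp
    qed
    then have "p0' \<le> exp (- gam ?k) * qform_cap T ?k + (T\<^sup>2 * L) * (C / S) / 4"
      unfolding p0'_def using Suc.prems(4) p00 bsq var1 L0
      by (intro add_mono divide_right_mono mult_mono) auto
    also have "\<dots> \<le> qform_cap T k" using qform_cap_step[OF kN(1), of T] by (simp add: S_def)
    finally show ?thesis .
  qed
  have p1': "cmod p1' \<le> p0'"
  proof -
    have "cmod p1' \<le> cmod ((\<rho> ?k)\<^sup>2 * p1) + cmod (b\<^sup>2 * (LINT w|M. (c1 w)\<^sup>2) / 4)"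
      unfolding p1'_def by (rule norm_triangle_ineq)
    also have "\<dots> = (cmod (\<rho> ?k))\<^sup>2 * cmod p1 + (cmod b)\<^sup>2 * cmod (LINT w|M. (c1 w)\<^sup>2) / 4"
      by (simp add: norm_mult norm_power norm_divide)
    also have "\<dots> \<le> p0'" unfolding p0'_def
    proof (intro add_mono mult_left_mono divide_right_mono)
      have "cmod (LINT w|M. (c1 w)\<^sup>2) \<le> (LINT w|M. cmod ((c1 w)\<^sup>2))" by (rule integral_norm_bound)
      then show "cmod (LINT w|M. (c1 w)\<^sup>2) \<le> (LINT w|M. (cmod (c1 w))\<^sup>2)" by (simp add: norm_power)
    qed (use Suc.prems(3) in auto)
    finally show ?thesis .
  qed
  define \<Phi> \<Phi>' where "\<Phi> = (\<lambda>v :: complex ^ 2. phase b a p0 p1 (v $ 1) (v $ 2))"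
    and "\<Phi>' = (\<lambda>v :: complex ^ 2. phase b a' p0' p1' (v $ 1) (v $ 2))"
  have m\<Phi>[measurable]: "\<Phi> \<in> borel_measurable borel" "\<Phi>' \<in> borel_measurable borel"
    unfolding \<Phi>_def \<Phi>'_def phase_def qform_def
    by (intro borel_measurable_continuous_onI continuous_intros)+
  have b\<Phi>: "cmod (\<Phi> v) \<le> 1" "cmod (\<Phi>' v) \<le> 1" for v
    unfolding \<Phi>_def \<Phi>'_def using cmod_phase_le Suc.prems(3) p1' by auto
  define g where "g = (\<lambda>v. LINT w|M. \<Phi> (U ?k w *v v))"
  have mU: "U ?k \<in> borel_measurable M" using indep_U kN by (auto simp: indep_vars_def)
  have mg[measurable]: "g \<in> borel_measurable borel"
  proof -
    have "(\<lambda>z. (\<lambda>(A, u). A *v u) (U ?k (snd z), fst z)) \<in> borel_measurable (borel \<Otimes>\<^sub>M M)"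
      by (rule measurable_compose[OF _ borel_measurable_matrix_vector_mult]) (use mU in measurable)
    then have "(\<lambda>z. \<Phi> (U ?k (snd z) *v fst z)) \<in> borel_measurable (borel \<Otimes>\<^sub>M M)" by simp
    then have "(\<lambda>(v, w). \<Phi> (U ?k w *v v)) \<in> borel_measurable (borel \<Otimes>\<^sub>M M)" by (simp add: case_prod_unfold)
    then show ?thesis unfolding g_def by (rule borel_measurable_lebesgue_integral)
  qed
  have bg: "cmod (g v) \<le> 1" for v
  proof -
    have "cmod (g v) \<le> (LINT w|M. cmod (\<Phi> (U ?k w *v v)))" unfolding g_def by (rule integral_norm_bound)
    also have "\<dots> \<le> 1"
    proof (rule integral_le_const)
      show "integrable M (\<lambda>w. cmod (\<Phi> (U ?k w *v v)))"
      proof (rule integrable_const_bound[where B = 1])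
        have "(\<lambda>w. (\<lambda>(A, u). A *v u) (U ?k w, v)) \<in> borel_measurable M"
          by (rule measurable_compose[OF _ borel_measurable_matrix_vector_mult]) (use mU in measurable)
        then have "(\<lambda>w. U ?k w *v v) \<in> borel_measurable M" by simp
        from measurable_compose[OF this m\<Phi>(1)]
        show "(\<lambda>w. cmod (\<Phi> (U ?k w *v v))) \<in> borel_measurable M" by measurable
      qed (use b\<Phi> in auto)
    qed (use b\<Phi> in auto)
    finally show ?thesis .
  qed
  have mZ[measurable]: "Z v1 k \<in> borel_measurable M" by (rule Z_measurable[OF kN(4)])
  have E1: "(LINT w|M. \<Phi> (Z v1 ?k w)) = (LINT w|M. g (Z v1 k w))"
    unfolding g_def Z_def by (rule integral_mat_prod_step[OF indep_U kN(3) m\<Phi>(1) b\<Phi>(1)])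
  define D where "D = 201000 * (C\<^sup>2 * T ^ 4) * rate ?k"
  have D0: "0 \<le> D" using rate_nonneg[OF kN(1)] T0 C0 by (simp add: D_def)
  have err: "cmod (g v - complex_of_real (exp (- h)) * \<Phi>' v) \<le> D * dev_size v ^ 4" for v
  proof -
    have "cmod (g v - complex_of_real (exp (- h)) * \<Phi>' v)
      \<le> phase_error (cmod a) (cmod b) p0 (C / S) (2 * C / S) B (cmod (v $ 1) + cmod (v $ 2) + 1) (cmod (v $ 1 - 1)) (cmod (v $ 2))"
      using step[of "v $ 1" "v $ 2"]
      by (simp add: g_def \<Phi>_def \<Phi>'_def U_def transfer_matrix_mult_nth e1_def e2_def e3_def)
    also have "\<dots> \<le> 201000 * (C\<^sup>2 * T ^ 4 * dev_size v ^ 4) * (L * \<tau> ?k / S * (1 / sqrt L + B * sqrt L) + B / S + L\<^sup>2 / S\<^sup>2)"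
    proof (rule phase_error_le)
      have os: "om / S \<le> 1" "0 \<le> om / S" using S0 om0 by auto
      show "p0 \<le> T\<^sup>2 * L * \<tau> ?k / 4"
      proof -
        have "8 * C * (om / S) \<le> L * \<tau> ?k" using L0 by (simp add: \<tau>_def S_def W_def distrib_left)
        then have "T\<^sup>2 / 4 * (8 * C * (om / S)) \<le> T\<^sup>2 / 4 * (L * \<tau> ?k)" by (intro mult_left_mono) auto
        moreover have "p0 \<le> T\<^sup>2 / 4 * (8 * C * (om / S))" using Suc.prems(4) by (simp add: qform_cap_def S_def mult_ac)
        ultimately show ?thesis by simp
      qed
      show "p0 \<le> 2 * C * T\<^sup>2"
      proof -
        have "p0 \<le> 2 * C * T\<^sup>2 * (om / S)" using Suc.prems(4) by (simp add: qform_cap_def S_def)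
        also have "\<dots> \<le> 2 * C * T\<^sup>2 * 1" using os C0 by (intro mult_left_mono) auto
        finally show ?thesis by simp
      qed
      show "1 / sqrt L + 8 * B \<le> 1"
      proof -
        have "R * L / S \<le> (1 / L)\<^sup>2"
        proof -
          have "R * L * L\<^sup>2 \<le> S" using om_large S0 by (simp add: power3_eq_cube power2_eq_square mult_ac)
          then show ?thesis using L0 S0 by (simp add: power_divide field_simps)
        qed
        from real_sqrt_le_mono[OF this] have "B \<le> 1 / L" using L0 by (simp add: B_def real_sqrt_divide)
        moreover have "1 / L \<le> 1 / 16" using L_ge by (intro divide_left_mono) auto
        moreover have "1 / sqrt L \<le> 1 / 2"
        proof -
          have "2 \<le> sqrt L" using L_ge by (intro real_le_rsqrt) auto
          then show ?thesis using L0 by (intro divide_left_mono) auto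
        qed
        ultimately show ?thesis by simp
      qed
    qed (use T C1 L_le S0 \<tau>_bounds[OF kN(1)] Suc.prems(2) b p00 dev_size_facts[of v] R1 L0 in \<open>auto simp: B_def\<close>)
    also have "\<dots> \<le> 201000 * (C\<^sup>2 * T ^ 4 * dev_size v ^ 4) * rate ?k"
    proof (rule mult_left_mono)
      have "R * L / S \<le> R * L / om" using S0 om0 R1 L0 by (intro divide_left_mono) auto
      from real_sqrt_le_mono[OF this] have "B \<le> sqrt (R * L / om)" by (simp add: B_def)
      then show "L * \<tau> ?k / S * (1 / sqrt L + B * sqrt L) + B / S + L\<^sup>2 / S\<^sup>2 \<le> rate ?k"
        unfolding rate_def S_def[symmetric] using \<tau>_bounds[OF kN(1)] L0 S0
        by (intro add_mono mult_left_mono mult_right_mono divide_right_mono) auto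
    qed (use C0 T0 dev_size_facts(1)[of v] in auto)
    finally show ?thesis by (simp add: D_def mult_ac)
  qed
  have int_g: "integrable M (\<lambda>w. g (Z v1 k w))" "integrable M (\<lambda>w. \<Phi>' (Z v1 k w))"
    by (rule integrable_const_bound[where B = 1]; use bg b\<Phi> in \<open>auto\<close>)+
  have "cmod ((LINT w|M. \<Phi> (Z v1 ?k w)) - complex_of_real (exp (- h)) * (LINT w|M. \<Phi>' (Z v1 k w)))
      \<le> D * (floor_const\<^sup>2 * exp (1 / 4 + C))"
  proof -
    have "(LINT w|M. \<Phi> (Z v1 ?k w)) - complex_of_real (exp (- h)) * (LINT w|M. \<Phi>' (Z v1 k w))
       = (LINT w|M. g (Z v1 k w) - complex_of_real (exp (- h)) * \<Phi>' (Z v1 k w))"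
      unfolding E1 using int_g by simp
    also have "ennreal (cmod \<dots>) \<le> (\<integral>\<^sup>+w. ennreal (cmod (g (Z v1 k w) - complex_of_real (exp (- h)) * \<Phi>' (Z v1 k w))) \<partial>M)"
      using int_g by (intro integral_norm_bound_ennreal) auto
    also have "\<dots> \<le> (\<integral>\<^sup>+w. ennreal D * ennreal (dev_size (Z v1 k w) ^ 4) \<partial>M)"
      using err D0 by (intro nn_integral_mono) (auto simp: ennreal_mult'[symmetric] intro!: ennreal_leI)
    also have "\<dots> = ennreal D * (\<integral>\<^sup>+w. ennreal (dev_size (Z v1 k w) ^ 4) \<partial>M)"
      unfolding dev_size_def by (intro nn_integral_cmult) measurable
    also have "\<dots> \<le> ennreal D * ennreal (floor_const\<^sup>2 * exp (1 / 4 + C))"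
      using dev_size_moment[OF kN(4)] by (intro mult_left_mono) auto
    finally show ?thesis using D0 by (simp add: ennreal_mult'[symmetric] ennreal_le_iff)
  qed
  moreover obtain \<theta> where \<theta>: "0 \<le> \<theta>" "\<theta> \<le> 1"
    "cmod ((LINT w|M. \<Phi>' (Z v1 k w)) - complex_of_real \<theta>)
      \<le> 201000 * (C\<^sup>2 * T ^ 4) * (floor_const\<^sup>2 * exp (1 / 4 + C)) * (\<Sum>j=1..k. rate j)"
    using Suc.IH[OF kN(4) a' p1' p0'] unfolding \<Phi>'_def by blast
  moreover have "cmod (complex_of_real (exp (- h)) * (LINT w|M. \<Phi>' (Z v1 k w)) - complex_of_real (exp (- h)) * complex_of_real \<theta>)
     \<le> cmod ((LINT w|M. \<Phi>' (Z v1 k w)) - complex_of_real \<theta>)"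
    unfolding right_diff_distrib[symmetric] norm_mult using h0 by (simp add: mult_left_le_one_le)
  ultimately have "cmod ((LINT w|M. \<Phi> (Z v1 ?k w)) - complex_of_real (exp (- h)) * complex_of_real \<theta>)
      \<le> D * (floor_const\<^sup>2 * exp (1 / 4 + C)) + 201000 * (C\<^sup>2 * T ^ 4) * (floor_const\<^sup>2 * exp (1 / 4 + C)) * (\<Sum>j=1..k. rate j)"
    using norm_triangle_ineq[of "(LINT w|M. \<Phi> (Z v1 ?k w)) - complex_of_real (exp (- h)) * (LINT w|M. \<Phi>' (Z v1 k w))"
      "complex_of_real (exp (- h)) * (LINT w|M. \<Phi>' (Z v1 k w)) - complex_of_real (exp (- h)) * complex_of_real \<theta>"]
    by simp
  also have "\<dots> = 201000 * (C\<^sup>2 * T ^ 4) * (floor_const\<^sup>2 * exp (1 / 4 + C)) * (\<Sum>j=1..?k. rate j)"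
    by (simp add: D_def algebra_simps)
  finally have "cmod ((LINT w|M. \<Phi> (Z v1 ?k w)) - complex_of_real (exp (- h) * \<theta>))
     \<le> 201000 * (C\<^sup>2 * T ^ 4) * (floor_const\<^sup>2 * exp (1 / 4 + C)) * (\<Sum>j=1..?k. rate j)" by simp
  moreover have "0 \<le> exp (- h) * \<theta>" "exp (- h) * \<theta> \<le> 1" using h0 \<theta> by (auto intro: mult_le_one)
  ultimately show ?case unfolding \<Phi>_def by blast
qed

lemma Re_characteristic_lower_bound:
  fixes a b :: complex
  assumes T: "1 \<le> T" and b: "cmod b \<le> T * sqrt L" and a: "cmod a \<le> T * sqrt L"
  shows "- (201000 * (C\<^sup>2 * T ^ 4) * (floor_const\<^sup>2 * exp (1 / 4 + C)) *
       (18 * C * (1 / sqrt L + sqrt (R * L / om) * sqrt L) + sqrt (R * L / om) * ln N + 2 * L\<^sup>2 / om))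
    \<le> (LINT w|M. cos (Re (b * (Z v1 N w $ 1 - 1) + a * Z v1 N w $ 2)))"
proof -
  define A where "A = 201000 * (C\<^sup>2 * T ^ 4) * (floor_const\<^sup>2 * exp (1 / 4 + C))"
  have A0: "0 \<le> A" using C1 T by (simp add: A_def)
  have "1 \<le> \<tau> N" using L_ge L_le C1 s_pos[of N] by (simp add: \<tau>_def W_def)
  then have "T * sqrt L * 1 \<le> T * sqrt L * \<tau> N" using T L_ge by (intro mult_left_mono) auto
  then have a': "cmod a \<le> T * sqrt L * \<tau> N" using a by simp
  have "0 \<le> qform_cap T N" using C1 L_le s_pos[of N] by (simp add: qform_cap_def)
  from phase_iterate[OF T b order.refl a' _ this, of 0]
  obtain \<theta> where \<theta>: "(0::real) \<le> \<theta>"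
    and le: "cmod ((LINT w|M. phase b a 0 0 (Z v1 N w $ 1) (Z v1 N w $ 2)) - complex_of_real \<theta>) \<le> A * (\<Sum>j=1..N. rate j)"
    by (auto simp: A_def)
  define I where "I = (LINT w|M. phase b a 0 0 (Z v1 N w $ 1) (Z v1 N w $ 2))"
  have [measurable]: "Z v1 N \<in> borel_measurable M" by (rule Z_measurable) simp
  have ph: "phase b a 0 0 x y = iexp (Re (b * (x - 1) + a * y))" for x y by (simp add: phase_def qform_def)
  have int: "integrable M (\<lambda>w. phase b a 0 0 (Z v1 N w $ 1) (Z v1 N w $ 2))"
    unfolding ph by (rule integrable_const_bound[where B = 1]) (auto, measurable)
  have Re_I: "Re I = (LINT w|M. cos (Re (b * (Z v1 N w $ 1 - 1) + a * Z v1 N w $ 2)))"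
    unfolding I_def using int by (simp add: integral_Re[symmetric] ph Re_exp)
  have "\<theta> - A * (\<Sum>j=1..N. rate j) \<le> Re I"
    using le abs_Re_le_cmod[of "I - \<theta>"] by (simp add: I_def[symmetric])
  moreover have "A * (\<Sum>j=1..N. rate j) \<le> A * (18 * C * (1 / sqrt L + sqrt (R * L / om) * sqrt L) + sqrt (R * L / om) * ln N + 2 * L\<^sup>2 / om)"
    using rate_sum A0 by (rule mult_left_mono)
  ultimately show ?thesis using \<theta> unfolding Re_I A_def[symmetric] by linarith
qed

end

section \<open>Small balls from characteristic functions\<close>

text \<open>The Fourier coefficient of \<open>cos (x / 2) ^ (2 * m)\<close> at the frequency k - m;
  k = m gives the constant term.\<close>

definition binom_weight :: "nat \<Rightarrow> nat \<Rightarrow> real" where "binom_weight m k = real ((2 * m) choose k) / 4 ^ m"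

lemma binom_weight_nonneg: "0 \<le> binom_weight m k" by (simp add: binom_weight_def)

lemma cos_power_even_expand:
  "complex_of_real (cos (\<theta> * x / 2) ^ (2 * m)) = (\<Sum>k\<le>2 * m. binom_weight m k * iexp (\<theta> * (real k - real m) * x))"
proof -
  define \<phi> where "\<phi> = \<theta> * x / 2"
  have "complex_of_real (cos \<phi>) = (iexp \<phi> + iexp (- \<phi>)) / 2"
    by (simp add: cos_exp_eq flip: cos_of_real)
  then have "complex_of_real (cos \<phi> ^ (2 * m)) = ((iexp \<phi> + iexp (- \<phi>)) / 2) ^ (2 * m)"
    by (simp only: of_real_power)
  also have "\<dots> = (iexp \<phi> + iexp (- \<phi>)) ^ (2 * m) / 4 ^ m"
    by (simp add: power_divide power_mult)
  also have "(iexp \<phi> + iexp (- \<phi>)) ^ (2 * m)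
     = (\<Sum>k\<le>2 * m. of_nat ((2 * m) choose k) * iexp \<phi> ^ k * iexp (- \<phi>) ^ (2 * m - k))"
    by (rule binomial_ring)
  also have "\<dots> / 4 ^ m = (\<Sum>k\<le>2 * m. binom_weight m k * iexp (\<theta> * (real k - real m) * x))"
    unfolding sum_divide_distrib
  proof (intro sum.cong refl)
    fix k assume k: "k \<in> {..2 * m}"
    have "iexp \<phi> ^ k * iexp (- \<phi>) ^ (2 * m - k) = exp (of_nat k * (\<i> * \<phi>)) * exp (of_nat (2 * m - k) * (\<i> * complex_of_real (- \<phi>)))"
      by (simp only: exp_of_nat_mult)
    also have "\<dots> = exp (of_nat k * (\<i> * \<phi>) + of_nat (2 * m - k) * (\<i> * complex_of_real (- \<phi>)))"
      by (simp only: exp_add)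
    also have "of_nat k * (\<i> * \<phi>) + of_nat (2 * m - k) * (\<i> * complex_of_real (- \<phi>))
        = \<i> * complex_of_real (\<theta> * (real k - real m) * x)"
      using k by (simp add: \<phi>_def of_nat_diff field_simps)
    finally show "of_nat ((2 * m) choose k) * iexp \<phi> ^ k * iexp (- \<phi>) ^ (2 * m - k) / 4 ^ m
        = binom_weight m k * iexp (\<theta> * (real k - real m) * x)"
      by (simp add: binom_weight_def mult.assoc)
  qed
  finally show ?thesis by (simp only: \<phi>_def)
qed

lemma sum_binom_weight: "(\<Sum>k\<le>2 * m. binom_weight m k) = 1"
proof -
  have "complex_of_real (\<Sum>k\<le>2 * m. binom_weight m k) = 1" using cos_power_even_expand[of 0 0 m] by simp
  then show ?thesis using of_real_eq_1_iff by blast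
qed

text \<open>
  The even power of the cosine is a trigonometric polynomial with nonnegative coefficients, so an
  almost nonnegative characteristic function bounds its mean from below by the constant coefficient.
\<close>
lemma (in prob_space) expectation_cos_power_ge:
  fixes S :: "'i \<Rightarrow> 'a \<Rightarrow> real"
  assumes J: "finite J" and meas: "\<And>j. j \<in> J \<Longrightarrow> S j \<in> borel_measurable M"
    and \<theta>: "0 \<le> \<theta>" and \<delta>: "0 \<le> \<delta>"
    and char: "\<And>t. (\<And>j. j \<in> J \<Longrightarrow> \<bar>t j\<bar> \<le> \<theta> * real m) \<Longrightarrow> - \<delta> \<le> (LINT w|M. cos (\<Sum>j\<in>J. t j * S j w))"
  shows "binom_weight m m ^ card J - \<delta> \<le> (LINT w|M. (\<Prod>j\<in>J. cos (\<theta> * S j w / 2) ^ (2 * m)))"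
proof -
  define PI where "PI = (J \<rightarrow>\<^sub>E {..2 * m})"
  have fin: "finite PI" unfolding PI_def using J by (intro finite_PiE) auto
  define cf where "cf = (\<lambda>g. \<Prod>j\<in>J. binom_weight m (g j))"
  define t where "t = (\<lambda>(g :: 'i \<Rightarrow> nat) j. \<theta> * (real (g j) - real m))"
  have cf0: "0 \<le> cf g" for g unfolding cf_def by (intro prod_nonneg) (auto simp: binom_weight_nonneg)
  have expand: "(\<Prod>j\<in>J. cos (\<theta> * S j w / 2) ^ (2 * m)) = (\<Sum>g\<in>PI. cf g * cos (\<Sum>j\<in>J. t g j * S j w))" for w
  proof -
    have "complex_of_real (\<Prod>j\<in>J. cos (\<theta> * S j w / 2) ^ (2 * m))
       = (\<Prod>j\<in>J. \<Sum>k\<le>2 * m. binom_weight m k * iexp (\<theta> * (real k - real m) * S j w))"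
      by (simp only: of_real_prod cos_power_even_expand)
    also have "\<dots> = (\<Sum>g\<in>PI. \<Prod>j\<in>J. binom_weight m (g j) * iexp (\<theta> * (real (g j) - real m) * S j w))"
      unfolding PI_def using J by (intro prod_sum_PiE) auto
    also have "\<dots> = (\<Sum>g\<in>PI. complex_of_real (cf g) * iexp (\<Sum>j\<in>J. t g j * S j w))"
    proof (intro sum.cong refl)
      fix g
      have "(\<Prod>j\<in>J. iexp (t g j * S j w)) = exp (\<Sum>j\<in>J. \<i> * complex_of_real (t g j * S j w))"
        using J by (rule exp_sum[symmetric])
      also have "\<dots> = iexp (\<Sum>j\<in>J. t g j * S j w)" by (simp only: of_real_sum sum_distrib_left)
      finally show "(\<Prod>j\<in>J. binom_weight m (g j) * iexp (\<theta> * (real (g j) - real m) * S j w))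
         = complex_of_real (cf g) * iexp (\<Sum>j\<in>J. t g j * S j w)"
        by (simp only: cf_def t_def of_real_prod prod.distrib)
    qed
    finally have "Re (complex_of_real (\<Prod>j\<in>J. cos (\<theta> * S j w / 2) ^ (2 * m)))
       = Re (\<Sum>g\<in>PI. complex_of_real (cf g) * iexp (\<Sum>j\<in>J. t g j * S j w))" by (simp only:)
    then show ?thesis by (simp add: Re_exp del: of_real_sum of_real_prod of_real_power)
  qed
  have mc: "(\<lambda>w. cos (\<Sum>j\<in>J. t g j * S j w)) \<in> borel_measurable M" for g
    using meas by measurable
  have int: "integrable M (\<lambda>w. cos (\<Sum>j\<in>J. t g j * S j w))" for g
    by (rule integrable_const_bound[where B = 1]) (use mc in auto)
  \<comment> \<open>The multi-index with all frequencies 0: its character is 1 and contributes the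
    full coefficient. The others contribute at least - \<delta> times theirs, and all coefficients
    together sum to 1.\<close>
  define g0 where "g0 = restrict (\<lambda>_. m) J"
  have g0: "g0 \<in> PI" by (auto simp: g0_def PI_def)
  have t0: "t g0 j = 0" if "j \<in> J" for j using that by (simp add: t_def g0_def)
  have c0: "cf g0 = binom_weight m m ^ card J" by (simp add: cf_def g0_def)
  have sumcf: "(\<Sum>g\<in>PI. cf g) = 1"
  proof -
    have "(\<Sum>g\<in>PI. cf g) = (\<Prod>j\<in>J. \<Sum>k\<le>2 * m. binom_weight m k)"
      unfolding PI_def cf_def using J by (intro prod_sum_PiE[symmetric]) auto
    then show ?thesis by (simp add: sum_binom_weight)
  qed
  have "cf g0 - \<delta> = cf g0 - \<delta> * (\<Sum>g\<in>PI. cf g)" by (simp add: sumcf)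
  also have "\<dots> = (\<Sum>g\<in>PI. (if g = g0 then cf g else 0) + cf g * (- \<delta>))"
    using fin g0 by (simp add: sum_subtractf sum_distrib_left mult.commute)
  also have "\<dots> \<le> (\<Sum>g\<in>PI. cf g * (LINT w|M. cos (\<Sum>j\<in>J. t g j * S j w)))"
  proof (rule sum_mono)
    fix g assume g: "g \<in> PI"
    show "(if g = g0 then cf g else 0) + cf g * (- \<delta>) \<le> cf g * (LINT w|M. cos (\<Sum>j\<in>J. t g j * S j w))"
    proof (cases "g = g0")
      case True
      have "(\<Sum>j\<in>J. t g j * S j w) = 0" for w using True by (intro sum.neutral) (auto simp: t0)
      then have "(LINT w|M. cos (\<Sum>j\<in>J. t g j * S j w)) = 1" by (simp add: prob_space)
      then show ?thesis using True cf0[of g] \<delta> by simp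
    next
      case False
      have "- \<delta> \<le> (LINT w|M. cos (\<Sum>j\<in>J. t g j * S j w))"
      proof (rule char)
        fix j assume "j \<in> J"
        then have "g j \<le> 2 * m" using g by (auto simp: PI_def)
        then have "\<bar>real (g j) - real m\<bar> \<le> real m" by simp
        then show "\<bar>t g j\<bar> \<le> \<theta> * real m" using \<theta> by (simp add: t_def abs_mult mult_left_mono)
      qed
      then show ?thesis using False cf0[of g] by (simp only: if_False add_0_left) (rule mult_left_mono)
    qed
  qed
  also have "\<dots> = (LINT w|M. (\<Prod>j\<in>J. cos (\<theta> * S j w / 2) ^ (2 * m)))"
    unfolding expand using int by (simp add: Bochner_Integration.integral_sum)
  finally show ?thesis unfolding c0 .
qed

text \<open>For |x| \<le> 1/2 the cubic Taylor error is at most x^2 / 12, and 1/2 - 1/12 exceeds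
  1/3.\<close>

lemma cos_power_le_exp:
  fixes x :: real
  assumes "\<bar>x\<bar> \<le> 1 / 2"
  shows "cos x ^ (2 * m) \<le> exp (- (2 * real m * x\<^sup>2 / 3))"
proof -
  have b: "cmod (iexp x - (\<Sum>k\<le>2. (\<i> * complex_of_real x) ^ k / fact k)) \<le> \<bar>x\<bar> ^ 3 / 6"
    using iexp_approx1[of x 2] by (simp add: eval_nat_numeral)
  have "(\<i> * complex_of_real x) ^ 2 = - complex_of_real (x\<^sup>2)" by (simp add: power_mult_distrib)
  moreover have "(\<Sum>k\<le>2. (\<i> * complex_of_real x) ^ k / fact k)
     = 1 + \<i> * complex_of_real x + (\<i> * complex_of_real x) ^ 2 / 2"
    by (simp add: numeral_2_eq_2)
  ultimately have "Re (iexp x - (\<Sum>k\<le>2. (\<i> * complex_of_real x) ^ k / fact k)) = cos x - (1 - x\<^sup>2 / 2)"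
    by (simp add: Re_exp)
  then have "cos x - (1 - x\<^sup>2 / 2) \<le> \<bar>x\<bar> ^ 3 / 6"
    using b complex_Re_le_cmod[of "iexp x - (\<Sum>k\<le>2. (\<i> * complex_of_real x) ^ k / fact k)"] by linarith
  moreover have "\<bar>x\<bar> ^ 3 \<le> x\<^sup>2 * (1 / 2)"
  proof -
    have "\<bar>x\<bar> ^ 3 = x\<^sup>2 * \<bar>x\<bar>" by (simp add: power3_eq_cube power2_eq_square abs_mult[symmetric])
    also have "\<dots> \<le> x\<^sup>2 * (1 / 2)" using assms by (intro mult_left_mono) auto
    finally show ?thesis .
  qed
  ultimately have "cos x \<le> 1 + (- (x\<^sup>2 / 3))" using zero_le_power2[of x] by linarith
  also have "\<dots> \<le> exp (- (x\<^sup>2 / 3))" by (rule exp_ge_add_one_self)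
  finally have le: "cos x \<le> exp (- (x\<^sup>2 / 3))" .
  have "0 \<le> cos x" using assms pi_gt3 by (intro cos_ge_zero) auto
  then have "cos x ^ (2 * m) \<le> exp (- (x\<^sup>2 / 3)) ^ (2 * m)" using le by (intro power_mono) auto
  also have "\<dots> = exp (- (2 * real m * x\<^sup>2 / 3))" by (simp add: exp_of_nat_mult[symmetric])
  finally show ?thesis .
qed

lemma binom_weight_central_ge: assumes "0 < m" shows "1 / (2 * real m) \<le> binom_weight m m"
proof -
  have "4 ^ m / (2 * real m) \<le> real ((2 * m) choose m)" using central_binomial_lower_bound[OF assms] by simp
  then show ?thesis using assms by (simp add: binom_weight_def field_simps)
qed

text \<open>The test function is the product of cos (S j / (2 * Q))^(2 * m), with values in [0, 1].
  While all |S j| \<le> Q the arguments stay below 1/2, so one coordinate outside radius r makes the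
  product small. Being periodic, it peaks again far away, which is why the event beyond Q is added.
  The frequencies involved are at most m / Q \<le> m.\<close>

lemma (in prob_space) small_ball:
  fixes S :: "'i \<Rightarrow> 'a \<Rightarrow> real"
  assumes J: "finite J" and meas: "\<And>j. j \<in> J \<Longrightarrow> S j \<in> borel_measurable M"
    and Q: "1 \<le> Q" and m: "0 < m" and r: "0 \<le> r" and \<delta>: "0 \<le> \<delta>"
    and char: "\<And>t. (\<And>j. j \<in> J \<Longrightarrow> \<bar>t j\<bar> \<le> real m) \<Longrightarrow> - \<delta> \<le> (LINT w|M. cos (\<Sum>j\<in>J. t j * S j w))"
  shows "(1 / (2 * real m)) ^ card J - \<delta> - exp (- (real m * r\<^sup>2 / (6 * Q\<^sup>2)))
     \<le> prob {w \<in> space M. \<forall>j\<in>J. \<bar>S j w\<bar> < r} + prob {w \<in> space M. \<exists>j\<in>J. Q < \<bar>S j w\<bar>}"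
proof -
  let ?G = "{w \<in> space M. \<forall>j\<in>J. \<bar>S j w\<bar> < r}" and ?H = "{w \<in> space M. \<exists>j\<in>J. Q < \<bar>S j w\<bar>}"
  have sets[measurable]: "?G \<in> sets M" "?H \<in> sets M"
  proof -
    have "{w \<in> space M. \<bar>S j w\<bar> < r} \<in> sets M" "{w \<in> space M. Q < \<bar>S j w\<bar>} \<in> sets M" if "j \<in> J" for j
      using meas[OF that] by measurable
    then show "?G \<in> sets M" "?H \<in> sets M"
      by (intro sets.sets_Collect_finite_All sets.sets_Collect_finite_Ex J; simp)+
  qed
  define f where "f = (\<lambda>w. \<Prod>j\<in>J. cos (1 / Q * S j w / 2) ^ (2 * m))"
  define E where "E = exp (- (real m * r\<^sup>2 / (6 * Q\<^sup>2)))"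
  have fac: "0 \<le> cos x ^ (2 * m)" "cos x ^ (2 * m) \<le> 1" for x :: real
  proof -
    show "0 \<le> cos x ^ (2 * m)" by (simp add: power_mult)
    have "(cos x)\<^sup>2 \<le> 1" by (simp add: abs_square_le_1)
    then show "cos x ^ (2 * m) \<le> 1" by (simp add: power_mult power_le_one)
  qed
  have f01: "0 \<le> f w" "f w \<le> 1" for w unfolding f_def using fac by (auto intro: prod_nonneg prod_le_1)
  have f_le: "f w \<le> indicator ?G w + indicator ?H w + E" if w: "w \<in> space M" for w
  proof (cases "w \<in> ?G \<or> w \<in> ?H")
    case True
    have "0 \<le> E" by (simp add: E_def)
    then show ?thesis using True f01[of w] by (auto simp: indicator_def)
  next
    case False
    then obtain j where j: "j \<in> J" "r \<le> \<bar>S j w\<bar>" "\<bar>S j w\<bar> \<le> Q" using w by force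
    define x where "x = 1 / Q * S j w / 2"
    have xQ: "\<bar>x\<bar> = \<bar>S j w\<bar> / (2 * Q)" using Q by (simp add: x_def abs_mult)
    have "\<bar>x\<bar> \<le> 1 / 2" unfolding xQ using j Q by (simp add: divide_le_eq)
    then have "cos x ^ (2 * m) \<le> exp (- (2 * real m * x\<^sup>2 / 3))" by (rule cos_power_le_exp)
    also have "\<dots> \<le> E"
    proof -
      have "r / (2 * Q) \<le> \<bar>x\<bar>" unfolding xQ using j Q by (intro divide_right_mono) auto
      then have "(r / (2 * Q))\<^sup>2 \<le> x\<^sup>2" using r Q power_mono[of "r / (2 * Q)" "\<bar>x\<bar>" 2] by simp
      then have "2 * real m * (r / (2 * Q))\<^sup>2 / 3 \<le> 2 * real m * x\<^sup>2 / 3" by (intro divide_right_mono mult_left_mono) auto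
      then show ?thesis by (simp add: E_def power_divide power_mult_distrib)
    qed
    finally have 1: "cos x ^ (2 * m) \<le> E" .
    have "f w = cos x ^ (2 * m) * (\<Prod>j\<in>J - {j}. cos (1 / Q * S j w / 2) ^ (2 * m))"
      unfolding f_def x_def using J j by (intro prod.remove) auto
    also have "\<dots> \<le> cos x ^ (2 * m) * 1"
      using fac by (intro mult_left_mono prod_le_1) auto
    finally show ?thesis using 1 by (simp add: indicator_def)
  qed
  have mf: "f \<in> borel_measurable M" unfolding f_def using meas by measurable
  have "(1 / (2 * real m)) ^ card J - \<delta> \<le> binom_weight m m ^ card J - \<delta>"
    using binom_weight_central_ge[OF m] by (intro diff_right_mono power_mono) auto
  also have "\<dots> \<le> (LINT w|M. f w)" unfolding f_def
  proof (rule expectation_cos_power_ge[OF J meas _ \<delta> char])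
    fix t :: "'i \<Rightarrow> real" and j assume t: "\<And>j. j \<in> J \<Longrightarrow> \<bar>t j\<bar> \<le> 1 / Q * real m" and j: "j \<in> J"
    have "1 / Q * real m \<le> 1 * real m" using Q by (intro mult_right_mono) auto
    then show "\<bar>t j\<bar> \<le> real m" using t[OF j] by simp
  qed (use Q in auto)
  also have "\<dots> \<le> (LINT w|M. indicator ?G w + indicator ?H w + E)"
  proof (rule integral_mono)
    show "integrable M f" by (rule integrable_const_bound[where B = 1]) (use f01 mf in auto)
    have "integrable M (indicator A :: 'a \<Rightarrow> real)" if "A \<in> sets M" for A
      using that by (intro integrable_real_indicator) (auto simp: emeasure_eq_measure)
    from this[OF sets(1)] this[OF sets(2)]
    show "integrable M (\<lambda>w. indicator ?G w + indicator ?H w + E)"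
      by (intro Bochner_Integration.integrable_add integrable_const)
  qed (use f_le in blast)
  also have "\<dots> = prob ?G + prob ?H + E"
  proof -
    have "integrable M (indicator A :: 'a \<Rightarrow> real)" if "A \<in> sets M" for A
      using that by (intro integrable_real_indicator) (auto simp: emeasure_eq_measure)
    note int = this[OF sets(1)] this[OF sets(2)]
    have "(LINT w|M. indicator ?G w + indicator ?H w + E)
      = (LINT w|M. indicator ?G w) + (LINT w|M. indicator ?H w) + (LINT w|M. E)"
      using int by (simp only: Bochner_Integration.integral_add Bochner_Integration.integrable_add integrable_const)
    also have "\<dots> = prob ?G + prob ?H + E"
    proof -
      have "(LINT w|M. indicator A w :: real) = prob A" if "A \<in> sets M" for A
        using sets.sets_into_space[OF that] by (simp add: Int_absorb2)
      then show ?thesis using sets by (simp only:) (simp add: prob_space)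
    qed
    finally show ?thesis .
  qed
  finally show ?thesis by (simp add: E_def)
qed

section \<open>Deviations of the product\<close>

context random_transfer_product begin

definition v2 :: "complex ^ 2" where "v2 = vector [0, 1]"

definition dev1 :: "'a \<Rightarrow> real" where
  "dev1 w = (cmod (Z v1 N w $ 1 - 1))\<^sup>2 + (cmod (Z v1 N w $ 2))\<^sup>2"
definition dev2 :: "'a \<Rightarrow> real" where
  "dev2 w = (cmod (Z v2 N w $ 1))\<^sup>2 + (cmod (Z v2 N w $ 2))\<^sup>2"

text \<open>For e \<le> 1 and a target of modulus at most 1, \<open>hx\<close> is at most 4 / e. The
  exponent p = tail_rate * L * e then gives p * hx \<le> 4 * tail_rate * L, exactly the admissible L
  / (1000000 * C^2).\<close>

definition tail_rate :: real where "tail_rate = 1 / (4000000 * C\<^sup>2)"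

lemma dev_measurable [measurable]: "dev1 \<in> borel_measurable M" "dev2 \<in> borel_measurable M"
proof -
  have [measurable]: "Z v N \<in> borel_measurable M" for v by (rule Z_measurable) simp
  show "dev1 \<in> borel_measurable M" "dev2 \<in> borel_measurable M"
    unfolding dev1_def dev2_def by measurable
qed

lemma tail_rate_pos: "0 < tail_rate" "tail_rate \<le> 1" "tail_rate * C \<le> 1 / 4000000"
proof -
  have "1 \<le> C\<^sup>2" "C \<le> C\<^sup>2" using C1 by (auto intro!: self_le_power)
  then show "0 < tail_rate" "tail_rate \<le> 1" "tail_rate * C \<le> 1 / 4000000" by (auto simp: tail_rate_def divide_le_eq)
qed

lemma tail_rate_L: "2 \<le> tail_rate * L"
proof -
  have "1 \<le> C\<^sup>2" using C1 by simp
  moreover from this have "2 * (4000000 * C\<^sup>2) \<le> L" using L_large by linarith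
  ultimately have "2 \<le> L / (4000000 * C\<^sup>2)" by (subst pos_le_divide_eq) auto
  then show ?thesis by (simp add: tail_rate_def)
qed

lemma dev1_tail:
  assumes e: "0 < e" "e \<le> 1" and p: "1 \<le> tail_rate * L * e" and a: "0 \<le> a"
  shows "prob {w \<in> space M. a \<le> dev1 w} \<le> (e / (e + a)) powr (tail_rate * L * e) * exp (tail_rate * L * e / 8 + C)"
proof -
  have L0: "0 < L" using L_ge by simp
  have "tail_rate * L * e * (2 * (cmod 1)\<^sup>2 / e + 2) = tail_rate * L * (2 + 2 * e)" using e by (simp add: field_simps)
  also have "\<dots> \<le> tail_rate * L * 4" using e tail_rate_pos L0 by (intro mult_left_mono) auto
  also have "\<dots> = L / (1000000 * C\<^sup>2)" by (simp add: tail_rate_def)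
  finally have hx: "tail_rate * L * e * (2 * (cmod 1)\<^sup>2 / e + 2) \<le> L / (1000000 * C\<^sup>2)" .
  have "lyap (tail_rate * L * e) e 1 N 0 v1 = e" by (simp add: lyap_def v1_def vector_2)
  with lyap_tail[OF p e(1) refl hx order.refl a, of v1] show ?thesis by (simp add: dev1_def)
qed

text \<open>The chain of the second column starts with y = 1, at distance N from the end. These
  bounds show that both parts of its initial Lyapunov weight are tiny; for the exponential x \<le>
  exp x suffices.\<close>

lemma om_div_s0: "om / s 0 \<le> L\<^sup>2 / om\<^sup>2" and W_0_le: "W N 0 \<le> om / (L * N)" and om_div_N: "om / N = L\<^sup>2 / om\<^sup>2"
proof -
  have L0: "0 < L" and om0: "0 < om" using L_ge L_le by auto
  show o: "om / N = L\<^sup>2 / om\<^sup>2" unfolding N_eq using L0 om0 by (simp add: field_simps power3_eq_cube power2_eq_square)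
  have "om / s 0 \<le> om / N" using om0 N_pos by (intro divide_left_mono) (auto simp: s_def)
  then show "om / s 0 \<le> L\<^sup>2 / om\<^sup>2" by (simp add: o)
  define x where "x = L / om * N"
  have x: "0 < x" using L0 om0 N_pos by (simp add: x_def)
  have "x \<le> exp x" using exp_ge_add_one_self[of x] by linarith
  then have "1 / exp x \<le> 1 / x" using x by (intro divide_left_mono) auto
  then show "W N 0 \<le> om / (L * N)" using om0 L0 by (simp add: W_def x_def exp_minus inverse_eq_divide)
qed

text \<open>The target is 0 and the initial Lyapunov value e + q instead of e. With p = tail_rate *
  L * e the excess factor (1 + q / e)^p is at most exp (tail_rate * L * q), where e has cancelled,
  hence at most exp 2.\<close>

lemma dev2_tail:
  assumes e: "0 < e" "e \<le> 1" and p: "1 \<le> tail_rate * L * e" and a: "0 \<le> a"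
  shows "prob {w \<in> space M. a \<le> dev2 w} \<le> (e / (e + a)) powr (tail_rate * L * e) * exp (tail_rate * L * e / 8 + (C + 2))"
proof -
  have L0: "1 \<le> L" and om0: "1 \<le> om" using L_ge L_le by auto
  define p' where "p' = tail_rate * L * e"
  have p0: "0 \<le> p'" using p by (simp add: p'_def)
  have pL: "p' \<le> tail_rate * L" using mult_left_mono[OF e(2), of "tail_rate * L"] tail_rate_pos L0 by (simp add: p'_def)
  have "p' * (2 * (cmod 0)\<^sup>2 / e + 2) = tail_rate * L * (2 * e)" by (simp add: p'_def)
  also have "\<dots> \<le> tail_rate * L * 4" using e tail_rate_pos L0 by (intro mult_left_mono) auto
  also have "\<dots> = L / (1000000 * C\<^sup>2)" by (simp add: tail_rate_def)
  finally have hx: "p' * (2 * (cmod 0)\<^sup>2 / e + 2) \<le> L / (1000000 * C\<^sup>2)" .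
  define q where "q = wt p' N 0"
  have sN: "0 < s 0" using s_pos[of 0] by simp
  have q0: "0 \<le> q" unfolding q_def wt_def W_def using C1 p0 L0 om0 sN
    by (intro add_nonneg_nonneg mult_nonneg_nonneg divide_nonneg_nonneg) auto
  have cq: "tail_rate * L * q \<le> 2"
  proof -
    have o1: "L * (om / s 0) \<le> 1"
    proof -
      have "L * (om / s 0) \<le> L * (L\<^sup>2 / om\<^sup>2)" using om_div_s0 L0 by (intro mult_left_mono) auto
      also have "\<dots> = L ^ 3 / om\<^sup>2" by (simp add: power3_eq_cube power2_eq_square)
      also have "\<dots> \<le> om / om\<^sup>2" using L3_le by (intro divide_right_mono) auto
      also have "\<dots> \<le> 1" using om0 by (simp add: power2_eq_square)
      finally show ?thesis .
    qed
    have "tail_rate * L * (5616 * C * p' / L * (om / s 0)) = 5616 * (tail_rate * C) * (p' * (om / s 0))" using L0 by simp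
    also have "\<dots> \<le> 5616 * (1 / 4000000) * (L * (om / s 0))"
    proof (intro mult_mono)
      show "p' \<le> L" using pL mult_right_mono[of tail_rate 1 L] tail_rate_pos L0 by linarith
    qed (use tail_rate_pos C1 p0 om0 sN L0 in auto)
    also have "\<dots> \<le> 1" using o1 by simp
    finally have 1: "tail_rate * L * (5616 * C * p' / L * (om / s 0)) \<le> 1" .
    have "tail_rate * L * W N 0 \<le> 1 * L * (om / (L * N))"
      using W_0_le tail_rate_pos L0 by (intro mult_mono) (auto simp: W_def)
    also have "\<dots> = om / N" using L0 by simp
    also have "\<dots> \<le> 1" using om_le_N om0 by (simp add: divide_le_eq)
    finally show ?thesis using 1 by (simp add: q_def wt_def distrib_left)
  qed
  have ly: "lyap p' e 0 N 0 v2 = e + q" by (simp add: lyap_def v2_def vector_2 q_def)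
  have "((e + q) / (e + a)) powr p' = (e / (e + a)) powr p' * ((e + q) / e) powr p'"
    using e a q0 by (subst powr_mult[symmetric]) auto
  also have "\<dots> \<le> (e / (e + a)) powr p' * exp 2"
  proof (intro mult_left_mono)
    have "((e + q) / e) powr p' \<le> exp (q / e) powr p'"
      using exp_ge_add_one_self[of "q / e"] e q0 p0 by (intro powr_mono2) (auto simp: add_divide_distrib)
    also have "\<dots> = exp (p' * (q / e))" by (simp add: powr_def)
    also have "p' * (q / e) = tail_rate * L * q" using e by (simp add: p'_def)
    finally show "((e + q) / e) powr p' \<le> exp 2" using cq by (simp add: order_trans)
  qed auto
  finally have "((e + q) / (e + a)) powr p' * exp (p' / 8 + C) \<le> (e / (e + a)) powr p' * exp 2 * exp (p' / 8 + C)"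
    by (intro mult_right_mono) auto
  also have "\<dots> = (e / (e + a)) powr p' * exp (p' / 8 + (C + 2))" by (simp add: exp_add[symmetric] mult.assoc add_ac)
  finally show ?thesis
    using lyap_tail[OF p[folded p'_def] e(1) refl hx order.refl a, of v2] unfolding ly by (simp add: dev2_def p'_def)
qed

text \<open>For the target 0, \<open>hx\<close> is 2 for every e, so p = 1 with e = 1 / L^2 is
  allowed. The squared second column is thus of order L^(-2), far below 1 / L, and only the first
  column needs the small-ball argument.\<close>

lemma dev2_small:
  assumes a: "0 < a"
  shows "prob {w \<in> space M. a \<le> dev2 w} \<le> 5618 * C * exp (1 + C) / (L\<^sup>2 * a)"
proof -
  have L0: "1 \<le> L" and om0: "1 \<le> om" using L_ge L_le by auto
  define e where "e = 1 / L\<^sup>2"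
  have e0: "0 < e" using L0 by (simp add: e_def)
  have "1 \<le> C\<^sup>2" using C1 by simp
  moreover from this have "2 * (1000000 * C\<^sup>2) \<le> L" using L_large by linarith
  ultimately have "2 \<le> L / (1000000 * C\<^sup>2)" by (subst pos_le_divide_eq) auto
  then have hx: "1 * (2 * (cmod 0)\<^sup>2 / e + 2) \<le> L / (1000000 * C\<^sup>2)" by simp
  have sN: "0 < s 0" using s_pos[of 0] by simp
  have oL: "L\<^sup>2 / om\<^sup>2 \<le> 1 / L"
  proof -
    have "L ^ 3 \<le> om * om" using L3_le om0 mult_left_mono[of 1 om om] by linarith
    then show ?thesis using L0 om0 by (simp add: field_simps power3_eq_cube power2_eq_square)
  qed
  have "5616 * C * 1 / L * (om / s 0) \<le> 5616 * C * 1 / L * (1 / L)"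
    using om_div_s0 oL C1 L0 by (intro mult_left_mono) auto
  moreover have "W N 0 \<le> 1 / L\<^sup>2"
  proof -
    have "W N 0 \<le> 1 / L * (om / N)" using W_0_le by simp
    also have "\<dots> \<le> 1 / L * (1 / L)" unfolding om_div_N using oL L0 by (intro mult_left_mono) auto
    finally show ?thesis by (simp add: power2_eq_square)
  qed
  ultimately have "e + wt 1 N 0 \<le> (2 + 5616 * C) / L\<^sup>2"
    by (simp add: wt_def e_def add_divide_distrib power2_eq_square)
  also have "\<dots> \<le> 5618 * C / L\<^sup>2" using C1 by (intro divide_right_mono) auto
  finally have ly: "lyap 1 e 0 N 0 v2 \<le> 5618 * C / L\<^sup>2" by (simp add: lyap_def v2_def vector_2)
  have w0: "0 \<le> wt 1 N 0" unfolding wt_def W_def using C1 L0 om0 sN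
    by (intro add_nonneg_nonneg mult_nonneg_nonneg divide_nonneg_nonneg) auto
  have ly0: "0 \<le> lyap 1 e 0 N 0 v2" using e0 w0 by (simp add: lyap_def)
  have "prob {w \<in> space M. a \<le> dev2 w} \<le> (lyap 1 e 0 N 0 v2 / (e + a)) powr 1 * exp (1 / 8 + C)"
    using lyap_tail[OF order.refl e0 refl hx order.refl less_imp_le[OF a], of v2] by (simp add: dev2_def)
  also have "\<dots> = lyap 1 e 0 N 0 v2 / (e + a) * exp (1 / 8 + C)" using ly0 e0 a by simp
  also have "\<dots> \<le> (5618 * C / L\<^sup>2) / a * exp (1 + C)"
    using ly ly0 e0 a C1 by (intro mult_mono frac_le) auto
  finally show ?thesis by (simp add: mult_ac)
qed

definition char_error :: "real \<Rightarrow> real" where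
  "char_error T = 201000 * (C\<^sup>2 * T ^ 4) * (floor_const\<^sup>2 * exp (1 / 4 + C)) *
       (18 * C * (1 / sqrt L + sqrt (R * L / om) * sqrt L) + sqrt (R * L / om) * ln N + 2 * L\<^sup>2 / om)"

text \<open>Applies \<open>small_ball\<close> to the four real coordinates of the deviation times
  sqrt L. Radius 1/4 is right since 4 * (1/16) = 1/4, and it yields 96 = 6 * 16. Real frequencies up
  to m combine to complex ones of modulus at most 2 * m * sqrt L, hence T = 2 * m.\<close>

lemma dev1_small_ball:
  assumes m: "0 < m" and Q: "1 \<le> Q"
  shows "(1 / (2 * real m)) ^ 4 - char_error (2 * real m) - exp (- (real m / (96 * Q\<^sup>2)))
     \<le> prob {w \<in> space M. dev1 w < 1 / (4 * L)} + prob {w \<in> space M. Q\<^sup>2 / L \<le> dev1 w}"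
proof -
  have L0: "0 < L" and om0: "0 < om" using L_ge L_le by auto
  have [measurable]: "Z v1 N \<in> borel_measurable M" by (rule Z_measurable) simp
  define l where "l = sqrt L"
  have l: "0 < l" "l * l = L" using L0 by (auto simp: l_def)
  define X Y where "X = (\<lambda>w. Z v1 N w $ 1 - 1)" and "Y = (\<lambda>w. Z v1 N w $ 2)"
  have [measurable]: "X \<in> borel_measurable M" "Y \<in> borel_measurable M" unfolding X_def Y_def by measurable
  define S where "S = (\<lambda>(j::nat) w. l * (if j = 0 then Re (X w) else if j = 1 then Im (X w) else if j = 2 then Re (Y w) else Im (Y w)))"
  let ?J = "{0, 1, 2, 3 :: nat}"
  have dev: "(\<Sum>j\<in>?J. (S j w)\<^sup>2) = L * dev1 w" for w
  proof -
    have "dev1 w = (cmod (X w))\<^sup>2 + (cmod (Y w))\<^sup>2" by (simp only: dev1_def X_def Y_def)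
    then show ?thesis unfolding cmod_power2
      by (simp add: S_def power_mult_distrib power2_eq_square[of l] l algebra_simps)
  qed
  have ce0: "0 \<le> char_error (2 * real m)"
  proof -
    have "0 \<le> ln (real N)" using N_pos by simp
    then show ?thesis unfolding char_error_def using C1 R1 L0 om0
      by (intro mult_nonneg_nonneg add_nonneg_nonneg divide_nonneg_nonneg) auto
  qed
  have "(1 / (2 * real m)) ^ card ?J - char_error (2 * real m) - exp (- (real m * (1 / 4)\<^sup>2 / (6 * Q\<^sup>2)))
     \<le> prob {w \<in> space M. \<forall>j\<in>?J. \<bar>S j w\<bar> < 1 / 4} + prob {w \<in> space M. \<exists>j\<in>?J. Q < \<bar>S j w\<bar>}"
  proof (rule small_ball[OF _ _ Q m _ ce0])
    fix t :: "nat \<Rightarrow> real" assume t: "\<And>j. j \<in> ?J \<Longrightarrow> \<bar>t j\<bar> \<le> real m"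
    \<comment> \<open>The conjugate sign turns Re (b * X) into t 0 * Re X + t 1 * Im X, up to the
      factor sqrt L.\<close>
    define b a where "b = complex_of_real l * Complex (t 0) (- t 1)" and "a = complex_of_real l * Complex (t 2) (- t 3)"
    have cm: "cmod (complex_of_real l * Complex u (- v)) \<le> 2 * real m * sqrt L"
      if "\<bar>u\<bar> \<le> real m" "\<bar>v\<bar> \<le> real m" for u v
    proof -
      have "cmod (Complex u (- v)) \<le> \<bar>u\<bar> + \<bar>v\<bar>" using cmod_le[of "Complex u (- v)"] by simp
      also have "\<dots> \<le> 2 * real m" using that by simp
      finally have "l * cmod (Complex u (- v)) \<le> l * (2 * real m)" using l by (intro mult_left_mono) auto
      then show ?thesis using l by (simp add: norm_mult l_def mult_ac)
    qed
    have "cmod b \<le> 2 * real m * sqrt L" "cmod a \<le> 2 * real m * sqrt L"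
      unfolding b_def a_def using t by (auto intro!: cm)
    then have "- char_error (2 * real m) \<le> (LINT w|M. cos (Re (b * (Z v1 N w $ 1 - 1) + a * Z v1 N w $ 2)))"
      unfolding char_error_def using m by (intro Re_characteristic_lower_bound) auto
    also have "(\<lambda>w. cos (Re (b * (Z v1 N w $ 1 - 1) + a * Z v1 N w $ 2))) = (\<lambda>w. cos (\<Sum>j\<in>?J. t j * S j w))"
    proof
      fix w
      have "Re (b * X w + a * Y w) = (\<Sum>j\<in>?J. t j * S j w)"
        by (simp add: a_def b_def S_def algebra_simps)
      then show "cos (Re (b * (Z v1 N w $ 1 - 1) + a * Z v1 N w $ 2)) = cos (\<Sum>j\<in>?J. t j * S j w)"
        by (simp only: X_def Y_def)
    qed
    finally show "- char_error (2 * real m) \<le> (LINT w|M. cos (\<Sum>j\<in>?J. t j * S j w))" .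
  next
    fix j show "S j \<in> borel_measurable M" unfolding S_def by (cases "j = 0"; cases "j = 1"; cases "j = 2"; simp)
  qed auto
  also have "prob {w \<in> space M. \<forall>j\<in>?J. \<bar>S j w\<bar> < 1 / 4} \<le> prob {w \<in> space M. dev1 w < 1 / (4 * L)}"
  proof (rule finite_measure_mono)
    show "{w \<in> space M. \<forall>j\<in>?J. \<bar>S j w\<bar> < 1 / 4} \<subseteq> {w \<in> space M. dev1 w < 1 / (4 * L)}"
    proof safe
      fix w assume *: "\<forall>j\<in>?J. \<bar>S j w\<bar> < 1 / 4"
      have "(S j w)\<^sup>2 < 1 / 16" if "j \<in> ?J" for j
      proof -
        have "\<bar>S j w\<bar> < 1 / 4" using * that by blast
        then have "\<bar>S j w\<bar>\<^sup>2 < (1 / 4)\<^sup>2" by (intro power_strict_mono) auto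
        then show ?thesis by (simp add: power2_eq_square)
      qed
      from this[of 0] this[of 1] this[of 2] this[of 3] dev[of w] have "L * dev1 w < 1 / 4" by simp
      then show "dev1 w < 1 / (4 * L)" using L0 by (simp add: field_simps)
    qed
  qed measurable
  also have "prob {w \<in> space M. \<exists>j\<in>?J. Q < \<bar>S j w\<bar>} \<le> prob {w \<in> space M. Q\<^sup>2 / L \<le> dev1 w}"
  proof (rule finite_measure_mono)
    show "{w \<in> space M. \<exists>j\<in>?J. Q < \<bar>S j w\<bar>} \<subseteq> {w \<in> space M. Q\<^sup>2 / L \<le> dev1 w}"
    proof (intro subsetI)
      fix w assume "w \<in> {w \<in> space M. \<exists>j\<in>?J. Q < \<bar>S j w\<bar>}"
      then obtain j where w: "w \<in> space M" and j: "j \<in> ?J" "Q < \<bar>S j w\<bar>" by blast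
      have "Q\<^sup>2 \<le> \<bar>S j w\<bar>\<^sup>2" using j Q by (intro power_mono) auto
      also have "\<dots> \<le> (\<Sum>j\<in>?J. (S j w)\<^sup>2)" using j(1) by (subst power2_abs) (rule member_le_sum; simp)
      finally have "Q\<^sup>2 \<le> L * dev1 w" by (simp only: dev)
      then show "w \<in> {w \<in> space M. Q\<^sup>2 / L \<le> dev1 w}" using w L0 by (simp add: field_simps)
    qed
  qed measurable
  finally have "(1 / (2 * real m)) ^ card ?J - char_error (2 * real m) - exp (- (real m * (1 / 4)\<^sup>2 / (6 * Q\<^sup>2)))
     \<le> prob {w \<in> space M. dev1 w < 1 / (4 * L)} + prob {w \<in> space M. Q\<^sup>2 / L \<le> dev1 w}"
    by simp
  moreover have "card ?J = 4" by simp
  moreover have "real m * (1 / 4)\<^sup>2 / (6 * Q\<^sup>2) = real m / (96 * Q\<^sup>2)" by (simp add: power_divide)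
  ultimately show ?thesis by (simp only:)
qed

lemma op_norm_event:
  assumes \<epsilon>: "0 < \<epsilon>"
  shows "measure M {w \<in> space M. op_norm (mat_prod (\<lambda>k. U k w) N - vector [vector [1, 0], vector [0, 0]]) \<ge> \<epsilon>}
     \<le> prob {w \<in> space M. \<epsilon>\<^sup>2 / 4 \<le> dev1 w} + prob {w \<in> space M. \<epsilon>\<^sup>2 / 4 \<le> dev2 w}"
proof -
  let ?E = "{w \<in> space M. op_norm (mat_prod (\<lambda>k. U k w) N - vector [vector [1, 0], vector [0, 0]]) \<ge> \<epsilon>}"
  let ?A = "{w \<in> space M. \<epsilon>\<^sup>2 / 4 \<le> dev1 w}" and ?B = "{w \<in> space M. \<epsilon>\<^sup>2 / 4 \<le> dev2 w}"
  have "?E \<subseteq> ?A \<union> ?B"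
  proof
    fix w assume w: "w \<in> ?E"
    define P where "P = mat_prod (\<lambda>k. U k w) N - vector [vector [1, 0], vector [0, 0 :: complex]]"
    have n1: "(norm (P *v vector [1, 0]))\<^sup>2 = dev1 w"
    proof -
      have "P *v vector [1, 0] = Z v1 N w - vector [1, 0]"
        by (simp add: P_def Z_def v1_def matrix_vector_mult_diff_rdistrib)
          (simp add: matrix_vector_mult_def sum_2 vector_2 vec_eq_iff forall_2)
      then show ?thesis by (simp add: norm_cvec2_sq dev1_def vector_2)
    qed
    have n2: "(norm (P *v vector [0, 1]))\<^sup>2 = dev2 w"
    proof -
      have "P *v vector [0, 1] = Z v2 N w"
        by (simp add: P_def Z_def v2_def matrix_vector_mult_diff_rdistrib)
          (simp add: matrix_vector_mult_def sum_2 vector_2 vec_eq_iff forall_2)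
      then show ?thesis by (simp add: norm_cvec2_sq dev2_def)
    qed
    have "\<epsilon> \<le> norm (P *v vector [1, 0]) + norm (P *v vector [0, 1])"
      using w op_norm_le_column_norms[of P] by (simp add: P_def)
    then consider "\<epsilon> / 2 \<le> norm (P *v vector [1, 0])" | "\<epsilon> / 2 \<le> norm (P *v vector [0, 1])" by linarith
    then show "w \<in> ?A \<union> ?B"
    proof cases
      case 1
      then have "(\<epsilon> / 2)\<^sup>2 \<le> dev1 w" unfolding n1[symmetric] using \<epsilon> by (intro power_mono) auto
      then show ?thesis using w by (simp add: power_divide)
    next
      case 2
      then have "(\<epsilon> / 2)\<^sup>2 \<le> dev2 w" unfolding n2[symmetric] using \<epsilon> by (intro power_mono) auto
      then show ?thesis using w by (simp add: power_divide)
    qed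
  qed
  then have "measure M ?E \<le> prob (?A \<union> ?B)" by (rule finite_measure_mono) measurable
  also have "\<dots> \<le> prob ?A + prob ?B" by (rule measure_Un_le) measurable
  finally show ?thesis .
qed

section \<open>Tail bounds for large, moderate and small \<epsilon>\<close>

abbreviation deviation_prob :: "real \<Rightarrow> real" where
  "deviation_prob \<epsilon> \<equiv> measure M {w \<in> space M.
     op_norm (mat_prod (\<lambda>k. U k w) N - vector [vector [1, 0], vector [0, 0]]) \<ge> \<epsilon>}"

lemma prob_antimono:
  assumes "f \<in> borel_measurable M" "a \<le> b"
  shows "prob {w \<in> space M. b \<le> (f w :: real)} \<le> prob {w \<in> space M. a \<le> f w}"
proof (rule finite_measure_mono)
  show "{w \<in> space M. a \<le> f w} \<in> sets M" using assms(1) by measurable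
qed (use assms(2) in auto)

text \<open>Markov's factor 2^(-p) against the accumulated growth exp (p / 8): ln 2 \<ge> 2/3 and
  2/3 - 1/8 > 1/2.\<close>

lemma half_powr_le: assumes "0 \<le> p" shows "(1 / 2 :: real) powr p * exp (p / 8 + c) \<le> exp (c - p / 2)"
proof -
  have "2 / 3 * p \<le> ln 2 * p" using ln2_ge_two_thirds assms by (intro mult_right_mono) auto
  moreover have "p * ln (1 / 2) = - (ln 2 * p)" by (simp add: ln_div)
  ultimately have "p * ln (1 / 2) + (p / 8 + c) \<le> c - p / 2" using assms by linarith
  then show ?thesis by (simp add: powr_def exp_add[symmetric])
qed

lemma deviation_prob_moderate:
  assumes e: "0 < e" "e \<le> 1" "1 \<le> tail_rate * L * e" "e \<le> \<epsilon>\<^sup>2 / 4" and \<epsilon>: "0 < \<epsilon>"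
  shows "deviation_prob \<epsilon> \<le> 2 * exp (C + 2 - tail_rate * L * e / 2)"
proof -
  have half: "e / (e + e) = 1 / 2" using e by simp
  have p0: "0 \<le> tail_rate * L * e" using e by simp
  have "prob {w \<in> space M. \<epsilon>\<^sup>2 / 4 \<le> dev1 w} \<le> prob {w \<in> space M. e \<le> dev1 w}"
    by (rule prob_antimono[OF _ e(4)]) measurable
  also have "\<dots> \<le> exp (C - tail_rate * L * e / 2)"
    using dev1_tail[OF e(1-3), of e] half_powr_le[OF p0, of C] e unfolding half by linarith
  also have "\<dots> \<le> exp (C + 2 - tail_rate * L * e / 2)" by simp
  finally have 1: "prob {w \<in> space M. \<epsilon>\<^sup>2 / 4 \<le> dev1 w} \<le> exp (C + 2 - tail_rate * L * e / 2)" .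
  have "prob {w \<in> space M. \<epsilon>\<^sup>2 / 4 \<le> dev2 w} \<le> prob {w \<in> space M. e \<le> dev2 w}"
    by (rule prob_antimono[OF _ e(4)]) measurable
  also have "\<dots> \<le> exp (C + 2 - tail_rate * L * e / 2)"
    using dev2_tail[OF e(1-3), of e] half_powr_le[OF p0, of "C + 2"] e unfolding half by linarith
  finally show ?thesis using 1 op_norm_event[OF \<epsilon>] by linarith
qed

text \<open>With e = 1 the tail is (1 + a)^(- tail_rate * L), polynomial in \<epsilon>. Once ln (1 +
  a) \<ge> R / tail_rate + 1 it beats exp (- R * L); the summand 1 pays for the growth factor exp
  (tail_rate * L / 8).\<close>

lemma deviation_prob_large:
  assumes \<epsilon>: "0 < \<epsilon>" "exp (R / tail_rate + 1) \<le> \<epsilon>\<^sup>2 / 4"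
  shows "deviation_prob \<epsilon> \<le> 2 * exp (C + 2 - R * L)"
proof -
  define a where "a = \<epsilon>\<^sup>2 / 4"
  have a: "0 < a" using \<epsilon> by (simp add: a_def)
  have L0: "0 < L" using L_ge by simp
  have c1: "1 \<le> tail_rate * L * 1" using tail_rate_L by simp
  have "R / tail_rate + 1 = ln (exp (R / tail_rate + 1))" by simp
  also have "\<dots> \<le> ln (1 + a)" using \<epsilon> by (intro ln_mono) (auto simp: a_def add_pos_pos)
  finally have "tail_rate * L * (R / tail_rate + 1) \<le> tail_rate * L * ln (1 + a)" using tail_rate_pos L0 by (intro mult_left_mono) auto
  moreover have "tail_rate * L * (R / tail_rate + 1) = R * L + tail_rate * L" using tail_rate_pos by (simp add: distrib_left)
  ultimately have "R * L + tail_rate * L \<le> tail_rate * L * ln (1 + a)" by linarith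
  moreover have "0 < tail_rate * L" using tail_rate_pos L0 by simp
  ultimately have "tail_rate * L * ln (1 / (1 + a)) + (tail_rate * L / 8 + (C + 2)) \<le> C + 2 - R * L" using a by (simp add: ln_div)
  then have "(1 / (1 + a)) powr (tail_rate * L) * exp (tail_rate * L / 8 + (C + 2)) \<le> exp (C + 2 - R * L)"
    using a by (simp add: powr_def exp_add[symmetric])
  moreover have "(1 / (1 + a)) powr (tail_rate * L) * exp (tail_rate * L / 8 + C) \<le> (1 / (1 + a)) powr (tail_rate * L) * exp (tail_rate * L / 8 + (C + 2))"
    by (intro mult_left_mono) auto
  ultimately show ?thesis
    using dev1_tail[of 1 a] dev2_tail[of 1 a] c1 a op_norm_event[OF \<epsilon>(1)] by (simp add: a_def)
qed

text \<open>The cutoff Q^2 = sqrt m balances the two losses: the cosine bound exp (- m / (96 * Q^2))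
  and the tail beyond Q are both exponentially small in sqrt m, whereas the gain is only a power
  m^(-4).\<close>

lemma deviation_prob_small:
  assumes \<epsilon>: "0 < \<epsilon>" "1 \<le> \<epsilon>\<^sup>2 * L" and m: "0 < m" "sqrt (real m) \<le> L" "1 \<le> tail_rate * sqrt (real m)"
  shows "deviation_prob \<epsilon> \<le> 1 - ((1 / (2 * real m)) ^ 4 - char_error (2 * real m) - exp (- (sqrt (real m) / 96))
      - exp (C - tail_rate * sqrt (real m) / 2)) + 22472 * C * exp (1 + C) / L"
proof -
  have L0: "0 < L" using L_ge by simp
  have a: "1 / (4 * L) \<le> \<epsilon>\<^sup>2 / 4" using \<epsilon> L0 by (simp add: field_simps)
  define Q where "Q = sqrt (sqrt (real m))"
  have Q: "1 \<le> Q" "Q\<^sup>2 = sqrt (real m)" using m by (auto simp: Q_def)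
  have e: "0 < Q\<^sup>2 / L" "Q\<^sup>2 / L \<le> 1" "1 \<le> tail_rate * L * (Q\<^sup>2 / L)" using m L0 by (auto simp: Q)
  have half: "Q\<^sup>2 / L / (Q\<^sup>2 / L + Q\<^sup>2 / L) = 1 / 2"
  proof -
    have "z / (z + z) = 1 / 2" if "0 < z" for z :: real using that by simp
    then show ?thesis using e(1) by blast
  qed
  have "tail_rate * L * (Q\<^sup>2 / L) = tail_rate * sqrt (real m)" using L0 by (simp add: Q)
  then have t: "prob {w \<in> space M. Q\<^sup>2 / L \<le> dev1 w} \<le> exp (C - tail_rate * sqrt (real m) / 2)"
    using dev1_tail[OF e, of "Q\<^sup>2 / L"] half_powr_le[of "tail_rate * L * (Q\<^sup>2 / L)" C] e unfolding half by (simp only:) linarith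
  have "real m / (96 * Q\<^sup>2) = sqrt (real m) / 96"
    using m real_sqrt_mult_self[of "real m"] by (simp add: Q field_simps)
  then have sb: "(1 / (2 * real m)) ^ 4 - char_error (2 * real m) - exp (- (sqrt (real m) / 96))
     \<le> prob {w \<in> space M. dev1 w < 1 / (4 * L)} + prob {w \<in> space M. Q\<^sup>2 / L \<le> dev1 w}"
    using dev1_small_ball[OF m(1) Q(1)] by (simp only:)
  have "{w \<in> space M. 1 / (4 * L) \<le> dev1 w} = space M - {w \<in> space M. dev1 w < 1 / (4 * L)}" by auto
  then have comp: "prob {w \<in> space M. 1 / (4 * L) \<le> dev1 w} = 1 - prob {w \<in> space M. dev1 w < 1 / (4 * L)}"
    by (simp add: prob_compl)
  have d1: "prob {w \<in> space M. \<epsilon>\<^sup>2 / 4 \<le> dev1 w} \<le> prob {w \<in> space M. 1 / (4 * L) \<le> dev1 w}"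
    by (rule prob_antimono[OF _ a]) measurable
  have "prob {w \<in> space M. \<epsilon>\<^sup>2 / 4 \<le> dev2 w} \<le> prob {w \<in> space M. 1 / (4 * L) \<le> dev2 w}"
    by (rule prob_antimono[OF _ a]) measurable
  also have "\<dots> \<le> 5618 * C * exp (1 + C) / (L\<^sup>2 * (1 / (4 * L)))" using L0 by (intro dev2_small) auto
  also have "\<dots> = 22472 * C * exp (1 + C) / L" using L0 by (simp add: power2_eq_square)
  finally have d2: "prob {w \<in> space M. \<epsilon>\<^sup>2 / 4 \<le> dev2 w} \<le> 22472 * C * exp (1 + C) / L" .
  show ?thesis using op_norm_event[OF \<epsilon>(1)] d1 d2 comp sb t by linarith
qed

text \<open>Expresses the error through one small number \<nu> with L^3 / om \<le> \<nu>^2; the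
  theorem takes \<nu> = N^(-4/45), small enough to beat the logarithm.\<close>

lemma char_error_le:
  assumes \<nu>: "0 \<le> \<nu>" "L ^ 3 \<le> \<nu>\<^sup>2 * om"
  shows "char_error T \<le> 201000 * (C\<^sup>2 * T ^ 4) * (floor_const\<^sup>2 * exp (1 / 4 + C)) *
       (18 * C * (1 / sqrt L + sqrt R * \<nu>) + sqrt R * \<nu> * ln N + 2 * \<nu>\<^sup>2)"
proof -
  have L0: "1 \<le> L" and om0: "0 < om" using L_ge L_le by auto
  have n2: "L ^ 3 / om \<le> \<nu>\<^sup>2" using \<nu> om0 by (simp add: divide_le_eq)
  have "L\<^sup>2 / om \<le> L ^ 3 / om" using L_le om0 by (intro divide_right_mono) auto
  then have 1: "L\<^sup>2 / om \<le> \<nu>\<^sup>2" using n2 by simp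
  have 2: "sqrt (R * L / om) * sqrt L \<le> sqrt R * \<nu>"
  proof -
    have "sqrt (R * L / om) * sqrt L = sqrt R * sqrt (L\<^sup>2 / om)"
      by (simp add: real_sqrt_mult[symmetric] real_sqrt_divide[symmetric] power2_eq_square)
    also have "\<dots> \<le> sqrt R * sqrt (\<nu>\<^sup>2)" using 1 R1 by (intro mult_left_mono real_sqrt_le_mono) auto
    finally show ?thesis using \<nu> by simp
  qed
  have 3: "sqrt (R * L / om) \<le> sqrt R * \<nu>"
  proof -
    have "sqrt (R * L / om) * 1 \<le> sqrt (R * L / om) * sqrt L"
      using L0 om0 R1 by (intro mult_left_mono) auto
    then show ?thesis using 2 by simp
  qed
  have lnN: "0 \<le> ln (real N)" using N_pos by simp
  have 4: "18 * C * (1 / sqrt L + sqrt (R * L / om) * sqrt L) \<le> 18 * C * (1 / sqrt L + sqrt R * \<nu>)"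
    using 2 C1 by (intro mult_left_mono add_left_mono) auto
  have 5: "sqrt (R * L / om) * ln N \<le> sqrt R * \<nu> * ln N" using 3 lnN by (rule mult_right_mono)
  have 6: "2 * L\<^sup>2 / om \<le> 2 * \<nu>\<^sup>2" using 1 by simp
  have "18 * C * (1 / sqrt L + sqrt (R * L / om) * sqrt L) + sqrt (R * L / om) * ln N + 2 * L\<^sup>2 / om
      \<le> 18 * C * (1 / sqrt L + sqrt R * \<nu>) + sqrt R * \<nu> * ln N + 2 * \<nu>\<^sup>2"
    using 4 5 6 by linarith
  then show ?thesis unfolding char_error_def using C1 by (intro mult_left_mono) auto
qed

end

section \<open>Choice of the constants and combination of the regimes\<close>

theorem theorem3p5:
  fixes R C :: real
  assumes "R > 0" and "C > 0"
  shows "\<exists>c\<^sub>R>0. \<forall>\<Omega> :: nat \<Rightarrow> real.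
    (\<forall>N. \<Omega> N > 0) \<longrightarrow>
    \<Omega> \<in> o(\<lambda>N. real N powr (1/15) / ln (real N)) \<longrightarrow>
    (\<exists>N\<^sub>0. \<forall>N\<ge>N\<^sub>0. \<forall>c\<^sub>0>1.
      \<forall>(M :: 'a measure) (\<rho> :: nat \<Rightarrow> complex) (\<eta> :: nat \<Rightarrow> 2 \<Rightarrow> 2 \<Rightarrow> 'a \<Rightarrow> complex).
        prob_space M \<longrightarrow>
        (\<forall>k\<in>{1..N}. cmod (\<rho> k)
            \<le> exp (- c\<^sub>0 * sqrt ((omega N (\<Omega> N) + (real N - real k)) / real N))) \<longrightarrow>
        (\<forall>k\<in>{1..N}. \<forall>i j.
            \<eta> k i j \<in> borel_measurable M
          \<and> cmod (LINT w|M. \<eta> k i j w) \<le> C / (omega N (\<Omega> N) + (real N - real k))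
          \<and> complex_variance M (\<eta> k i j) \<le> C / (omega N (\<Omega> N) + (real N - real k))
          \<and> (AE w in M. cmod (\<eta> k i j w)
               \<le> sqrt (R * \<Omega> N * ln (real N) / (omega N (\<Omega> N) + (real N - real k))))) \<longrightarrow>
        prob_space.indep_vars M (\<lambda>_. borel)
          (\<lambda>k w. transfer_matrix (\<rho> k) (\<lambda>i j. \<eta> k i j w)) {1..N} \<longrightarrow>
        (\<forall>\<epsilon> \<ge> (\<Omega> N * ln (real N)) powr (-1/2).
          measure M {w \<in> space M.
              op_norm (mat_prod (\<lambda>k. transfer_matrix (\<rho> k) (\<lambda>i j. \<eta> k i j w)) N
                       - vector [vector [1, 0], vector [0, 0]]) \<ge> \<epsilon>}
            \<le> real N powr (- c\<^sub>R * \<epsilon>\<^sup>2 * \<Omega> N)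
               + inverse c\<^sub>R * real N powr (4 - R * \<Omega> N)))"
proof -
  define C' R' where "C' = max C 1" and "R' = max R 1"
  have C': "1 \<le> C'" "C \<le> C'" and R': "1 \<le> R'" "R \<le> R'" "0 < R'" by (auto simp: C'_def R'_def)
  define c where "c = 1 / (4000000 * C'\<^sup>2)"
  have c0: "0 < c" using C' by (simp add: c_def)
  have "\<forall>\<^sub>F m in at_top. exp (C' - c * sqrt (real m) / 2) \<le> (1 / (2 * real m)) ^ 4 / 4"
    using c0 by real_asymp
  moreover have "\<forall>\<^sub>F m in at_top. exp (- (sqrt (real m) / 96)) \<le> (1 / (2 * real m)) ^ 4 / 4"
    by real_asymp
  moreover have "\<forall>\<^sub>F m in at_top. 1 \<le> c * sqrt (real m)" using c0 by real_asymp
  moreover have "\<forall>\<^sub>F m in at_top. (0::nat) < m" by (rule eventually_gt_at_top)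
  ultimately have "\<forall>\<^sub>F m in at_top. exp (C' - c * sqrt (real m) / 2) \<le> (1 / (2 * real m)) ^ 4 / 4 \<and>
      exp (- (sqrt (real m) / 96)) \<le> (1 / (2 * real m)) ^ 4 / 4 \<and> 1 \<le> c * sqrt (real m) \<and> 0 < m"
    by eventually_elim blast
  \<comment> \<open>m depends only on C, so the probability gained by the small-ball argument is
    bounded below uniformly in N and \<Omega>.\<close>
  then obtain m :: nat where m: "exp (C' - c * sqrt (real m) / 2) \<le> (1 / (2 * real m)) ^ 4 / 4"
      "exp (- (sqrt (real m) / 96)) \<le> (1 / (2 * real m)) ^ 4 / 4" "1 \<le> c * sqrt (real m)" "0 < m"
    by (auto dest: eventually_happens)
  define \<kappa> where "\<kappa> = (1 / (2 * real m)) ^ 4"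
  have \<kappa>0: "0 < \<kappa>" using m by (simp add: \<kappa>_def)
  \<comment> \<open>Threshold for \<epsilon>^2 at which \<open>deviation_prob_large\<close> takes
    over.\<close>
  define M2 where "M2 = 4 * exp (R' / c + 1)"
  have M2: "4 \<le> M2" using c0 R' by (simp add: M2_def)
  \<comment> \<open>Threshold for \<epsilon>^2 * L above which, with e = \<epsilon>^2 / M2, the
    exponent c * L * e is at least 4 * (C' + 3): half of the decay c * L * e / 2 then absorbs the
    prefactor 2 * exp (C' + 2).\<close>
  define K0 where "K0 = 4 * M2 * (C' + 3) / c"
  have K0: "0 < K0" using M2 C' c0 by (simp add: K0_def)
  \<comment> \<open>One entry per regime: the decay left over for moderate \<epsilon>, the gain
    \<kappa> / 4 spread over \<epsilon>^2 * L < K0, and the prefactor for large \<epsilon>, which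
    goes into the inverse constant of the second term.\<close>
  define cR where "cR = min (c / (4 * M2)) (min (\<kappa> / (4 * K0)) (exp (- (C' + 2)) / 2))"
  have cR0: "0 < cR" using c0 M2 \<kappa>0 K0 by (simp add: cR_def)
  have cR: "cR \<le> c / (4 * M2)" "cR \<le> \<kappa> / (4 * K0)" "cR \<le> exp (- (C' + 2)) / 2" by (auto simp: cR_def)
  have cR_inv: "2 * exp (C' + 2) \<le> inverse cR"
  proof -
    have "inverse (exp (- (C' + 2)) / 2) \<le> inverse cR" using cR(3) cR0 by (intro le_imp_inverse_le) auto
    moreover have "inverse (exp (- x) / 2) = 2 * exp x" for x :: real
      by (rule inverse_unique) (simp add: exp_minus)
    ultimately show ?thesis by (simp only:)
  qed
  have cR_inv1: "1 \<le> inverse cR"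
  proof -
    have "1 \<le> exp (C' + 2)" using C' by simp
    then show ?thesis using cR_inv by linarith
  qed
  define A where "A = 201000 * (C'\<^sup>2 * (2 * real m) ^ 4) * ((8000000 * C'\<^sup>2)\<^sup>2 * exp (1 / 4 + C'))"
  define err where "err = (\<lambda>N. A * (18 * C' * (sqrt (R' / 4) * (1 / sqrt (ln (real N))) + sqrt R' * (real N powr (-4/45)))
     + sqrt R' * (real N powr (-4/45) * ln (real N)) + 2 * (real N powr (-8/45)))
     + 22472 * C' * exp (1 + C') * (R' / 4) * (1 / ln (real N)))"
  have A0: "0 \<le> A" using C' by (simp add: A_def)
  have "err \<longlonglongrightarrow> A * (18 * C' * (sqrt (R' / 4) * 0 + sqrt R' * 0) + sqrt R' * 0 + 2 * 0) + 22472 * C' * exp (1 + C') * (R' / 4) * 0"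
    unfolding err_def by (intro tendsto_intros; real_asymp)
  then have err_ev: "\<forall>\<^sub>F N in sequentially. err N < \<kappa> / 4"
    using \<kappa>0 by (intro order_tendstoD(2)) auto
  show ?thesis
  proof (intro exI[of _ cR] conjI cR0 allI impI)
    fix \<Omega> :: "nat \<Rightarrow> real"
    assume \<Omega>: "\<forall>N. 0 < \<Omega> N" and small: "\<Omega> \<in> o(\<lambda>N. real N powr (1/15) / ln (real N))"
    have small_ev: "\<forall>\<^sub>F N in sequentially. norm (\<Omega> N) \<le> 1 * norm (real N powr (1/15) / ln (real N))"
      using landau_o.smallD[OF small, of 1] by simp
    have ev1: "\<forall>\<^sub>F N in sequentially. 10000000 * C'\<^sup>2 \<le> 4 / R' * ln (real N)" using R' by real_asymp
    have ev2: "\<forall>\<^sub>F N in sequentially. sqrt (real m) \<le> 4 / R' * ln (real N)" using R' by real_asymp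
    have ev3: "\<forall>\<^sub>F N in sequentially. R' \<le> real N powr (8/45)" by real_asymp
    have ev4: "\<forall>\<^sub>F N in sequentially. 1 \<le> ln (real N)" by real_asymp
    have "\<forall>\<^sub>F N in sequentially. norm (\<Omega> N) \<le> 1 * norm (real N powr (1/15) / ln (real N)) \<and>
        10000000 * C'\<^sup>2 \<le> 4 / R' * ln (real N) \<and> sqrt (real m) \<le> 4 / R' * ln (real N) \<and>
        R' \<le> real N powr (8/45) \<and> 1 \<le> ln (real N) \<and> err N < \<kappa> / 4 \<and> 0 < N"
      using small_ev ev1 ev2 ev3 ev4 err_ev eventually_gt_at_top[of 0] by eventually_elim blast
    then obtain N\<^sub>0 where N\<^sub>0: "\<And>N. N \<ge> N\<^sub>0 \<Longrightarrow> norm (\<Omega> N) \<le> 1 * norm (real N powr (1/15) / ln (real N)) \<and>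
        10000000 * C'\<^sup>2 \<le> 4 / R' * ln (real N) \<and> sqrt (real m) \<le> 4 / R' * ln (real N) \<and>
        R' \<le> real N powr (8/45) \<and> 1 \<le> ln (real N) \<and> err N < \<kappa> / 4 \<and> 0 < N"
      unfolding eventually_sequentially by blast
    show "\<exists>N\<^sub>0. \<forall>N\<ge>N\<^sub>0. \<forall>c\<^sub>0>1.
      \<forall>(M :: 'a measure) (\<rho> :: nat \<Rightarrow> complex) (\<eta> :: nat \<Rightarrow> 2 \<Rightarrow> 2 \<Rightarrow> 'a \<Rightarrow> complex).
        prob_space M \<longrightarrow>
        (\<forall>k\<in>{1..N}. cmod (\<rho> k)
            \<le> exp (- c\<^sub>0 * sqrt ((omega N (\<Omega> N) + (real N - real k)) / real N))) \<longrightarrow>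
        (\<forall>k\<in>{1..N}. \<forall>i j.
            \<eta> k i j \<in> borel_measurable M
          \<and> cmod (LINT w|M. \<eta> k i j w) \<le> C / (omega N (\<Omega> N) + (real N - real k))
          \<and> complex_variance M (\<eta> k i j) \<le> C / (omega N (\<Omega> N) + (real N - real k))
          \<and> (AE w in M. cmod (\<eta> k i j w)
               \<le> sqrt (R * \<Omega> N * ln (real N) / (omega N (\<Omega> N) + (real N - real k))))) \<longrightarrow>
        prob_space.indep_vars M (\<lambda>_. borel)
          (\<lambda>k w. transfer_matrix (\<rho> k) (\<lambda>i j. \<eta> k i j w)) {1..N} \<longrightarrow>
        (\<forall>\<epsilon> \<ge> (\<Omega> N * ln (real N)) powr (-1/2).
          measure M {w \<in> space M.
              op_norm (mat_prod (\<lambda>k. transfer_matrix (\<rho> k) (\<lambda>i j. \<eta> k i j w)) N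
                       - vector [vector [1, 0], vector [0, 0]]) \<ge> \<epsilon>}
            \<le> real N powr (- cR * \<epsilon>\<^sup>2 * \<Omega> N)
               + inverse cR * real N powr (4 - R * \<Omega> N))"
    proof (intro exI[of _ N\<^sub>0] allI impI)
      fix N c\<^sub>0 \<epsilon> and M :: "'a measure" and \<rho> :: "nat \<Rightarrow> complex" and \<eta> :: "nat \<Rightarrow> 2 \<Rightarrow> 2 \<Rightarrow> 'a \<Rightarrow> complex"
      assume N: "N\<^sub>0 \<le> N" and c\<^sub>0: "1 < (c\<^sub>0 :: real)" and M: "prob_space M"
        and rho: "\<forall>k\<in>{1..N}. cmod (\<rho> k) \<le> exp (- c\<^sub>0 * sqrt ((omega N (\<Omega> N) + (real N - real k)) / real N))"
        and eta: "\<forall>k\<in>{1..N}. \<forall>i j. \<eta> k i j \<in> borel_measurable M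
          \<and> cmod (LINT w|M. \<eta> k i j w) \<le> C / (omega N (\<Omega> N) + (real N - real k))
          \<and> complex_variance M (\<eta> k i j) \<le> C / (omega N (\<Omega> N) + (real N - real k))
          \<and> (AE w in M. cmod (\<eta> k i j w)
               \<le> sqrt (R * \<Omega> N * ln (real N) / (omega N (\<Omega> N) + (real N - real k))))"
        and ind: "prob_space.indep_vars M (\<lambda>_. borel) (\<lambda>k w. transfer_matrix (\<rho> k) (\<lambda>i j. \<eta> k i j w)) {1..N}"
        and \<epsilon>: "(\<Omega> N * ln (real N)) powr (-1/2) \<le> \<epsilon>"
      interpret prob_space M by (rule M)
      let ?P = "measure M {w \<in> space M.
              op_norm (mat_prod (\<lambda>k. transfer_matrix (\<rho> k) (\<lambda>i j. \<eta> k i j w)) N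
                       - vector [vector [1, 0], vector [0, 0]]) \<ge> \<epsilon>}"
      have N': "norm (\<Omega> N) \<le> 1 * norm (real N powr (1/15) / ln (real N))" "10000000 * C'\<^sup>2 \<le> 4 / R' * ln (real N)"
          "sqrt (real m) \<le> 4 / R' * ln (real N)" "R' \<le> real N powr (8/45)" "1 \<le> ln (real N)" "err N < \<kappa> / 4" "0 < N"
        using N\<^sub>0[OF N] by auto
      define L om where "L = \<Omega> N * ln (real N)" and "om = omega N (\<Omega> N)"
      have L0: "0 < L" using \<Omega> N'(5) by (simp add: L_def)
      have \<epsilon>0: "0 < \<epsilon>"
      proof -
        have "0 < L powr (-1/2)" using L0 by simp
        then show ?thesis using \<epsilon> unfolding L_def by linarith
      qed
      have \<epsilon>L: "1 \<le> \<epsilon>\<^sup>2 * L"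
      proof -
        have "L powr (-1) = (L powr (-1/2))\<^sup>2" by (simp add: power2_eq_square flip: powr_add)
        also have "\<dots> \<le> \<epsilon>\<^sup>2" using \<epsilon> by (intro power_mono) (auto simp: L_def)
        finally have "L powr (-1) * L \<le> \<epsilon>\<^sup>2 * L" using L0 by (intro mult_right_mono) auto
        then show ?thesis using L0 by (simp add: powr_minus)
      qed
      have rhs1: "real N powr (- cR * \<epsilon>\<^sup>2 * \<Omega> N) = exp (- (cR * (\<epsilon>\<^sup>2 * L)))"
        using N'(7) by (simp add: powr_def L_def mult_ac)
      have rhs2: "real N powr (4 - R * \<Omega> N) = exp (4 * ln N - R * L)"
        using N'(7) by (simp add: powr_def L_def algebra_simps)
      show "?P \<le> real N powr (- cR * \<epsilon>\<^sup>2 * \<Omega> N) + inverse cR * real N powr (4 - R * \<Omega> N)"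
      proof (cases "R * \<Omega> N \<le> 4")
        case True
        then have "1 \<le> real N powr (4 - R * \<Omega> N)" using N'(7) by (intro ge_one_powr_ge_zero) auto
        then have "1 * 1 \<le> inverse cR * real N powr (4 - R * \<Omega> N)" using cR_inv1 cR0 by (intro mult_mono) auto
        moreover have "0 \<le> real N powr (- cR * \<epsilon>\<^sup>2 * \<Omega> N)" by simp
        moreover have "?P \<le> 1" by (rule prob_le_1)
        ultimately show ?thesis by linarith
      next
        case False
        have lnN: "ln (real N) \<le> R' / 4 * L"
        proof -
          have "R * \<Omega> N \<le> R' * \<Omega> N" using R' \<Omega> by (intro mult_right_mono) (auto simp: less_imp_le)
          then have "4 \<le> R' * \<Omega> N" using False by linarith
          then have "4 * ln (real N) \<le> R' * \<Omega> N * ln (real N)" using N'(5) by (intro mult_right_mono) auto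
          then show ?thesis by (simp add: L_def)
        qed
        then have L_ge: "4 / R' * ln (real N) \<le> L" using R' by (simp add: field_simps)
        have L_le: "L \<le> real N powr (1/15)"
        proof -
          have "\<Omega> N \<le> real N powr (1/15) / ln (real N)" using N'(1,5) by auto
          then show ?thesis using N'(5) by (simp add: L_def field_simps)
        qed
        have om_eq: "om = real N powr (1/3) * L powr (2/3)" by (simp add: om_def omega_def L_def)
        have om0: "0 < om" using L0 N'(7) by (simp add: om_eq)
        \<comment> \<open>L^3 / om = L^(7/3) * N^(-1/3), and (7/3) / 15 - 1/3 = - 8/45.\<close>
        have L3: "L ^ 3 \<le> real N powr (-8/45) * om"
        proof -
          have "L ^ 3 = L powr 3" using L0 by simp
          also have "\<dots> = L powr (7/3) * L powr (2/3)" using L0 by (simp flip: powr_add)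
          also have "\<dots> \<le> (real N powr (1/15)) powr (7/3) * L powr (2/3)"
            using L_le L0 by (intro mult_right_mono powr_mono2) auto
          also have "(real N powr (1/15)) powr (7/3) = real N powr (-8/45) * real N powr (1/3)"
            using N'(7) by (simp add: powr_powr flip: powr_add)
          finally show ?thesis by (simp add: om_eq mult.assoc)
        qed
        have RL3: "R' * L ^ 3 \<le> om"
        proof -
          have "R' * L ^ 3 \<le> real N powr (8/45) * (real N powr (-8/45) * om)"
            using N'(4) L3 L0 R' om0 by (intro mult_mono) auto
          also have "\<dots> = om" using N'(7) by (simp flip: powr_add mult.assoc)
          finally show ?thesis .
        qed
        have loc: "random_transfer_product M N om L C' R' \<rho> \<eta>"
        proof unfold_locales
          show "1 \<le> C'" "1 \<le> R'" using C' R' by auto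
          show "om ^ 3 = L\<^sup>2 * real N"
          proof -
            have "om ^ 3 = om powr 3" using om0 by simp
            also have "\<dots> = (real N powr (1/3)) powr 3 * (L powr (2/3)) powr 3"
              unfolding om_eq by (rule powr_mult)
            also have "\<dots> = real N * L powr 2" using N'(7) by (simp add: powr_powr)
            finally show ?thesis using L0 by simp
          qed
          show "10000000 * C'\<^sup>2 \<le> L" using N'(2) L_ge by simp
          show "R' * L ^ 3 \<le> om" by (rule RL3)
          fix k assume k: "k \<in> {1..N}"
          have D: "0 < om + (real N - real k)" using om0 k by auto
          define q where "q = sqrt ((om + (real N - real k)) / real N)"
          have q: "0 \<le> q" using D by (simp add: q_def)
          have "cmod (\<rho> k) \<le> exp (- c\<^sub>0 * q)" using rho k by (auto simp: q_def om_def)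
          also have "\<dots> \<le> exp (- q)" using c\<^sub>0 q mult_right_mono[of 1 c\<^sub>0 q] by simp
          finally show "cmod (\<rho> k) \<le> exp (- sqrt ((om + (real N - real k)) / real N))" by (simp add: q_def)
          fix i j
          have E: "\<eta> k i j \<in> borel_measurable M" "cmod (LINT w|M. \<eta> k i j w) \<le> C / (om + (real N - real k))"
            "complex_variance M (\<eta> k i j) \<le> C / (om + (real N - real k))"
            "AE w in M. cmod (\<eta> k i j w) \<le> sqrt (R * \<Omega> N * ln (real N) / (om + (real N - real k)))"
            using eta k by (auto simp: om_def)
          show "\<eta> k i j \<in> borel_measurable M" by (rule E(1))
          have CC: "C / (om + (real N - real k)) \<le> C' / (om + (real N - real k))"
            using C' D by (intro divide_right_mono) auto
          show "cmod (LINT w|M. \<eta> k i j w) \<le> C' / (om + (real N - real k))" using E(2) CC by linarith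
          show "complex_variance M (\<eta> k i j) \<le> C' / (om + (real N - real k))" using E(3) CC by linarith
          have "R * L \<le> R' * L" using R' L0 by (intro mult_right_mono) auto
          then have le: "sqrt (R * \<Omega> N * ln (real N) / (om + (real N - real k))) \<le> sqrt (R' * L / (om + (real N - real k)))"
            using D by (intro real_sqrt_le_mono divide_right_mono) (auto simp: L_def mult.assoc)
          from E(4) show "AE w in M. cmod (\<eta> k i j w) \<le> sqrt (R' * L / (om + (real N - real k)))"
            by eventually_elim (use le in \<open>linarith\<close>)
        qed (rule ind)
        interpret T: random_transfer_product M N om L C' R' \<rho> \<eta> by (rule loc)
        have tail_rate: "T.tail_rate = c" by (simp add: T.tail_rate_def c_def)
        have P: "?P = T.deviation_prob \<epsilon>" by (simp add: T.U_def)
        have nn: "0 \<le> real N powr (- cR * \<epsilon>\<^sup>2 * \<Omega> N)" "0 \<le> inverse cR * real N powr (4 - R * \<Omega> N)" using cR0 by auto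
        consider "M2 \<le> \<epsilon>\<^sup>2" | "\<epsilon>\<^sup>2 < M2" "K0 \<le> \<epsilon>\<^sup>2 * L" | "\<epsilon>\<^sup>2 * L < K0" by linarith
        then show ?thesis
        proof cases
          case 1
          then have "?P \<le> 2 * exp (C' + 2 - R' * L)"
            unfolding P using \<epsilon>0 by (intro T.deviation_prob_large) (simp_all add: tail_rate M2_def)
          also have "\<dots> = 2 * exp (C' + 2) * exp (- (R' * L))" by (simp add: mult_exp_exp)
          also have "\<dots> \<le> inverse cR * exp (4 * ln N - R * L)"
          proof (intro mult_mono cR_inv)
            have "R * L \<le> R' * L" using R' L0 by (intro mult_right_mono) auto
            then show "exp (- (R' * L)) \<le> exp (4 * ln N - R * L)" using N'(5) by simp
          qed (use cR0 in auto)
          finally show ?thesis using nn unfolding rhs2 by linarith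
        next
          case 2
          define e where "e = \<epsilon>\<^sup>2 / M2"
          have cL: "c * L * e = c * (\<epsilon>\<^sup>2 * L) / M2" by (simp add: e_def)
          have big: "4 * (C' + 3) \<le> c * L * e"
          proof -
            have "c * K0 / M2 \<le> c * (\<epsilon>\<^sup>2 * L) / M2" using 2 c0 M2 by (intro divide_right_mono mult_left_mono) auto
            then show ?thesis unfolding cL using c0 M2 by (simp add: K0_def)
          qed
          have "?P \<le> 2 * exp (C' + 2 - c * L * e / 2)"
            unfolding P tail_rate[symmetric]
          proof (rule T.deviation_prob_moderate)
            show "0 < e" "e \<le> 1" using \<epsilon>0 M2 2 by (auto simp: e_def)
            show "1 \<le> T.tail_rate * L * e" using big C' by (simp add: tail_rate)
            show "e \<le> \<epsilon>\<^sup>2 / 4" unfolding e_def using M2 by (intro divide_left_mono) auto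
          qed (rule \<epsilon>0)
          also have "\<dots> \<le> exp 1 * exp (C' + 2 - c * L * e / 2)"
            using exp_ge_add_one_self[of 1] by (intro mult_right_mono) auto
          also have "\<dots> = exp (C' + 3 - c * L * e / 2)" by (simp flip: exp_add)
          also have "\<dots> \<le> exp (- (cR * (\<epsilon>\<^sup>2 * L)))"
          proof -
            have "cR * (\<epsilon>\<^sup>2 * L) \<le> c / (4 * M2) * (\<epsilon>\<^sup>2 * L)" using cR(1) \<epsilon>L by (intro mult_right_mono) auto
            also have "\<dots> = c * L * e / 4" by (simp add: e_def mult_ac)
            finally show ?thesis using big by simp
          qed
          finally show ?thesis using nn unfolding rhs1 by linarith
        next
          case 3
          define \<nu> where "\<nu> = real N powr (-4/45)"
          have \<nu>: "0 \<le> \<nu>" "\<nu>\<^sup>2 = real N powr (-8/45)"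
            using N'(7) by (simp_all add: \<nu>_def power2_eq_square flip: powr_add)
          have err: "T.char_error (2 * real m) + 22472 * C' * exp (1 + C') / L \<le> \<kappa> / 4"
          proof -
            have "1 / L \<le> 1 / (4 / R' * ln (real N))" using L_ge L0 R' N'(5) by (intro divide_left_mono) auto
            then have iL: "1 / L \<le> R' / 4 * (1 / ln (real N))" by simp
            have sL: "1 / sqrt L \<le> sqrt (R' / 4) * (1 / sqrt (ln (real N)))"
              using real_sqrt_le_mono[OF iL] by (simp add: real_sqrt_divide real_sqrt_mult)
            have "T.char_error (2 * real m) \<le> A * (18 * C' * (1 / sqrt L + sqrt R' * \<nu>) + sqrt R' * \<nu> * ln N + 2 * \<nu>\<^sup>2)"
              using T.char_error_le[of \<nu> "2 * real m"] \<nu> L3 by (simp add: A_def T.floor_const_def)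
            also have "\<dots> \<le> A * (18 * C' * (sqrt (R' / 4) * (1 / sqrt (ln (real N))) + sqrt R' * \<nu>) + sqrt R' * \<nu> * ln N + 2 * \<nu>\<^sup>2)"
              using sL A0 C' by (intro mult_left_mono add_right_mono) auto
            finally have e1: "T.char_error (2 * real m) \<le> \<dots>" .
            have "22472 * C' * exp (1 + C') * (1 / L) \<le> 22472 * C' * exp (1 + C') * (R' / 4 * (1 / ln (real N)))"
              using iL C' by (intro mult_left_mono) auto
            then have "22472 * C' * exp (1 + C') / L \<le> 22472 * C' * exp (1 + C') * (R' / 4) * (1 / ln (real N))" by simp
            with e1 have "T.char_error (2 * real m) + 22472 * C' * exp (1 + C') / L \<le> err N"
              unfolding err_def \<nu>(2) unfolding \<nu>_def by (simp add: mult.assoc)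
            then show ?thesis using N'(6) by simp
          qed
          have "?P \<le> 1 - ((1 / (2 * real m)) ^ 4 - T.char_error (2 * real m) - exp (- (sqrt (real m) / 96))
              - exp (C' - T.tail_rate * sqrt (real m) / 2)) + 22472 * C' * exp (1 + C') / L"
            unfolding P using \<epsilon>0 \<epsilon>L m(3,4) N'(3) L_ge by (intro T.deviation_prob_small) (auto simp: tail_rate)
          \<comment> \<open>Of the central coefficient \<kappa>, one quarter is lost to the cosine
            bound, one to the tail beyond Q, and one to the characteristic error together with the
            second column.\<close>
          also have "\<dots> \<le> 1 - \<kappa> / 4"
            using err m(1,2) unfolding tail_rate \<kappa>_def by linarith
          also have "\<dots> \<le> exp (- (\<kappa> / 4))" using exp_ge_add_one_self[of "- (\<kappa> / 4)"] by simp
          also have "\<dots> \<le> exp (- (cR * (\<epsilon>\<^sup>2 * L)))"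
          proof -
            have "cR * (\<epsilon>\<^sup>2 * L) \<le> \<kappa> / (4 * K0) * K0" using cR(2) 3 cR0 K0 \<kappa>0 \<epsilon>L by (intro mult_mono) auto
            then show ?thesis using K0 by simp
          qed
          finally show ?thesis using nn unfolding rhs1 by linarith
        qed
      qed
    qed
  qed
qed

end
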